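(* Let $H\in(\frac13,\frac12]$, let $\Gamma\in\mathbb{R}^{d\times d}$ be symmetric and positive-definite, let $\sigma$ be a real constant, and let $X$ be the fractional Ornstein-Uhlenbeck process which solves $dX_t=-\Gamma X_t\,dt+\sigma\,dB^H_t$, $X_0=0$. Then $$\frac1tA(t)=\frac1t\int_0^tX_s\otimes\circ\, d_{\mathfrak{R}_1}\mathbf{X}\ \to\ 0\quad\text{almost surely as }t\to\infty,$$ where the integral is the Stratonovich rough integral.
   Context: $B^H$ is a $d$-dimensional fractional Brownian motion (fBM) with Hurst parameter $H$: a continuous centred Gaussian process with independent components, each of covariance $\frac12(u^{2H}+s^{2H}-|u-s|^{2H})$. Rough paths. Fix $2<p<3$, $p>1/H$. A $p$-rough path over $\mathbb{R}^e$ on $[0,T]$ is a map $(s,t)\mapsto(1,Y_{s,t},\mathbb{Y}_{s,t})$, $0\le s<t\le T$, with $Y_{s,t}=Y_t-Y_s\in\mathbb{R}^e$ for a continuous path $Y$, $\mathbb{Y}_{s,t}\in\mathbb{R}^e\otimes\mathbb{R}^e$, satisfying Chen's identity $\mathbb{Y}_{s,t}-\mathbb{Y}_{s,u}-\mathbb{Y}_{u,t}=Y_{s,u}\otimes Y_{u,t}$ and having finite $p$-variation: there is a control $\omega$ (nonnegative, continuous, super-additive, zero on the diagonal) with $|Y_{s,t}|\le\omega(s,t)^{1/p}$, $|\mathbb{Y}_{s,t}|\le\omega(s,t)^{2/p}$. The rough integral $\int F(Y)\,d_{\mathfrak R}\mathbf{Y}$ is the rough path with first level $I^1_{u,v}=\int_u^vF(Y)\,d_{\mathfrak{R}_1}\mathbf{Y}=\lim_{|\mathcal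 P|\to0}\sum_{[s,t]\in\mathcal P}\big(F(Y_s)Y_{s,t}+DF(Y_s)\mathbb{Y}_{s,t}\big)$ and second level $\lim_{|\mathcal P|\to0}\sum_{[s,t]\in\mathcal P}\big(I^1_{u,s}\otimes I^1_{s,t}+F(Y_s)\otimes F(Y_s)\mathbb{Y}_{s,t}\big)$, limits over finite partitions of $[u,v]$. Stratonovich lifts. $\mathbf{B}^{H,\mathrm{Str}}=(1,B^H,\mathbb{B}^{H,\mathrm{Str}})$ is the canonical geometric rough path over $B^H$ (a.s. limit in $p$-variation of the iterated-integral lifts of dyadic piecewise linear approximations). The Stratonovich lift $\mathbf{X}=(1,X,\mathbb{X}^{\mathrm{Str}})$ of $X$ is the $X$-block of the unique $p$-rough path $\mathbf{Z}$ over $Z_t=(B^H_t,X_t,t)$ solving the rough differential equation $d_{\mathfrak R}\mathbf{Z}=f(Z)\,d_{\mathfrak R}\mathbf{Z}$ (both levels of $\mathbf Z$ equal those of $\int f(Z)\,d_{\mathfrak R}\mathbf Z$), $f(x,y,t)(\xi,\eta,\tau)=(\xi,-\Gamma y\tau+\sigma\xi,\tau)$, whose $(B^H,t)$-part is $\mathbf{B}^{H,\mathrm{Str}}$ joined with $t$ through Young integrals. The Stratonovich rough integral is $\int_0^tX_s\otimes\circ\,d_{\mathfrak{R}_1}\mathbf{X}=\mathbb{X}^{\mathrm{Str}}_{0,t}+X_0\otimes X_{0,t}$, i.e. the first-level rough integral of $F(x)\xi=x\otimes\xi$ against this lift; $A(t)$ denotes this $d\times d$ matrix. *)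

theory Defs
  imports "HOL-Probability.Probability"
begin

section \<open>Fractional Brownian motion\<close>

text \<open>The second disjunct admits degenerate (zero variance) centred Gaussian variables.\<close>

definition centred_gaussian_rv :: "'w measure \<Rightarrow> ('w \<Rightarrow> real) \<Rightarrow> bool" where
  "centred_gaussian_rv M Y \<longleftrightarrow> Y \<in> borel_measurable M \<and>
     ((\<exists>s>0. distributed M lborel Y (normal_density 0 s)) \<or> (AE w in M. Y w = 0))"

definition centred_gaussian_process ::
  "'w measure \<Rightarrow> real set \<Rightarrow> (real \<Rightarrow> 'w \<Rightarrow> real) \<Rightarrow> bool" where
  "centred_gaussian_process M I Y \<longleftrightarrow>
     (\<forall>J c. finite J \<and> J \<subseteq> I \<longrightarrow> centred_gaussian_rv M (\<lambda>w. \<Sum>t\<in>J. c t * Y t w))"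

definition fractional_brownian_motion ::
  "'w measure \<Rightarrow> real \<Rightarrow> (real \<Rightarrow> 'w \<Rightarrow> real ^ 'd) \<Rightarrow> bool" where
  "fractional_brownian_motion M H B \<longleftrightarrow>
     (AE w in M. continuous_on {0..} (\<lambda>t. B t w)) \<and>
     prob_space.indep_vars M (\<lambda>_::'d. PiM {0..} (\<lambda>_. borel))
       (\<lambda>i w. \<lambda>t\<in>{0..}. B t w $ i) UNIV \<and>
     (\<forall>i. centred_gaussian_process M {0..} (\<lambda>t w. B t w $ i)) \<and>
     (\<forall>i. \<forall>u\<ge>0. \<forall>s\<ge>0. prob_space.expectation M (\<lambda>w. B u w $ i * B s w $ i) =
        (1/2) * (u powr (2*H) + s powr (2*H) - \<bar>u - s\<bar> powr (2*H)))"


section \<open>Limits along partitions\<close>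

text \<open>A partition of \<open>[u,v]\<close> is given by its points \<open>D 0 < \<dots> < D n\<close>. For \<open>u = v\<close> the only
  partition is the trivial one (\<open>n = 0\<close>), so all limits over \<open>[u,u]\<close> are \<open>0\<close>.\<close>

definition is_partition :: "real \<Rightarrow> real \<Rightarrow> nat \<Rightarrow> (nat \<Rightarrow> real) \<Rightarrow> bool" where
  "is_partition u v n D \<longleftrightarrow> D 0 = u \<and> D n = v \<and> (\<forall>i<n. D i < D (Suc i))"

definition has_partition_limit ::
  "(real \<Rightarrow> real \<Rightarrow> 'a::real_normed_vector) \<Rightarrow> real \<Rightarrow> real \<Rightarrow> 'a \<Rightarrow> bool" where
  "has_partition_limit \<Xi> u v L \<longleftrightarrow>
     (\<forall>\<epsilon>>0. \<exists>\<delta>>0. \<forall>n D. is_partition u v n D \<and> (\<forall>i<n. D (Suc i) - D i < \<delta>) \<longrightarrow>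
        norm ((\<Sum>i<n. \<Xi> (D i) (D (Suc i))) - L) < \<epsilon>)"

definition partition_limit ::
  "(real \<Rightarrow> real \<Rightarrow> 'a::real_normed_vector) \<Rightarrow> real \<Rightarrow> real \<Rightarrow> 'a" where
  "partition_limit \<Xi> u v = (THE L. has_partition_limit \<Xi> u v L)"

lemma has_partition_limit_unique:
  assumes "u \<le> v" "has_partition_limit \<Xi> u v L" "has_partition_limit \<Xi> u v L'"
  shows "L = L'"
proof (rule ccontr)
  assume "L \<noteq> L'"
  define \<epsilon> where "\<epsilon> = norm (L - L') / 2"
  have "\<epsilon> > 0" using \<open>L \<noteq> L'\<close> by (simp add: \<epsilon>_def)
  obtain \<delta> where d: "\<delta> > 0"
    "\<And>n D. is_partition u v n D \<Longrightarrow> \<forall>i<n. D (Suc i) - D i < \<delta> \<Longrightarrow>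
        norm ((\<Sum>i<n. \<Xi> (D i) (D (Suc i))) - L) < \<epsilon>"
    using assms(2) \<open>\<epsilon> > 0\<close> unfolding has_partition_limit_def by meson
  obtain \<delta>' where d': "\<delta>' > 0"
    "\<And>n D. is_partition u v n D \<Longrightarrow> \<forall>i<n. D (Suc i) - D i < \<delta>' \<Longrightarrow>
        norm ((\<Sum>i<n. \<Xi> (D i) (D (Suc i))) - L') < \<epsilon>"
    using assms(3) \<open>\<epsilon> > 0\<close> unfolding has_partition_limit_def by meson
  have "\<exists>n D. is_partition u v n D \<and> (\<forall>i<n. D (Suc i) - D i < min \<delta> \<delta>')"
  proof (cases "u = v")
    case True
    then have "is_partition u v 0 (\<lambda>_. u)" by (simp add: is_partition_def)
    then show ?thesis by (meson not_less_zero)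
  next
    case False
    with assms(1) have uv: "u < v" by simp
    obtain n where n: "(v - u) / min \<delta> \<delta>' < real n" using reals_Archimedean2 by blast
    have mpos: "min \<delta> \<delta>' > 0" using d(1) d'(1) by simp
    with uv have "(v - u) / min \<delta> \<delta>' > 0" by simp
    with n have npos: "real n > 0" by linarith
    define D where "D i = u + (v - u) / real n * real i" for i
    have step: "D (Suc i) - D i = (v - u) / real n" for i
      using npos by (simp add: D_def field_simps)
    have pos: "(v - u) / real n > 0" using uv npos by simp
    have "D i < D (Suc i)" for i using step[of i] pos by linarith
    then have "is_partition u v n D" using npos by (simp add: is_partition_def D_def)
    moreover have "v - u < min \<delta> \<delta>' * real n"
      using n mpos by (simp only: pos_divide_less_eq mult.commute)
    then have "(v - u) / real n < min \<delta> \<delta>'"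
      by (simp only: pos_divide_less_eq[OF npos])
    then have "\<forall>i<n. D (Suc i) - D i < min \<delta> \<delta>'"
      unfolding step by blast
    ultimately show ?thesis by blast
  qed
  then obtain n D where D: "is_partition u v n D" "\<forall>i<n. D (Suc i) - D i < min \<delta> \<delta>'" by blast
  let ?S = "\<Sum>i<n. \<Xi> (D i) (D (Suc i))"
  have "norm (?S - L) < \<epsilon>" "norm (?S - L') < \<epsilon>" using d(2) d'(2) D by auto
  moreover have "norm (L - L') \<le> norm (?S - L) + norm (?S - L')"
    using norm_triangle_ineq4[of "?S - L'" "?S - L"] by simp
  ultimately show False by (simp add: \<epsilon>_def)
qed

lemma partition_limit_eqI:
  assumes "u \<le> v" "has_partition_limit \<Xi> u v L"
  shows "partition_limit \<Xi> u v = L"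
  unfolding partition_limit_def using assms has_partition_limit_unique by blast


section \<open>Rough paths\<close>

text \<open>\<open>\<real>\<^sup>e \<otimes> \<real>\<^sup>e\<close> is represented by matrices; the norm on \<^typ>\<open>real ^ 'e ^ 'e\<close> is the Euclidean
  (Hilbert-Schmidt) one.\<close>

definition tensor :: "real ^ 'e \<Rightarrow> real ^ 'f \<Rightarrow> real ^ 'f ^ 'e" (infixl "\<otimes>\<^sub>t" 75) where
  "x \<otimes>\<^sub>t y = (\<chi> i j. x $ i * y $ j)"

definition is_control :: "real \<Rightarrow> (real \<Rightarrow> real \<Rightarrow> real) \<Rightarrow> bool" where
  "is_control T \<omega> \<longleftrightarrow>
     continuous_on {(s, t). 0 \<le> s \<and> s \<le> t \<and> t \<le> T} (\<lambda>(s, t). \<omega> s t) \<and>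
     (\<forall>s t. 0 \<le> s \<and> s \<le> t \<and> t \<le> T \<longrightarrow> 0 \<le> \<omega> s t) \<and>
     (\<forall>s u t. 0 \<le> s \<and> s \<le> u \<and> u \<le> t \<and> t \<le> T \<longrightarrow> \<omega> s u + \<omega> u t \<le> \<omega> s t) \<and>
     (\<forall>t. 0 \<le> t \<and> t \<le> T \<longrightarrow> \<omega> t t = 0)"

text \<open>The rough path \<open>(s,t) \<mapsto> (1, Y t - Y s, YY s t)\<close> is represented by \<open>Y\<close> and \<open>YY\<close>; values of \<open>YY\<close>
  off \<open>0 \<le> s < t \<le> T\<close> are irrelevant.\<close>

definition rough_path ::
  "real \<Rightarrow> real \<Rightarrow> (real \<Rightarrow> real ^ 'e) \<Rightarrow> (real \<Rightarrow> real \<Rightarrow> real ^ 'e ^ 'e) \<Rightarrow> bool" where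
  "rough_path p T Y YY \<longleftrightarrow>
     continuous_on {0..T} Y \<and>
     (\<forall>s u t. 0 \<le> s \<and> s < u \<and> u < t \<and> t \<le> T \<longrightarrow>
        YY s t - YY s u - YY u t = (Y u - Y s) \<otimes>\<^sub>t (Y t - Y u)) \<and>
     (\<exists>\<omega>. is_control T \<omega> \<and>
        (\<forall>s t. 0 \<le> s \<and> s < t \<and> t \<le> T \<longrightarrow>
           norm (Y t - Y s) \<le> \<omega> s t powr (1/p) \<and> norm (YY s t) \<le> \<omega> s t powr (2/p)))"

text \<open>An integrand \<open>F : \<real>\<^sup>e \<rightarrow> L(\<real>\<^sup>e, W)\<close> is curried, \<open>F y \<xi>\<close> being linear in \<open>\<xi>\<close>. Its derivative
  acts on tensors by \<open>DF(y)(a \<otimes> b) = (DF(y) a) b\<close>, extended linearly.\<close>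

definition deriv_on_tensor ::
  "(real ^ 'e \<Rightarrow> real ^ 'e \<Rightarrow> 'b::real_normed_vector) \<Rightarrow> real ^ 'e \<Rightarrow> real ^ 'e ^ 'e \<Rightarrow> 'b" where
  "deriv_on_tensor F y m = (\<Sum>i\<in>UNIV. \<Sum>j\<in>UNIV.
     m $ i $ j *\<^sub>R frechet_derivative (\<lambda>z. F z (axis j 1)) (at y) (axis i 1))"

definition tensor_square_map ::
  "(real ^ 'e \<Rightarrow> real ^ 'f) \<Rightarrow> real ^ 'e ^ 'e \<Rightarrow> real ^ 'f ^ 'f" where
  "tensor_square_map G m =
     (\<Sum>i\<in>UNIV. \<Sum>j\<in>UNIV. m $ i $ j *\<^sub>R (G (axis i 1) \<otimes>\<^sub>t G (axis j 1)))"

definition rough_germ1 ::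
  "(real ^ 'e \<Rightarrow> real ^ 'e \<Rightarrow> 'b::real_normed_vector) \<Rightarrow> (real \<Rightarrow> real ^ 'e) \<Rightarrow>
   (real \<Rightarrow> real \<Rightarrow> real ^ 'e ^ 'e) \<Rightarrow> real \<Rightarrow> real \<Rightarrow> 'b" where
  "rough_germ1 F Y YY s t = F (Y s) (Y t - Y s) + deriv_on_tensor F (Y s) (YY s t)"

definition has_rough_integral1 ::
  "(real ^ 'e \<Rightarrow> real ^ 'e \<Rightarrow> 'b::real_normed_vector) \<Rightarrow> (real \<Rightarrow> real ^ 'e) \<Rightarrow>
   (real \<Rightarrow> real \<Rightarrow> real ^ 'e ^ 'e) \<Rightarrow> real \<Rightarrow> real \<Rightarrow> 'b \<Rightarrow> bool" where
  "has_rough_integral1 F Y YY u v L \<longleftrightarrow> has_partition_limit (rough_germ1 F Y YY) u v L"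

definition rough_integral1 ::
  "(real ^ 'e \<Rightarrow> real ^ 'e \<Rightarrow> 'b::real_normed_vector) \<Rightarrow> (real \<Rightarrow> real ^ 'e) \<Rightarrow>
   (real \<Rightarrow> real \<Rightarrow> real ^ 'e ^ 'e) \<Rightarrow> real \<Rightarrow> real \<Rightarrow> 'b" where
  "rough_integral1 F Y YY u v = partition_limit (rough_germ1 F Y YY) u v"

definition has_rough_integral2 ::
  "(real ^ 'e \<Rightarrow> real ^ 'e \<Rightarrow> real ^ 'f) \<Rightarrow> (real \<Rightarrow> real ^ 'e) \<Rightarrow>
   (real \<Rightarrow> real \<Rightarrow> real ^ 'e ^ 'e) \<Rightarrow> real \<Rightarrow> real \<Rightarrow> real ^ 'f ^ 'f \<Rightarrow> bool" where
  "has_rough_integral2 F Y YY u v L \<longleftrightarrow>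
     has_partition_limit
       (\<lambda>s t. rough_integral1 F Y YY u s \<otimes>\<^sub>t rough_integral1 F Y YY s t
              + tensor_square_map (F (Y s)) (YY s t)) u v L"

text \<open>The equation \<open>d\<^bold>Z = f(Z) d\<^bold>Z\<close> on \<open>[0,T]\<close>, at both levels.\<close>

definition solves_rde ::
  "real \<Rightarrow> (real ^ 'e \<Rightarrow> real ^ 'e \<Rightarrow> real ^ 'e) \<Rightarrow> (real \<Rightarrow> real ^ 'e) \<Rightarrow>
   (real \<Rightarrow> real \<Rightarrow> real ^ 'e ^ 'e) \<Rightarrow> bool" where
  "solves_rde T f Z ZZ \<longleftrightarrow>
     (\<forall>u v. 0 \<le> u \<and> u < v \<and> v \<le> T \<longrightarrow>
        has_rough_integral1 f Z ZZ u v (Z v - Z u) \<and> has_rough_integral2 f Z ZZ u v (ZZ u v))"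


section \<open>Canonical lift of the driving path\<close>

definition dyadic_interpolation :: "nat \<Rightarrow> (real \<Rightarrow> real ^ 'd) \<Rightarrow> real \<Rightarrow> real ^ 'd" where
  "dyadic_interpolation n b t =
     (let k = of_int \<lfloor>2 ^ n * t\<rfloor> in
       b (k / 2 ^ n) + (2 ^ n * t - k) *\<^sub>R (b ((k + 1) / 2 ^ n) - b (k / 2 ^ n)))"

text \<open>The iterated integral \<open>\<integral>\<^sub>s\<^sup>t (y\<^sub>r - y\<^sub>s) \<otimes> dy\<^sub>r\<close> as a Riemann-Stieltjes integral.\<close>

definition iterated_integral :: "(real \<Rightarrow> real ^ 'e) \<Rightarrow> real \<Rightarrow> real \<Rightarrow> real ^ 'e ^ 'e" where
  "iterated_integral y s t = partition_limit (\<lambda>q r. (y q - y s) \<otimes>\<^sub>t (y r - y q)) s t"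

definition p_variation ::
  "real \<Rightarrow> real \<Rightarrow> (real \<Rightarrow> real \<Rightarrow> 'a::real_normed_vector) \<Rightarrow> ennreal" where
  "p_variation q T \<Xi> = (SUP (n, D) \<in> {(n, D). is_partition 0 T n D}.
     ennreal ((\<Sum>i<n. norm (\<Xi> (D i) (D (Suc i))) powr q) powr (1/q)))"

definition canonical_lift ::
  "real \<Rightarrow> (real \<Rightarrow> real ^ 'd) \<Rightarrow> (real \<Rightarrow> real \<Rightarrow> real ^ 'd ^ 'd) \<Rightarrow> bool" where
  "canonical_lift p b bb \<longleftrightarrow>
     (\<forall>T>0. rough_path p T b bb \<and>
       (\<lambda>n. p_variation p T
          (\<lambda>s t. (dyadic_interpolation n b t - dyadic_interpolation n b s) - (b t - b s)))
         \<longlonglongrightarrow> 0 \<and>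
       (\<lambda>n. p_variation (p/2) T
          (\<lambda>s t. iterated_integral (dyadic_interpolation n b) s t - bb s t))
         \<longlonglongrightarrow> 0)"


section \<open>Fractional Ornstein-Uhlenbeck process and its Stratonovich lift\<close>

definition fractional_ou ::
  "'w measure \<Rightarrow> real ^ 'd ^ 'd \<Rightarrow> real \<Rightarrow> (real \<Rightarrow> 'w \<Rightarrow> real ^ 'd) \<Rightarrow>
   (real \<Rightarrow> 'w \<Rightarrow> real ^ 'd) \<Rightarrow> bool" where
  "fractional_ou M \<Gamma> \<sigma> B X \<longleftrightarrow>
     (\<forall>t\<ge>0. X t \<in> borel_measurable M) \<and>
     (AE w in M. continuous_on {0..} (\<lambda>t. X t w) \<and> X 0 w = 0 \<and>
        (\<forall>t\<ge>0. X t w - X 0 w =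
           - integral {0..t} (\<lambda>s. \<Gamma> *v X s w) + \<sigma> *\<^sub>R (B t w - B 0 w)))"

text \<open>\<open>\<real>\<^sup>d \<times> \<real>\<^sup>d \<times> \<real>\<close> is \<^typ>\<open>real ^ ('d + 'd + unit)\<close>, with blocks \<open>Inl i\<close>, \<open>Inr (Inl i)\<close> and
  \<open>Inr (Inr ())\<close>.\<close>

definition join3 :: "real ^ 'd \<Rightarrow> real ^ 'd \<Rightarrow> real \<Rightarrow> real ^ ('d + 'd + unit)" where
  "join3 x y t = (\<chi> k. case k of Inl i \<Rightarrow> x $ i | Inr (Inl i) \<Rightarrow> y $ i | Inr (Inr _) \<Rightarrow> t)"

definition ou_field ::
  "real ^ 'd ^ 'd \<Rightarrow> real \<Rightarrow> real ^ ('d + 'd + unit) \<Rightarrow> real ^ ('d + 'd + unit) \<Rightarrow>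
   real ^ ('d + 'd + unit)" where
  "ou_field \<Gamma> \<sigma> z \<zeta> =
     (let y = (\<chi> i. z $ Inr (Inl i)); \<xi> = (\<chi> i. \<zeta> $ Inl i); \<tau> = \<zeta> $ Inr (Inr ())
      in join3 \<xi> (- (\<tau> *\<^sub>R (\<Gamma> *v y)) + \<sigma> *\<^sub>R \<xi>) \<tau>)"

text \<open>The \<open>(b,t)\<close>-part of the second level: \<open>bb\<close> in the \<open>b\<close>-block, and the Young integrals
  \<open>\<integral>\<^sub>s\<^sup>t (b\<^sub>r - b\<^sub>s) dr\<close>, \<open>\<integral>\<^sub>s\<^sup>t (r - s) db\<^sub>r\<close> and \<open>\<integral>\<^sub>s\<^sup>t (r - s) dr\<close> in the others.\<close>

definition driver_part ::
  "real \<Rightarrow> (real \<Rightarrow> real ^ 'd) \<Rightarrow> (real \<Rightarrow> real \<Rightarrow> real ^ 'd ^ 'd) \<Rightarrow>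
   (real \<Rightarrow> real \<Rightarrow> real ^ ('d + 'd + unit) ^ ('d + 'd + unit)) \<Rightarrow> bool" where
  "driver_part T b bb ZZ \<longleftrightarrow>
     (\<forall>s t. 0 \<le> s \<and> s < t \<and> t \<le> T \<longrightarrow>
        (\<forall>i j. ZZ s t $ Inl i $ Inl j = bb s t $ i $ j) \<and>
        (\<forall>i. has_partition_limit (\<lambda>q r. (b q $ i - b s $ i) * (r - q)) s t
               (ZZ s t $ Inl i $ Inr (Inr ()))) \<and>
        (\<forall>i. has_partition_limit (\<lambda>q r. (q - s) * (b r $ i - b q $ i)) s t
               (ZZ s t $ Inr (Inr ()) $ Inl i)) \<and>
        has_partition_limit (\<lambda>q r. (q - s) * (r - q)) s t
          (ZZ s t $ Inr (Inr ()) $ Inr (Inr ())))"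

definition stratonovich_lift ::
  "real \<Rightarrow> real ^ 'd ^ 'd \<Rightarrow> real \<Rightarrow> (real \<Rightarrow> real ^ 'd) \<Rightarrow> (real \<Rightarrow> real \<Rightarrow> real ^ 'd ^ 'd) \<Rightarrow>
   (real \<Rightarrow> real ^ 'd) \<Rightarrow> (real \<Rightarrow> real \<Rightarrow> real ^ 'd ^ 'd) \<Rightarrow> bool" where
  "stratonovich_lift p \<Gamma> \<sigma> b bb x xx \<longleftrightarrow>
     (\<forall>T>0. \<exists>ZZ. rough_path p T (\<lambda>t. join3 (b t) (x t) t) ZZ \<and>
       solves_rde T (ou_field \<Gamma> \<sigma>) (\<lambda>t. join3 (b t) (x t) t) ZZ \<and>
       driver_part T b bb ZZ \<and>
       (\<forall>s t. 0 \<le> s \<and> s < t \<and> t \<le> T \<longrightarrow>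
          (\<forall>i j. xx s t $ i $ j = ZZ s t $ Inr (Inl i) $ Inr (Inl j))))"

definition stratonovich_integral ::
  "(real \<Rightarrow> real ^ 'd) \<Rightarrow> (real \<Rightarrow> real \<Rightarrow> real ^ 'd ^ 'd) \<Rightarrow> real \<Rightarrow> real ^ 'd ^ 'd" where
  "stratonovich_integral x xx t = rough_integral1 (\<lambda>y \<xi>. y \<otimes>\<^sub>t \<xi>) x xx 0 t"

lemma stratonovich_integral_eq:
  fixes x :: "real \<Rightarrow> real ^ 'd"
  assumes "rough_path p T x xx" "0 < t" "t \<le> T"
  shows "stratonovich_integral x xx t = xx 0 t + x 0 \<otimes>\<^sub>t (x t - x 0)"
proof -
  let ?F = "\<lambda>(y::real ^ 'd) (\<xi>::real ^ 'd). y \<otimes>\<^sub>t \<xi>"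
  have lin: "bounded_linear (\<lambda>z. ?F z b)" for b
    by (rule linear_conv_bounded_linear[THEN iffD1], rule linearI)
       (auto simp: tensor_def vec_eq_iff algebra_simps)
  have fd: "frechet_derivative (\<lambda>z. ?F z b) (at y) = (\<lambda>z. ?F z b)" for b y
    using frechet_derivative_at[OF bounded_linear_imp_has_derivative[OF lin]] by metis
  have "deriv_on_tensor ?F y m $ k $ l = m $ k $ l" for y and m :: "real ^ 'd ^ 'd" and k l
  proof -
    have *: "(m $ i $ j *\<^sub>R (axis i 1 \<otimes>\<^sub>t axis j 1)) $ k $ l =
        (if j = l then (if i = k then m $ i $ j else 0) else 0)" for i j
      by (auto simp: tensor_def axis_def)
    have "deriv_on_tensor ?F y m $ k $ l =
        (\<Sum>i\<in>UNIV. \<Sum>j\<in>UNIV. if j = l then (if i = k then m $ i $ j else 0) else 0)"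
      unfolding deriv_on_tensor_def fd by (simp only: sum_component *)
    then show ?thesis by (simp add: sum.delta)
  qed
  then have dt: "deriv_on_tensor ?F y m = m" for y m by (simp add: vec_eq_iff)
  have germ: "rough_germ1 ?F x xx s r = xx s r + x s \<otimes>\<^sub>t (x r - x s)" for s r
    by (simp add: rough_germ1_def dt)
  have sum: "(\<Sum>i<n. rough_germ1 ?F x xx (D i) (D (Suc i))) = xx 0 (D n) + x 0 \<otimes>\<^sub>t (x (D n) - x 0)"
    if "D 0 = 0" "\<forall>i<n. D i < D (Suc i)" "D n \<le> T" "n > 0" for n and D :: "nat \<Rightarrow> real"
    using that
  proof (induction n)
    case (Suc n)
    show ?case
    proof (cases "n = 0")
      case True
      then show ?thesis using Suc.prems by (simp add: germ)
    next
      case False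
      have mono: "D 0 < D n"
        using False Suc.prems(2)
      proof (induction n)
        case (Suc m)
        then show ?case by (cases "m = 0") (auto intro: less_trans)
      qed simp
      have lt: "D n < D (Suc n)" using Suc.prems(2) by simp
      have "xx 0 (D (Suc n)) - xx 0 (D n) - xx (D n) (D (Suc n)) =
          (x (D n) - x 0) \<otimes>\<^sub>t (x (D (Suc n)) - x (D n))"
        using assms(1) mono lt Suc.prems unfolding rough_path_def by auto
      moreover have "(\<Sum>i<n. rough_germ1 ?F x xx (D i) (D (Suc i))) =
          xx 0 (D n) + x 0 \<otimes>\<^sub>t (x (D n) - x 0)"
        using Suc.IH Suc.prems lt False by auto
      ultimately show ?thesis
        by (simp add: germ) (simp add: tensor_def vec_eq_iff algebra_simps)
    qed
  qed simp
  have "has_partition_limit (rough_germ1 ?F x xx) 0 t (xx 0 t + x 0 \<otimes>\<^sub>t (x t - x 0))"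
    unfolding has_partition_limit_def
  proof (intro allI impI exI[of _ 1] conjI)
    fix \<epsilon> :: real and n and D :: "nat \<Rightarrow> real"
    assume e: "\<epsilon> > 0" and D: "is_partition 0 t n D \<and> (\<forall>i<n. D (Suc i) - D i < 1)"
    then have "n > 0" using assms(2) by (cases n) (auto simp: is_partition_def)
    then show "norm ((\<Sum>i<n. rough_germ1 ?F x xx (D i) (D (Suc i))) -
        (xx 0 t + x 0 \<otimes>\<^sub>t (x t - x 0))) < \<epsilon>"
      using sum[of D n] D e assms(3) by (auto simp: is_partition_def)
  qed simp
  then show ?thesis
    unfolding stratonovich_integral_def rough_integral1_def
    by (rule partition_limit_eqI[OF less_imp_le[OF assms(2)]])
qed

end

theory Submission
  imports Defs
begin

text \<open>The second level of the rough differential equation, Chen's relation and the canonical lift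
  show that the Stratonovich lift of \<open>X\<close> over a dyadic interval is the limit of the trapezoidal sums
  \<open>\<Sum> (X\<^sub>k + X\<^bsub>k+1\<^esub>)/2 \<otimes> (X\<^bsub>k+1\<^esub> - X\<^sub>k)\<close>. In an orthonormal eigenbasis of \<open>\<Gamma>\<close> the coordinates \<open>x, y\<close> of \<open>X\<close>
  for eigenvalues \<open>\<mu>, \<nu>\<close> solve scalar Ornstein--Uhlenbeck equations with uncorrelated drivers \<open>\<beta>, \<gamma>\<close>.
  With \<open>N = \<sigma> \<integral> x \<circ> d\<gamma>\<close> and \<open>N' = \<sigma> \<integral> y \<circ> d\<beta>\<close>, the product rule gives
  \<open>(\<mu> + \<nu>) \<integral> x y dt = N + N' - x\<^sub>t y\<^sub>t\<close>, so no ergodic theorem is needed: it is enough that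
  \<open>N\<^sub>t/t\<close> and \<open>x\<^sub>t\<^sup>2/t\<close> vanish almost surely. By Wick's formula the second moment of a Riemann sum for \<open>N\<close>
  is a double sum of products of covariances; since the increments of \<open>\<gamma>\<close> are negatively correlated and
  their covariances telescope, it is \<open>O(|t - s|\<^bsup>4/3\<^esup>)\<close>. Dyadic chaining over the integers
  (as in the Rademacher--Menshov theorem) and inside unit intervals turns this into almost sure
  sublinear growth.\<close>

subsection \<open>Symmetric matrices\<close>

text \<open>The solution \<open>X\<close> is given pathwise and is not known to lie in the span of
  finitely many driver values, and \<open>XX\<close> carries no measurability. Moments are therefore
  computed for the Euler scheme \<open>ou_euler\<close>, a finite linear combination of driver
  values; Fatou's lemma carries them to a liminf, and pathwise limits are compared with it outside a
  null set that depends on the drivers alone. The sums of \<open>bb\<close> over small intervals and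
  the sums of products of increments need not converge separately as the mesh shrinks; only their
  trapezoidal combination does, hence the rewriting of the lift. For a short interval of length
  \<open>t\<close> the plain sum has second moment bounded by order \<open>t powr (2*H)\<close>
  only, which is not summable over the \<open>2 ^ j\<close> intervals of level \<open>j\<close>.
  Subtracting the integrand's value at the left end improves this to \<open>t powr (4/3)\<close>;
  the subtracted term, a value of \<open>x\<close> times an increment of \<gamma>, is bounded path
  by path. The condition \<open>H > 1/3\<close> enters through \<open>\<theta> \<le> 2*H\<close> and
  through fourth moments of order \<open>t powr (4*H)\<close>, at most \<open>t powr (4/3)\<close>
  for \<open>t \<le> 1\<close>.\<close>

text \<open>A maximiser \<open>v\<close> of the Rayleigh quotient over the unit sphere of
  \<open>S\<close> is an eigenvector: varying it along the residual
  \<open>c *\<^sub>R v - f v\<close> would otherwise increase the quotient.\<close>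

lemma self_adjoint_eigenvector:
  fixes f :: "'a::euclidean_space \<Rightarrow> 'a"
  assumes f: "linear f" and adj: "\<And>x y. f x \<bullet> y = x \<bullet> f y"
    and S: "subspace S" "f ` S \<subseteq> S" "S \<noteq> {0}"
  shows "\<exists>v\<in>S. norm v = 1 \<and> (\<exists>c. f v = c *\<^sub>R v)"
proof -
  let ?K = "S \<inter> sphere 0 1"
  obtain s where s: "s \<in> S" "s \<noteq> 0" using S subspace_0 by auto
  then have "s /\<^sub>R norm s \<in> ?K" using S(1) by (simp add: subspace_scale)
  moreover have "compact ?K" using closed_subspace[OF S(1)] by (simp add: closed_Int_compact)
  moreover have "continuous_on ?K (\<lambda>x. x \<bullet> f x)"
    by (intro continuous_intros linear_continuous_on linear_conv_bounded_linear[THEN iffD1] f)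
  ultimately obtain v where v: "v \<in> ?K" "\<And>w. w \<in> ?K \<Longrightarrow> w \<bullet> f w \<le> v \<bullet> f v"
    using continuous_attains_sup[of ?K "\<lambda>x. x \<bullet> f x"] by blast
  define c where "c = v \<bullet> f v"
  have vv: "v \<bullet> v = 1" using v(1) by (simp add: norm_eq_1)
  have q: "w \<bullet> f w \<le> c * (w \<bullet> w)" if "w \<in> S" for w
  proof (cases "w = 0")
    case False
    then have "w /\<^sub>R norm w \<in> ?K" using S(1) that by (simp add: subspace_scale)
    from v(2)[OF this] have "(w /\<^sub>R norm w) \<bullet> f (w /\<^sub>R norm w) \<le> c" unfolding c_def .
    moreover have "(w /\<^sub>R norm w) \<bullet> f (w /\<^sub>R norm w) = (w \<bullet> f w) / (w \<bullet> w)"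
      by (simp add: linear_scale[OF f] dot_square_norm power2_eq_square divide_simps)
    ultimately have "(w \<bullet> f w) / (w \<bullet> w) \<le> c" by simp
    then show ?thesis using False by (simp add: pos_divide_le_eq)
  qed (simp add: linear_0[OF f])
  define w where "w = c *\<^sub>R v - f v"
  have wS: "w \<in> S" unfolding w_def using v(1) S by (intro subspace_diff subspace_scale) auto
  define b where "b = c * (w \<bullet> w) - w \<bullet> f w"
  have b: "b \<ge> 0" using q[OF wS] by (simp add: b_def)
  \<comment> \<open>The defect of the Rayleigh bound at \<open>v + t *\<^sub>R w\<close> has no
    constant term, and its linear coefficient is twice the squared length of the residual.\<close>
  have *: "0 \<le> 2 * t * (w \<bullet> w) + t\<^sup>2 * b" for t
  proof -
    have "v + t *\<^sub>R w \<in> S" using v(1) wS S(1) by (auto simp: subspace_add subspace_scale)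
    from q[OF this] have "0 \<le> c * ((v + t *\<^sub>R w) \<bullet> (v + t *\<^sub>R w)) - (v + t *\<^sub>R w) \<bullet> f (v + t *\<^sub>R w)" by simp
    also have "\<dots> = 2 * t * (c * (v \<bullet> w) - f v \<bullet> w) + t\<^sup>2 * b"
      using adj[of v w] vv
      by (simp add: linear_add[OF f] linear_scale[OF f] b_def c_def algebra_simps power2_eq_square
          inner_commute[of w "f v"] inner_commute[of w v])
    also have "c * (v \<bullet> w) - f v \<bullet> w = w \<bullet> w" by (simp add: w_def algebra_simps)
    finally show ?thesis .
  qed
  have "w \<bullet> w = 0"
  proof (rule ccontr)
    assume "w \<bullet> w \<noteq> 0"
    then have a: "w \<bullet> w > 0" by simp
    \<comment> \<open>A negative \<open>t\<close> of this size lets the linear term win;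
      \<open>b + 1\<close> keeps the denominator positive when \<open>b = 0\<close>.\<close>
    let ?t = "- (w \<bullet> w) / (b + 1)"
    have "2 * ?t * (w \<bullet> w) + ?t\<^sup>2 * b = - ((w \<bullet> w)\<^sup>2 * (b + 2)) / (b + 1)\<^sup>2"
      using b by (simp add: divide_simps) algebra
    moreover have "(w \<bullet> w)\<^sup>2 * (b + 2) / (b + 1)\<^sup>2 > 0" using a b by (intro divide_pos_pos mult_pos_pos) auto
    ultimately show False using *[of ?t] by simp
  qed
  then have "f v = c *\<^sub>R v" by (simp add: w_def)
  with v(1) show ?thesis by auto
qed

text \<open>Induction on the dimension: self-adjointness makes the orthogonal complement of an
  eigenvector invariant, and the rest of the basis is found there. Working with invariant subspaces
  keeps the induction inside one type.\<close>

lemma self_adjoint_orthonormal_eigenbasis: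
  fixes f :: "'a::euclidean_space \<Rightarrow> 'a"
  assumes f: "linear f" and adj: "\<And>x y. f x \<bullet> y = x \<bullet> f y"
    and S: "subspace S" "f ` S \<subseteq> S"
  shows "\<exists>E. finite E \<and> E \<subseteq> S \<and> S \<subseteq> span E \<and> pairwise orthogonal E \<and>
    (\<forall>v\<in>E. norm v = 1 \<and> (\<exists>c. f v = c *\<^sub>R v))"
  using S
proof (induction "dim S" arbitrary: S rule: less_induct)
  case less
  show ?case
  proof (cases "S = {0}")
    case True
    then show ?thesis by (intro exI[of _ "{}"]) auto
  next
    case False
    obtain v c where v: "v \<in> S" "norm v = 1" "f v = c *\<^sub>R v"
      using self_adjoint_eigenvector[OF f adj less.prems False] by blast
    then have vv: "v \<bullet> v = 1" by (simp add: norm_eq_1)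
    let ?S = "S \<inter> {x. v \<bullet> x = 0}"
    have sub: "subspace ?S"
      by (intro subspace_inter less.prems subspace_hyperplane)
    have "v \<in> S - ?S" using v(1) vv by auto
    then have "?S \<subset> S" by blast
    then have "dim ?S < dim S"
      using dim_psubset[of ?S S] sub less.prems(1) by (simp add: span_eq_iff[THEN iffD2])
    moreover have "f ` ?S \<subseteq> ?S"
    proof safe
      fix x assume x: "x \<in> S" "v \<bullet> x = 0"
      then show "f x \<in> S" using less.prems(2) by auto
      show "v \<bullet> f x = 0" using adj[of v x] x(2) v(3) by simp
    qed
    ultimately obtain E where E: "finite E" "E \<subseteq> ?S" "?S \<subseteq> span E" "pairwise orthogonal E"
      "\<forall>v\<in>E. norm v = 1 \<and> (\<exists>c. f v = c *\<^sub>R v)"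
      using less.hyps[OF _ sub] by blast
    have "x \<in> span (insert v E)" if "x \<in> S" for x
    proof -
      have "x - (v \<bullet> x) *\<^sub>R v \<in> ?S"
        using that v(1) vv less.prems(1) by (auto simp: subspace_diff subspace_scale algebra_simps)
      then have "x - (v \<bullet> x) *\<^sub>R v \<in> span (insert v E)"
        using E(3) span_mono[of E "insert v E"] by blast
      moreover have "(v \<bullet> x) *\<^sub>R v \<in> span (insert v E)" by (simp add: span_base span_scale)
      ultimately show ?thesis using span_add by fastforce
    qed
    moreover have "pairwise orthogonal (insert v E)"
      unfolding pairwise_insert using E(2,4) by (auto simp: orthogonal_def inner_commute[of _ v])
    moreover have "\<forall>w\<in>insert v E. norm w = 1 \<and> (\<exists>c. f w = c *\<^sub>R w)"
      using E(5) v(2,3) by blast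
    moreover have "insert v E \<subseteq> S" using E(2) v(1) by blast
    ultimately show ?thesis
      using E(1) by (intro exI[of _ "insert v E"]) blast
  qed
qed

lemma symmetric_matrix_eigenbasis:
  fixes A :: "real ^ 'n ^ 'n"
  assumes "transpose A = A"
  shows "\<exists>E. finite E \<and> span E = UNIV \<and> pairwise orthogonal E \<and>
    (\<forall>v\<in>E. norm v = 1 \<and> (\<exists>c. A *v v = c *\<^sub>R v))"
proof -
  have "(A *v x) \<bullet> y = x \<bullet> (A *v y)" for x y
    using dot_lmul_matrix[of x A y] assms by (simp flip: transpose_matrix_vector)
  from self_adjoint_orthonormal_eigenbasis[OF matrix_vector_mul_linear this subspace_UNIV]
  show ?thesis by (metis subset_UNIV top.extremum_uniqueI)
qed

text \<open>With one slot fixed, the vectors in the other slot with vanishing limit form a subspace;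
  two passes extend the limit from \<open>E\<close> to all pairs, in particular to the axes.\<close>

lemma tendsto_matrix_eigenbasis:
  fixes A :: "'b \<Rightarrow> real ^ 'n ^ 'n"
  assumes E: "finite E" "span E = UNIV"
    and lim: "\<And>u v. u \<in> E \<Longrightarrow> v \<in> E \<Longrightarrow> ((\<lambda>t. u \<bullet> (A t *v v)) \<longlongrightarrow> 0) F"
  shows "(A \<longlongrightarrow> 0) F"
proof -
  let ?P = "\<lambda>u v. ((\<lambda>t. u \<bullet> (A t *v v)) \<longlongrightarrow> 0) F"
  have "subspace {u. ?P u v}" for v
    unfolding subspace_def by (auto simp: inner_add_left intro: tendsto_add_zero tendsto_mult_right_zero)
  then have 1: "?P u v" if "v \<in> E" for u v
    using span_minimal[of E "{u. ?P u v}"] lim[OF _ that] E(2) by auto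
  have "subspace {v. ?P u v}" for u
    unfolding subspace_def
    by (auto simp: matrix_vector_right_distrib inner_add_right matrix_vector_mult_scaleR
        intro: tendsto_add_zero tendsto_mult_right_zero)
  then have 2: "?P u v" for u v
    using span_minimal[of E "{v. ?P u v}"] 1 E(2) by auto
  have "((\<lambda>t. A t $ i $ j) \<longlongrightarrow> 0) F" for i j
    using 2[of "axis i 1" "axis j 1"] by (simp add: inner_axis' matrix_vector_mul_component inner_axis)
  then show ?thesis
    by (intro vec_tendstoI) simp
qed

subsection \<open>Limits along partitions\<close>

lemma is_partition_mono:
  assumes "is_partition u v n D" "i \<le> j" "j \<le> n"
  shows "D i \<le> D j"
  using assms(2,3)
proof (induction j rule: dec_induct)
  case (step m)
  then show ?case using assms(1) unfolding is_partition_def by (meson Suc_le_lessD less_imp_le order_trans)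
qed simp

lemma is_partition_range:
  assumes "is_partition u v n D" "i \<le> n"
  shows "u \<le> D i" "D i \<le> v"
  using is_partition_mono[OF assms(1), of 0 i] is_partition_mono[OF assms(1), of i n] assms
  by (auto simp: is_partition_def)

lemma sum_partition_lengths:
  assumes "is_partition u v n D" shows "(\<Sum>i<n. D (Suc i) - D i) = v - u"
  using assms by (simp add: is_partition_def sum_lessThan_telescope)

lemma is_partition_dyadic: "is_partition 0 (real a / 2 ^ j) (a * 2 ^ n) (\<lambda>i. real i / 2 ^ (j + n))"
  by (simp add: is_partition_def power_add field_simps)

text \<open>All grids of step \<open>1 / 2 ^ (j + n)\<close> contain the end point
  \<open>a / 2 ^ j\<close>, so a limit over all partitions becomes an ordinary sequence along these
  grids.\<close>

lemma has_partition_limit_dyadic: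
  assumes "has_partition_limit \<Xi> 0 (real a / 2 ^ j) L"
  shows "(\<lambda>n. \<Sum>i<a * 2 ^ n. \<Xi> (real i / 2 ^ (j + n)) (real (Suc i) / 2 ^ (j + n))) \<longlonglongrightarrow> L"
proof (rule LIMSEQ_I)
  fix e :: real assume "e > 0"
  then obtain d where d: "d > 0" "\<And>n D. is_partition 0 (real a / 2 ^ j) n D \<Longrightarrow>
      \<forall>i<n. D (Suc i) - D i < d \<Longrightarrow> norm ((\<Sum>i<n. \<Xi> (D i) (D (Suc i))) - L) < e"
    using assms unfolding has_partition_limit_def by meson
  obtain n0 where n0: "(1/2) ^ n0 < d" using real_arch_pow_inv[of d "1/2"] d(1) by auto
  have "norm ((\<Sum>i<a * 2 ^ n. \<Xi> (real i / 2 ^ (j + n)) (real (Suc i) / 2 ^ (j + n))) - L) < e"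
    if "n \<ge> n0" for n
  proof (rule d(2)[OF is_partition_dyadic], intro allI impI)
    fix i :: nat
    have "real (Suc i) / 2 ^ (j + n) - real i / 2 ^ (j + n) = (1/2) ^ (j + n)"
      by (simp add: field_simps)
    also have "\<dots> \<le> (1/2) ^ n0" using that by (intro power_decreasing) auto
    finally show "real (Suc i) / 2 ^ (j + n) - real i / 2 ^ (j + n) < d" using n0 by simp
  qed
  then show "\<exists>n0. \<forall>n\<ge>n0. norm ((\<Sum>i<a * 2 ^ n. \<Xi> (real i / 2 ^ (j + n)) (real (Suc i) / 2 ^ (j + n))) - L) < e"
    by blast
qed

lemma fine_partition_exists:
  fixes u v :: real
  assumes "u < v" "0 < d"
  shows "\<exists>n D. is_partition u v n D \<and> (\<forall>i<n. D (Suc i) - D i < d)"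
proof -
  obtain n where n: "(v - u) / d < real n" using reals_Archimedean2 by blast
  with assms have npos: "real n > 0" by (smt (verit) divide_pos_pos)
  define D where "D i = u + (v - u) / real n * real i" for i
  have step: "D (Suc i) - D i = (v - u) / real n" for i
    using npos by (simp add: D_def field_simps)
  have "(v - u) / real n > 0" using assms npos by simp
  then have "D i < D (Suc i)" for i using step[of i] by linarith
  then have "is_partition u v n D" using npos by (simp add: is_partition_def D_def)
  moreover have "(v - u) / real n < d"
    using n npos assms(2) by (simp add: pos_divide_less_eq mult.commute)
  ultimately show ?thesis using step by metis
qed

lemma has_partition_limit_norm_le:
  assumes "has_partition_limit \<Xi> u v L" "u < v"
    and "\<And>n D. is_partition u v n D \<Longrightarrow> norm (\<Sum>i<n. \<Xi> (D i) (D (Suc i))) \<le> K"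
  shows "norm L \<le> K"
proof (rule field_le_epsilon)
  fix e :: real assume "e > 0"
  then obtain d where d: "d > 0" "\<And>n D. is_partition u v n D \<Longrightarrow>
      \<forall>i<n. D (Suc i) - D i < d \<Longrightarrow> norm ((\<Sum>i<n. \<Xi> (D i) (D (Suc i))) - L) < e"
    using assms(1) unfolding has_partition_limit_def by meson
  obtain n D where D: "is_partition u v n D" "\<forall>i<n. D (Suc i) - D i < d"
    using fine_partition_exists[OF assms(2) d(1)] by blast
  show "norm L \<le> K + e"
    using d(2)[OF D] assms(3)[OF D(1)] norm_triangle_ineq2[of L "\<Sum>i<n. \<Xi> (D i) (D (Suc i))"]
    by (simp add: norm_minus_commute)
qed

text \<open>Quadratic errors add up to at most \<open>C * (v - u)\<close> times the mesh, so only
  the increments of \<open>J\<close> survive. A bound for nearby points is enough because the mesh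
  may be taken below \<open>h\<close>.\<close>

lemma has_partition_limit_almost_additive:
  fixes J :: "real \<Rightarrow> 'a::real_normed_vector"
  assumes "u \<le> v" "0 < h" "0 \<le> C"
    and J: "\<And>q r. u \<le> q \<Longrightarrow> q < r \<Longrightarrow> r \<le> v \<Longrightarrow> r - q < h \<Longrightarrow> norm (\<Xi> q r - (J r - J q)) \<le> C * (r - q)\<^sup>2"
  shows "has_partition_limit \<Xi> u v (J v - J u)"
  unfolding has_partition_limit_def
proof (intro allI impI)
  fix e :: real assume e: "e > 0"
  define d where "d = min h (e / (C * (v - u) + 1))"
  have pos: "C * (v - u) + 1 > 0" using assms(1,3) by (simp add: add_nonneg_pos)
  have d: "d > 0" using e assms(2) pos by (simp add: d_def)
  have "norm ((\<Sum>i<n. \<Xi> (D i) (D (Suc i))) - (J v - J u)) < e"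
    if D: "is_partition u v n D" "\<forall>i<n. D (Suc i) - D i < d" for n D
  proof -
    have "(\<Sum>i<n. J (D (Suc i)) - J (D i)) = J v - J u"
      using D(1) sum_lessThan_telescope[of "\<lambda>i. J (D i)" n] by (simp add: is_partition_def)
    then have "norm ((\<Sum>i<n. \<Xi> (D i) (D (Suc i))) - (J v - J u)) =
        norm (\<Sum>i<n. \<Xi> (D i) (D (Suc i)) - (J (D (Suc i)) - J (D i)))"
      by (simp add: sum_subtractf)
    also have "\<dots> \<le> (\<Sum>i<n. (C * d) * (D (Suc i) - D i))"
    proof (rule sum_norm_le)
      fix i assume "i \<in> {..<n}"
      then have i: "i < n" by simp
      have lt: "D i < D (Suc i)" "D (Suc i) - D i < d" using D i by (auto simp: is_partition_def)
      have "norm (\<Xi> (D i) (D (Suc i)) - (J (D (Suc i)) - J (D i))) \<le> C * (D (Suc i) - D i)\<^sup>2"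
        using lt i is_partition_range[OF D(1), of i] is_partition_range[OF D(1), of "Suc i"]
        by (intro J) (auto simp: d_def)
      also have "\<dots> \<le> C * (d * (D (Suc i) - D i))"
        unfolding power2_eq_square using lt assms(3) by (intro mult_left_mono mult_right_mono) auto
      finally show "norm (\<Xi> (D i) (D (Suc i)) - (J (D (Suc i)) - J (D i))) \<le> (C * d) * (D (Suc i) - D i)"
        by (simp add: mult.assoc)
    qed
    also have "\<dots> = C * (v - u) * d"
      by (simp only: sum_distrib_left[symmetric] sum_partition_lengths[OF D(1)]) (simp add: mult_ac)
    also have "\<dots> < (C * (v - u) + 1) * d" using d by (simp add: distrib_right)
    also have "\<dots> \<le> (C * (v - u) + 1) * (e / (C * (v - u) + 1))"
      using pos by (intro mult_left_mono) (auto simp: d_def)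
    also have "\<dots> = e" using pos by simp
    finally show ?thesis .
  qed
  then show "\<exists>\<delta>>0. \<forall>n D. is_partition u v n D \<and> (\<forall>i<n. D (Suc i) - D i < \<delta>) \<longrightarrow>
      norm ((\<Sum>i<n. \<Xi> (D i) (D (Suc i))) - (J v - J u)) < e"
    using d by blast
qed

text \<open>There are \<open>a * 2 ^ n\<close> terms, so terms that are small relative to the step
  \<open>1 / 2 ^ (j + n)\<close> have a small sum.\<close>

lemma dyadic_sum_tendsto_0:
  fixes e :: "nat \<Rightarrow> nat \<Rightarrow> real"
  assumes "\<And>\<epsilon>. \<epsilon> > 0 \<Longrightarrow> \<forall>\<^sub>F n in sequentially. \<forall>i<a * 2 ^ n. \<bar>e n i\<bar> \<le> \<epsilon> / 2 ^ (j + n)"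
  shows "(\<lambda>n. \<Sum>i<a * 2 ^ n. e n i) \<longlonglongrightarrow> 0"
proof (rule tendstoI)
  fix r :: real assume r: "r > 0"
  define \<epsilon> where "\<epsilon> = r / (real a + 1)"
  have "\<epsilon> > 0" using r by (simp add: \<epsilon>_def)
  from assms[OF this] show "\<forall>\<^sub>F n in sequentially. dist (\<Sum>i<a * 2 ^ n. e n i) 0 < r"
  proof eventually_elim
    case (elim n)
    have "\<bar>\<Sum>i<a * 2 ^ n. e n i\<bar> \<le> (\<Sum>i<a * 2 ^ n. \<epsilon> / 2 ^ (j + n))"
      using elim by (intro order_trans[OF sum_abs] sum_mono) auto
    also have "\<dots> = real a * \<epsilon> / 2 ^ j" by (simp add: power_add)
    also have "\<dots> \<le> real a * \<epsilon> / 1" using \<open>\<epsilon> > 0\<close> by (intro divide_left_mono) auto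
    also have "\<dots> < r" using r by (simp add: \<epsilon>_def divide_simps)
    finally show ?case by simp
  qed
qed

lemma uniformly_close_dyadic:
  fixes f :: "real \<Rightarrow> 'a::metric_space"
  assumes "continuous_on {0..T} f" "\<epsilon> > 0"
  shows "\<forall>\<^sub>F n in sequentially. \<forall>q r. 0 \<le> q \<and> q \<le> r \<and> r \<le> T \<and> r \<le> q + 1 / 2 ^ (j + n) \<longrightarrow> dist (f r) (f q) < \<epsilon>"
proof -
  have "uniformly_continuous_on {0..T} f"
    using assms(1) by (intro compact_uniformly_continuous) auto
  then obtain d where d: "d > 0" "\<And>q r. q \<in> {0..T} \<Longrightarrow> r \<in> {0..T} \<Longrightarrow> dist r q < d \<Longrightarrow> dist (f r) (f q) < \<epsilon>"
    using assms(2) unfolding uniformly_continuous_on_def by metis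
  obtain n0 where n0: "(1/2) ^ n0 < d" using real_arch_pow_inv[of d "1/2"] d(1) by auto
  have "dist (f r) (f q) < \<epsilon>" if "n \<ge> n0" "0 \<le> q" "q \<le> r" "r \<le> T" "r \<le> q + 1 / 2 ^ (j + n)" for n q r
  proof -
    have "1 / 2 ^ (j + n) = (1/2 :: real) ^ (j + n)" by (simp add: power_divide)
    also have "\<dots> \<le> (1/2) ^ n0" using that by (intro power_decreasing) auto
    finally have "1 / 2 ^ (j + n) < d" using n0 by linarith
    then have "dist r q < d" using that by (simp add: dist_real_def)
    then show ?thesis using that by (intro d(2)) auto
  qed
  then show ?thesis unfolding eventually_sequentially by blast
qed

subsection \<open>Iterated integrals of dyadic interpolations\<close>

lemma norm_tensor: "norm (x \<otimes>\<^sub>t y) = norm x * norm y"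
proof -
  have "(norm (x \<otimes>\<^sub>t y))\<^sup>2 = (norm x * norm y)\<^sup>2"
    by (simp add: power2_norm_eq_inner power_mult_distrib inner_vec_def tensor_def
        sum_product mult_ac) (rule sum.swap)
  then show ?thesis by (simp add: power2_eq_iff_nonneg)
qed

text \<open>On an affine cell the integral is exactly the trapezoidal term. \<open>cl k r\<close>
  clips \<open>r\<close> to cell \<open>k\<close> and \<open>T k r\<close> is the contribution of
  that cell up to time \<open>r\<close>, so \<open>J\<close> is the integral as a function of its
  upper limit. Within a cell the germ misses its increments by half a tensor square of an increment
  of \<open>y\<close>.\<close>

lemma piecewise_affine_iterated_integral:
  fixes y :: "real \<Rightarrow> real ^ 'e"
  assumes h: "0 < h" and K: "0 \<le> K"
    and aff: "\<And>k. k < N \<Longrightarrow> \<exists>c. norm c \<le> K \<and>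
      (\<forall>q r. real k * h \<le> q \<and> q \<le> r \<and> r \<le> real (Suc k) * h \<longrightarrow> y r - y q = (r - q) *\<^sub>R c)"
  shows "has_partition_limit (\<lambda>q r. (y q - y 0) \<otimes>\<^sub>t (y r - y q)) 0 (real N * h)
    (\<Sum>k<N. ((1/2) *\<^sub>R (y (real k * h) + y (real (Suc k) * h)) - y 0) \<otimes>\<^sub>t (y (real (Suc k) * h) - y (real k * h)))"
proof -
  define cl where "cl k r = min (max r (real k * h)) (real (Suc k) * h)" for k r
  define T where "T k r = ((1/2) *\<^sub>R (y (real k * h) + y (cl k r)) - y 0) \<otimes>\<^sub>t (y (cl k r) - y (real k * h))" for k r
  define J where "J r = (\<Sum>k<N. T k r)" for r
  let ?\<Xi> = "\<lambda>q r. (y q - y 0) \<otimes>\<^sub>t (y r - y q)"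
  have lip: "norm (y r - y q) \<le> K * (r - q)"
    if k: "k < N" "real k * h \<le> q" "q \<le> r" "r \<le> real (Suc k) * h" for k q r
  proof -
    obtain c where "norm c \<le> K" "y r - y q = (r - q) *\<^sub>R c" using aff[OF k(1)] k(2-4) by blast
    then show ?thesis using k(3) by (simp add: mult_right_mono mult.commute)
  qed
  have same: "norm (?\<Xi> q r - (J r - J q)) \<le> K\<^sup>2 * (r - q)\<^sup>2"
    if k: "k < N" "real k * h \<le> q" "q \<le> r" "r \<le> real (Suc k) * h" for k q r
  proof -
    \<comment> \<open>The clipped times of all other cells stand still while \<open>q\<close> and
      \<open>r\<close> remain in cell \<open>k\<close>.\<close>
    have "T l r = T l q" if "l \<noteq> k" for l
    proof -
      have "l < k \<or> k < l" using that by auto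
      then have "real l * h + h \<le> real k * h \<or> real k * h + h \<le> real l * h"
        using mult_right_mono[of "real l + 1" "real k" h] mult_right_mono[of "real k + 1" "real l" h] h
        by (auto simp: distrib_right)
      moreover have "real k * h \<le> q" "q \<le> r" "r \<le> real k * h + h"
        using k by (auto simp: distrib_right)
      ultimately have "cl l r = cl l q"
        using h unfolding cl_def of_nat_Suc distrib_right by (auto simp: min_def max_def)
      then show ?thesis by (simp add: T_def)
    qed
    then have J: "J r - J q = T k r - T k q"
      using k(1) unfolding J_def by (simp add: sum.remove[of "{..<N}" k])
    have cl: "cl k r = r" "cl k q = q" using k by (auto simp: cl_def)
    obtain c where c: "norm c \<le> K" "\<And>q r. real k * h \<le> q \<Longrightarrow> q \<le> r \<Longrightarrow> r \<le> real (Suc k) * h \<Longrightarrow>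
        y r - y q = (r - q) *\<^sub>R c" using aff[OF k(1)] by blast
    have yr: "y r = y (real k * h) + (r - real k * h) *\<^sub>R c"
      and yq: "y q = y (real k * h) + (q - real k * h) *\<^sub>R c"
      using c(2)[of "real k * h" r] c(2)[of "real k * h" q] k by (auto simp: algebra_simps)
    have "?\<Xi> q r - (J r - J q) = - ((1/2) *\<^sub>R ((y r - y q) \<otimes>\<^sub>t (y r - y q)))"
      unfolding J T_def cl yr yq by (simp add: tensor_def vec_eq_iff field_simps)
    then have "norm (?\<Xi> q r - (J r - J q)) = (1/2) * (norm (y r - y q))\<^sup>2"
      by (simp add: norm_tensor power2_eq_square)
    also have "\<dots> \<le> (K * (r - q))\<^sup>2"
      using power_mono[OF lip[OF k] norm_ge_zero, of 2] zero_le_power2[of "K * (r - q)"] by linarith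
    finally show ?thesis by (simp add: power_mult_distrib)
  qed
  have "has_partition_limit ?\<Xi> 0 (real N * h) (J (real N * h) - J 0)"
  proof (rule has_partition_limit_almost_additive[where h = h and C = "3 * K\<^sup>2"])
    fix q r assume qr: "0 \<le> q" "q < r" "r \<le> real N * h" "r - q < h"
    define k where "k = nat \<lfloor>q / h\<rfloor>"
    have fl: "\<lfloor>q / h\<rfloor> \<ge> 0" using qr(1) h by simp
    have "real k \<le> q / h" "q / h < real k + 1" using fl by (auto simp: k_def)
    then have kq: "real k * h \<le> q" "q < real (Suc k) * h" using h by (auto simp: field_simps)
    then have "real k * h < real N * h" using qr by linarith
    then have kN: "k < N" using h by (simp add: mult_less_cancel_right)
    show "norm (?\<Xi> q r - (J r - J q)) \<le> 3 * K\<^sup>2 * (r - q)\<^sup>2"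
    proof (cases "r \<le> real (Suc k) * h")
      case True
      have "K\<^sup>2 * (r - q)\<^sup>2 \<le> 3 * K\<^sup>2 * (r - q)\<^sup>2" by simp
      then show ?thesis using same[OF kN kq(1) _ True] qr(2) by linarith
    next
      case False
      \<comment> \<open>An interval shorter than \<open>h\<close> crosses at most one knot, here
        \<open>m\<close>; splitting the germ there costs one product of increments.\<close>
      define m where "m = real (Suc k) * h"
      have m: "q \<le> m" "m \<le> r" using False kq(2) by (auto simp: m_def)
      have r: "r \<le> real (Suc (Suc k)) * h" using qr(4) kq(2) by (simp add: distrib_right)
      have "m < real N * h" using False qr(3) by (simp add: m_def)
      then have kN': "Suc k < N" using h unfolding m_def by (simp only: mult_less_cancel_right) simp
      have "?\<Xi> q r - (J r - J q) = (?\<Xi> q m - (J m - J q)) + (?\<Xi> m r - (J r - J m)) - (y m - y q) \<otimes>\<^sub>t (y r - y m)"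
        by (simp add: tensor_def vec_eq_iff algebra_simps)
      then have "norm (?\<Xi> q r - (J r - J q)) \<le>
          norm (?\<Xi> q m - (J m - J q)) + norm (?\<Xi> m r - (J r - J m)) + norm ((y m - y q) \<otimes>\<^sub>t (y r - y m))"
        by (metis (no_types, lifting) add_mono_thms_linordered_semiring(3) norm_triangle_ineq norm_triangle_ineq4 order_trans)
      also have "\<dots> \<le> K\<^sup>2 * (r - q)\<^sup>2 + K\<^sup>2 * (r - q)\<^sup>2 + K\<^sup>2 * (r - q)\<^sup>2"
      proof (intro add_mono)
        have "K\<^sup>2 * (m - q)\<^sup>2 \<le> K\<^sup>2 * (r - q)\<^sup>2" using m by (intro mult_left_mono power_mono) auto
        then show "norm (?\<Xi> q m - (J m - J q)) \<le> K\<^sup>2 * (r - q)\<^sup>2"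
          using same[OF kN kq(1) m(1)] by (simp add: m_def)
        have "K\<^sup>2 * (r - m)\<^sup>2 \<le> K\<^sup>2 * (r - q)\<^sup>2" using m by (intro mult_left_mono power_mono) auto
        then show "norm (?\<Xi> m r - (J r - J m)) \<le> K\<^sup>2 * (r - q)\<^sup>2"
          using same[OF kN' _ m(2) r] by (simp add: m_def)
        have "norm ((y m - y q) \<otimes>\<^sub>t (y r - y m)) \<le> (K * (m - q)) * (K * (r - m))"
          unfolding norm_tensor using lip[OF kN kq(1) m(1)] lip[OF kN' _ m(2) r] m K
          by (intro mult_mono) (auto simp: m_def)
        also have "\<dots> \<le> (K * (r - q)) * (K * (r - q))" using m K by (intro mult_mono) auto
        finally show "norm ((y m - y q) \<otimes>\<^sub>t (y r - y m)) \<le> K\<^sup>2 * (r - q)\<^sup>2"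
          by (simp add: power2_eq_square mult_ac)
      qed
      finally show ?thesis by simp
    qed
  qed (use h K in auto)
  moreover have "J 0 = 0"
  proof -
    have "cl k 0 = real k * h" for k using h by (simp add: cl_def)
    then show ?thesis by (simp add: J_def T_def tensor_def vec_eq_iff)
  qed
  moreover have "J (real N * h) = (\<Sum>k<N. ((1/2) *\<^sub>R (y (real k * h) + y (real (Suc k) * h)) - y 0) \<otimes>\<^sub>t (y (real (Suc k) * h) - y (real k * h)))"
    unfolding J_def
  proof (rule sum.cong[OF refl])
    fix k assume "k \<in> {..<N}"
    then have "real (Suc k) * h \<le> real N * h" "real k * h \<le> real N * h" using h by (auto intro!: mult_right_mono)
    then have "cl k (real N * h) = real (Suc k) * h" by (simp add: cl_def)
    then show "T k (real N * h) = ((1/2) *\<^sub>R (y (real k * h) + y (real (Suc k) * h)) - y 0) \<otimes>\<^sub>t (y (real (Suc k) * h) - y (real k * h))"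
      by (simp add: T_def)
  qed
  ultimately show ?thesis by simp
qed

text \<open>At the right end of the closed cell the floor already selects the next cell; the two
  affine formulas agree there.\<close>

lemma dyadic_interpolation_cell:
  assumes "real k / 2 ^ m \<le> r" "r \<le> real (Suc k) / 2 ^ m"
  shows "dyadic_interpolation m b r =
    b (real k / 2 ^ m) + (2 ^ m * r - real k) *\<^sub>R (b (real (Suc k) / 2 ^ m) - b (real k / 2 ^ m))"
proof (cases "r = real (Suc k) / 2 ^ m")
  case True
  then have "2 ^ m * r = real (Suc k)" by simp
  then have "\<lfloor>2 ^ m * r\<rfloor> = int (Suc k)" by (metis floor_of_nat)
  with \<open>2 ^ m * r = real (Suc k)\<close> show ?thesis
    unfolding dyadic_interpolation_def Let_def by (simp add: True)
next
  case False
  then have "real k \<le> 2 ^ m * r" "2 ^ m * r < real k + 1"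
    using assms by (auto simp: field_simps)
  then have "\<lfloor>2 ^ m * r\<rfloor> = int k" by (simp add: floor_eq_iff)
  then show ?thesis unfolding dyadic_interpolation_def Let_def by (simp add: add.commute)
qed

lemma iterated_integral_dyadic_interpolation:
  fixes b :: "real \<Rightarrow> real ^ 'd"
  shows "iterated_integral (dyadic_interpolation (j + n) b) 0 (real a / 2 ^ j) =
    (\<Sum>k<a * 2 ^ n. ((1/2) *\<^sub>R (b (real k / 2 ^ (j + n)) + b (real (Suc k) / 2 ^ (j + n))) - b 0) \<otimes>\<^sub>t
       (b (real (Suc k) / 2 ^ (j + n)) - b (real k / 2 ^ (j + n))))"
proof -
  let ?m = "j + n" and ?N = "a * 2 ^ n"
  let ?y = "dyadic_interpolation ?m b" and ?h = "1 / 2 ^ ?m :: real"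
  \<comment> \<open>The sum of all slopes serves as a common bound for each of them.\<close>
  define K where "K = (\<Sum>k<?N. norm (2 ^ ?m *\<^sub>R (b (real (Suc k) / 2 ^ ?m) - b (real k / 2 ^ ?m))))"
  have grid: "?y (real k / 2 ^ ?m) = b (real k / 2 ^ ?m)" for k
    by (subst dyadic_interpolation_cell[of k]) (auto simp: divide_right_mono)
  have end': "real a / 2 ^ j = real ?N * ?h" by (simp add: power_add)
  have "has_partition_limit (\<lambda>q r. (?y q - ?y 0) \<otimes>\<^sub>t (?y r - ?y q)) 0 (real ?N * ?h)
    (\<Sum>k<?N. ((1/2) *\<^sub>R (?y (real k * ?h) + ?y (real (Suc k) * ?h)) - ?y 0) \<otimes>\<^sub>t (?y (real (Suc k) * ?h) - ?y (real k * ?h)))"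
  proof (rule piecewise_affine_iterated_integral[where K = K])
    fix k assume k: "k < ?N"
    let ?c = "2 ^ ?m *\<^sub>R (b (real (Suc k) / 2 ^ ?m) - b (real k / 2 ^ ?m))"
    have "norm ?c \<le> K" unfolding K_def using k by (intro member_le_sum) auto
    moreover have "?y r - ?y q = (r - q) *\<^sub>R ?c"
      if "real k * ?h \<le> q" "q \<le> r" "r \<le> real (Suc k) * ?h" for q r
    proof -
      have "real k / 2 ^ ?m \<le> q" "q \<le> real (Suc k) / 2 ^ ?m" "real k / 2 ^ ?m \<le> r" "r \<le> real (Suc k) / 2 ^ ?m"
        using that by auto
      then show ?thesis
        by (simp add: dyadic_interpolation_cell[of k] scaleR_left_diff_distrib[symmetric] mult.commute[of r] right_diff_distrib[symmetric] mult.commute[of q] del: of_nat_Suc)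
    qed
    ultimately show "\<exists>c. norm c \<le> K \<and> (\<forall>q r. real k * ?h \<le> q \<and> q \<le> r \<and> r \<le> real (Suc k) * ?h \<longrightarrow> ?y r - ?y q = (r - q) *\<^sub>R c)"
      by blast
  qed (auto simp: K_def intro: sum_nonneg)
  then show ?thesis
    unfolding iterated_integral_def end'
    using grid[of 0] by (intro partition_limit_eqI) (auto simp: grid simp del: of_nat_Suc)
qed

subsection \<open>The Stratonovich lift as a limit of trapezoidal sums\<close>

lemma sum_UNIV_Plus:
  fixes g :: "'a::finite + 'b::finite \<Rightarrow> 'c::comm_monoid_add"
  shows "(\<Sum>k\<in>UNIV. g k) = (\<Sum>i\<in>UNIV. g (Inl i)) + (\<Sum>i\<in>UNIV. g (Inr i))"
  using sum.Plus[of "UNIV :: 'a set" "UNIV :: 'b set" g] by (simp add: comp_def)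

lemma ou_field_axis:
  "ou_field \<Gamma> \<sigma> z (axis (Inl k) 1) $ Inr (Inl i) = (if k = i then \<sigma> else 0)"
  "ou_field \<Gamma> \<sigma> z (axis (Inr (Inl k)) 1) $ Inr (Inl i) = 0"
  "ou_field \<Gamma> \<sigma> z (axis (Inr (Inr ())) 1) $ Inr (Inl i) = - (\<Gamma> *v (\<chi> i. z $ Inr (Inl i))) $ i"
  by (auto simp: ou_field_def join3_def Let_def axis_def)

text \<open>The field ignores the solution component of its direction, so this block of the image
  depends only on the prescribed driver part of \<open>m\<close>. The second-level equation thereby
  expresses the block of \<open>X\<close> through known quantities.\<close>

lemma tensor_square_map_ou_field:
  "tensor_square_map (ou_field \<Gamma> \<sigma> z) m $ Inr (Inl i) $ Inr (Inl j) =
    (let g = \<Gamma> *v (\<chi> i. z $ Inr (Inl i)); \<tau> = Inr (Inr ()) in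
      \<sigma>\<^sup>2 * m $ Inl i $ Inl j - \<sigma> * g $ j * m $ Inl i $ \<tau> - \<sigma> * g $ i * m $ \<tau> $ Inl j
      + g $ i * g $ j * m $ \<tau> $ \<tau>)"
proof -
  let ?G = "\<lambda>k i. ou_field \<Gamma> \<sigma> z (axis k 1) $ Inr (Inl i)"
  let ?\<tau> = "Inr (Inr ())" and ?g = "\<Gamma> *v (\<chi> i. z $ Inr (Inl i))"
  have contract: "(\<Sum>k\<in>UNIV. c k * ?G k i) = \<sigma> * c (Inl i) - ?g $ i * c ?\<tau>" for c i
  proof -
    have u: "(UNIV :: unit set) = {()}" by auto
    have "(\<Sum>k\<in>UNIV. c (Inl k) * (if k = i then \<sigma> else 0)) = c (Inl i) * \<sigma>"
      by (simp add: if_distrib sum.delta cong: if_cong)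
    then show ?thesis by (simp add: sum_UNIV_Plus ou_field_axis u)
  qed
  have "tensor_square_map (ou_field \<Gamma> \<sigma> z) m $ Inr (Inl i) $ Inr (Inl j) =
      (\<Sum>k\<in>UNIV. \<Sum>l\<in>UNIV. m $ k $ l * (?G k i * ?G l j))"
    by (simp add: tensor_square_map_def sum_component tensor_def)
  also have "\<dots> = (\<Sum>k\<in>UNIV. (\<Sum>l\<in>UNIV. m $ k $ l * ?G l j) * ?G k i)"
    unfolding sum_distrib_right by (simp only: mult_ac)
  also have "\<dots> = \<sigma> * (\<sigma> * m $ Inl i $ Inl j - ?g $ j * m $ Inl i $ ?\<tau>)
      - ?g $ i * (\<sigma> * m $ ?\<tau> $ Inl j - ?g $ j * m $ ?\<tau> $ ?\<tau>)"
    by (simp only: contract)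
  finally show ?thesis by (simp add: Let_def algebra_simps power2_eq_square)
qed

text \<open>Each block involving time is bounded by the length of the interval times the oscillation
  of one factor. On short intervals these blocks are o(length) and vanish from the summed
  germ.\<close>

lemma driver_part_bounds:
  assumes dr: "driver_part T b bb ZZ" and st: "0 \<le> s" "s < t" "t \<le> T"
    and K: "\<And>r. s \<le> r \<Longrightarrow> r \<le> t \<Longrightarrow> norm (b r - b s) \<le> K"
  shows "\<bar>ZZ s t $ Inl i $ Inr (Inr ())\<bar> \<le> K * (t - s)"
    and "\<bar>ZZ s t $ Inr (Inr ()) $ Inl i\<bar> \<le> 2 * K * (t - s)"
    and "\<bar>ZZ s t $ Inr (Inr ()) $ Inr (Inr ())\<bar> \<le> (t - s) * (t - s)"
proof -
  have Ki: "\<bar>b r $ i - b s $ i\<bar> \<le> K" if "s \<le> r" "r \<le> t" for r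
    using component_le_norm_cart[of "b r - b s" i] K[OF that] by simp
  have K0: "0 \<le> K" using K[of s] st(2) by simp
  have weighted: "\<bar>\<Sum>i<n. c i * (D (Suc i) - D i)\<bar> \<le> C * (t - s)"
    if D: "is_partition s t n D" and c: "\<And>i. i < n \<Longrightarrow> \<bar>c i\<bar> \<le> C" for n D c C
  proof -
    have "\<bar>\<Sum>i<n. c i * (D (Suc i) - D i)\<bar> \<le> (\<Sum>i<n. C * (D (Suc i) - D i))"
      using D c by (intro order_trans[OF sum_abs] sum_mono)
        (auto simp: abs_mult is_partition_def less_imp_le intro!: mult_right_mono)
    then show ?thesis using sum_partition_lengths[OF D] by (simp add: sum_distrib_left[symmetric])
  qed
  have lims: "has_partition_limit (\<lambda>q r. (b q $ i - b s $ i) * (r - q)) s t (ZZ s t $ Inl i $ Inr (Inr ()))"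
    "has_partition_limit (\<lambda>q r. (q - s) * (b r $ i - b q $ i)) s t (ZZ s t $ Inr (Inr ()) $ Inl i)"
    "has_partition_limit (\<lambda>q r. (q - s) * (r - q)) s t (ZZ s t $ Inr (Inr ()) $ Inr (Inr ()))"
    using dr st unfolding driver_part_def by auto
  have "norm (ZZ s t $ Inl i $ Inr (Inr ())) \<le> K * (t - s)"
    using lims(1) st(2)
  proof (rule has_partition_limit_norm_le)
    fix n D assume D: "is_partition s t n D"
    show "norm (\<Sum>k<n. (b (D k) $ i - b s $ i) * (D (Suc k) - D k)) \<le> K * (t - s)"
      unfolding real_norm_def using is_partition_range[OF D] by (intro weighted[OF D] Ki) auto
  qed
  then show "\<bar>ZZ s t $ Inl i $ Inr (Inr ())\<bar> \<le> K * (t - s)" by simp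
  have "norm (ZZ s t $ Inr (Inr ()) $ Inl i) \<le> 2 * K * (t - s)"
    using lims(2) st(2)
  proof (rule has_partition_limit_norm_le)
    fix n D assume D: "is_partition s t n D"
    \<comment> \<open>Summation by parts moves the increments from \<open>b\<close> to time; the
      boundary term and the remaining sum cost \<open>K * (t - s)\<close> each.\<close>
    let ?g = "\<lambda>k. (D k - s) * (b (D k) $ i - b s $ i)"
    have "(\<Sum>k<n. (D k - s) * (b (D (Suc k)) $ i - b (D k) $ i)) =
       (\<Sum>k<n. (?g (Suc k) - ?g k) - (b (D (Suc k)) $ i - b s $ i) * (D (Suc k) - D k))"
      by (rule sum.cong) (auto simp: algebra_simps)
    also have "\<dots> = (t - s) * (b t $ i - b s $ i) - (\<Sum>k<n. (b (D (Suc k)) $ i - b s $ i) * (D (Suc k) - D k))"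
      unfolding sum_subtractf[of _ _ "{..<n}"] sum_lessThan_telescope[of ?g] using D by (simp add: is_partition_def)
    finally have eq: "(\<Sum>k<n. (D k - s) * (b (D (Suc k)) $ i - b (D k) $ i)) = \<dots>" .
    have "\<bar>(t - s) * (b t $ i - b s $ i)\<bar> \<le> (t - s) * K"
      using Ki[of t] st(2) by (auto simp: abs_mult intro!: mult_mono)
    moreover have "\<bar>\<Sum>k<n. (b (D (Suc k)) $ i - b s $ i) * (D (Suc k) - D k)\<bar> \<le> K * (t - s)"
      using is_partition_range[OF D] by (intro weighted[OF D] Ki) auto
    ultimately show "norm (\<Sum>k<n. (D k - s) * (b (D (Suc k)) $ i - b (D k) $ i)) \<le> 2 * K * (t - s)"
      unfolding eq real_norm_def by (simp add: algebra_simps)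
  qed
  then show "\<bar>ZZ s t $ Inr (Inr ()) $ Inl i\<bar> \<le> 2 * K * (t - s)" by simp
  have "norm (ZZ s t $ Inr (Inr ()) $ Inr (Inr ())) \<le> (t - s) * (t - s)"
    using lims(3) st(2)
  proof (rule has_partition_limit_norm_le)
    fix n D assume D: "is_partition s t n D"
    have "\<bar>D k - s\<bar> \<le> t - s" if "k < n" for k
      using is_partition_range[OF D, of k] that by auto
    then show "norm (\<Sum>k<n. (D k - s) * (D (Suc k) - D k)) \<le> (t - s) * (t - s)"
      unfolding real_norm_def by (intro weighted[OF D])
  qed
  then show "\<bar>ZZ s t $ Inr (Inr ()) $ Inr (Inr ())\<bar> \<le> (t - s) * (t - s)" by simp
qed

text \<open>The trivial partition occurs in the supremum defining \<open>p_variation\<close>, so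
  convergence in \<open>p/2\<close>-variation contains convergence over the whole interval.\<close>

lemma canonical_lift_dyadic_limit:
  fixes b :: "real \<Rightarrow> real ^ 'd"
  assumes can: "canonical_lift p b bb" and p: "0 < p" and a: "0 < a"
  shows "(\<lambda>n. \<Sum>k<a * 2 ^ n. ((1/2) *\<^sub>R (b (real k / 2 ^ (j + n)) + b (real (Suc k) / 2 ^ (j + n))) - b 0) \<otimes>\<^sub>t
       (b (real (Suc k) / 2 ^ (j + n)) - b (real k / 2 ^ (j + n)))) \<longlonglongrightarrow> bb 0 (real a / 2 ^ j)"
proof -
  define T where "T = real a / 2 ^ j"
  have T: "T > 0" using a by (simp add: T_def)
  let ?I = "\<lambda>m. iterated_integral (dyadic_interpolation m b)"
  let ?pv = "\<lambda>m. p_variation (p/2) T (\<lambda>s t. ?I m s t - bb s t)"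
  have pv: "?pv \<longlonglongrightarrow> 0" using can T unfolding canonical_lift_def by auto
  have le: "ennreal (norm (?I m 0 T - bb 0 T)) \<le> ?pv m" for m
  proof -
    have "is_partition 0 T 1 (\<lambda>i. if i = 0 then 0 else T)" using T by (simp add: is_partition_def)
    then have "(1, \<lambda>i. if i = 0 then 0 else T) \<in> {(n, D). is_partition 0 T n D}" by simp
    from SUP_upper[OF this, of "\<lambda>(n, D). ennreal ((\<Sum>i<n. norm (?I m (D i) (D (Suc i)) - bb (D i) (D (Suc i))) powr (p/2)) powr (1/(p/2)))"]
    show ?thesis
      unfolding p_variation_def using p by (simp add: powr_powr)
  qed
  have "(\<lambda>m. ennreal (norm (?I m 0 T - bb 0 T))) \<longlonglongrightarrow> ennreal 0"
    using tendsto_sandwich[OF _ _ tendsto_const pv] le by simp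
  then have "(\<lambda>m. norm (?I m 0 T - bb 0 T)) \<longlonglongrightarrow> 0"
    by (subst (asm) tendsto_ennreal_iff) auto
  then have "(\<lambda>m. ?I m 0 T) \<longlonglongrightarrow> bb 0 T"
    by (simp add: tendsto_norm_zero_iff LIM_zero_iff)
  then have "(\<lambda>n. ?I (n + j) 0 T) \<longlonglongrightarrow> bb 0 T" by (rule LIMSEQ_ignore_initial_segment)
  then show ?thesis by (simp add: T_def iterated_integral_dyadic_interpolation add.commute[of _ j])
qed

text \<open>Chen's relation, telescoped. It ties the sum of \<open>bb\<close> over small intervals,
  which need not converge by itself, to the left Riemann sums of \<open>b\<close>.\<close>

lemma chen_sum:
  assumes rp: "rough_path p T b bb" and D: "is_partition 0 T n D" "0 < k" "k \<le> n"
  shows "(\<Sum>i<k. bb (D i) (D (Suc i))) = bb 0 (D k) - (\<Sum>i<k. (b (D i) - b 0) \<otimes>\<^sub>t (b (D (Suc i)) - b (D i)))"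
  using D(2,3)
proof (induction k)
  case (Suc k)
  show ?case
  proof (cases "k = 0")
    case True
    then show ?thesis using D(1) by (simp add: is_partition_def tensor_def vec_eq_iff zero_vec_def)
  next
    case False
    have lt: "D i < D (Suc i)" if "i < n" for i using D(1) that by (simp add: is_partition_def)
    have "D 0 < D 1" using lt[of 0] Suc.prems by simp
    also have "D 1 \<le> D k" using is_partition_mono[OF D(1), of 1 k] False Suc.prems by simp
    finally have "0 < D k" using D(1) by (simp add: is_partition_def)
    then have "bb 0 (D (Suc k)) - bb 0 (D k) - bb (D k) (D (Suc k)) = (b (D k) - b 0) \<otimes>\<^sub>t (b (D (Suc k)) - b (D k))"
      using rp lt[of k] Suc.prems is_partition_range[OF D(1), of "Suc k"] unfolding rough_path_def by simp
    moreover note Suc.IH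
    ultimately show ?thesis using False Suc.prems by (simp add: algebra_simps)
  qed
qed simp

lemma ou_increment:
  fixes x b :: "real \<Rightarrow> real ^ 'd"
  assumes cont: "continuous_on {0..} x"
    and ode: "\<And>t. 0 \<le> t \<Longrightarrow> x t - x 0 = - integral {0..t} (\<lambda>s. \<Gamma> *v x s) + \<sigma> *\<^sub>R (b t - b 0)"
    and st: "0 \<le> s" "s \<le> t"
  shows "x t - x s = - integral {s..t} (\<lambda>s. \<Gamma> *v x s) + \<sigma> *\<^sub>R (b t - b s)"
proof -
  have "continuous_on {0..t} x" using cont by (rule continuous_on_subset) auto
  then have "continuous_on {0..t} (\<lambda>s. \<Gamma> *v x s)"
    by (rule bounded_linear.continuous_on[OF matrix_vector_mul_bounded_linear])
  then have "(\<lambda>s. \<Gamma> *v x s) integrable_on {0..t}" by (rule integrable_continuous_interval)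
  then have I: "integral {0..s} (\<lambda>s. \<Gamma> *v x s) + integral {s..t} (\<lambda>s. \<Gamma> *v x s) = integral {0..t} (\<lambda>s. \<Gamma> *v x s)"
    using st by (intro Henstock_Kurzweil_Integration.integral_combine)
  have "x t - x s = (x t - x 0) - (x s - x 0)" by simp
  also have "\<dots> = - integral {s..t} (\<lambda>s. \<Gamma> *v x s) + \<sigma> *\<^sub>R (b t - b s)"
    using st by (simp only: ode I[symmetric] order_trans[OF st]) (simp add: algebra_simps)
  finally show ?thesis .
qed

text \<open>Three sums on one grid are compared: the germ of the second-level equation, with limit
  \<open>xx\<close>; the trapezoidal sums of \<open>b\<close>, with limit \<open>bb\<close>; and a
  vanishing remainder. By Chen's relation, half the products of increments of \<open>b\<close> equal
  the sum of \<open>bb\<close> over the grid, up to the difference between the trapezoidal sums of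
  \<open>b\<close> and their limit. Increments of \<open>x\<close> are \<sigma> times those of
  \<open>b\<close> up to the drift.\<close>

lemma stratonovich_lift_trapezoid_limit:
  fixes x b :: "real \<Rightarrow> real ^ 'd"
  assumes strat: "stratonovich_lift p \<Gamma> \<sigma> b bb x xx" and can: "canonical_lift p b bb" and p: "0 < p"
    and cont: "continuous_on {0..} x" and x0: "x 0 = 0"
    and ode: "\<And>t. 0 \<le> t \<Longrightarrow> x t - x 0 = - integral {0..t} (\<lambda>s. \<Gamma> *v x s) + \<sigma> *\<^sub>R (b t - b 0)"
    and a: "0 < a"
  shows "(\<lambda>n. \<Sum>k<a * 2 ^ n. ((1/2) *\<^sub>R (x (real k / 2 ^ (j + n)) + x (real (Suc k) / 2 ^ (j + n)))) \<otimes>\<^sub>t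
       (x (real (Suc k) / 2 ^ (j + n)) - x (real k / 2 ^ (j + n)))) \<longlonglongrightarrow> xx 0 (real a / 2 ^ j)"
proof (intro vec_tendstoI)
  fix i l :: 'd
  define T where "T = real a / 2 ^ j"
  have T: "T > 0" using a by (simp add: T_def)
  define Z where "Z t = join3 (b t) (x t) t" for t
  let ?f = "ou_field \<Gamma> \<sigma>" and ?\<tau> = "Inr (Inr ()) :: 'd + 'd + unit"
  obtain ZZ where rde: "solves_rde T ?f Z ZZ" and dr: "driver_part T b bb ZZ"
    and xxZ: "\<And>s t i j. 0 \<le> s \<Longrightarrow> s < t \<Longrightarrow> t \<le> T \<Longrightarrow> xx s t $ i $ j = ZZ s t $ Inr (Inl i) $ Inr (Inl j)"
    using strat T unfolding stratonovich_lift_def Z_def by meson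
  have rp: "rough_path p T b bb" using can T unfolding canonical_lift_def by blast
  then have cb: "continuous_on {0..T} b" unfolding rough_path_def by blast
  have yZ: "(\<chi> i. Z t $ Inr (Inl i)) = x t" for t by (simp add: Z_def join3_def vec_eq_iff)
  define g where "g t = \<Gamma> *v x t" for t
  have cg: "continuous_on {0..T} g"
    unfolding g_def by (rule bounded_linear.continuous_on[OF matrix_vector_mul_bounded_linear])
      (rule continuous_on_subset[OF cont], auto)
  obtain G where G: "0 < G" "\<And>t. 0 \<le> t \<Longrightarrow> t \<le> T \<Longrightarrow> norm (g t) \<le> G"
    using compact_imp_bounded[OF compact_continuous_image[OF cg compact_Icc]] unfolding bounded_pos by auto
  have dx: "norm ((x t - x s) - \<sigma> *\<^sub>R (b t - b s)) \<le> G * (t - s)" if "0 \<le> s" "s \<le> t" "t \<le> T" for s t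
  proof -
    have "continuous_on {s..t} g" by (rule continuous_on_subset[OF cg]) (use that in auto)
    then have "norm (integral {s..t} g) \<le> G * (t - s)"
      using that G(2) by (intro integral_bound) auto
    moreover have "(x t - x s) - \<sigma> *\<^sub>R (b t - b s) = - integral {s..t} g"
      using ou_increment[OF cont ode that(1,2)] unfolding g_def by simp
    ultimately show ?thesis by simp
  qed
  \<comment> \<open>The case \<open>u = v\<close> is included because the germ on the first cell
    contains the integral from 0 to 0, defined by the trivial partition alone.\<close>
  have ri: "rough_integral1 ?f Z ZZ u v = Z v - Z u" if "0 \<le> u" "u \<le> v" "v \<le> T" for u v
  proof (cases "u = v")
    case True
    have "n = 0" if "is_partition u u n D" for n D
    proof (rule ccontr)
      assume "n \<noteq> 0"
      then have "D 0 < D (Suc 0)" using that unfolding is_partition_def by blast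
      then show False
        using is_partition_range[OF that, of 0] is_partition_range[OF that, of "Suc 0"] \<open>n \<noteq> 0\<close> by simp
    qed
    then have "norm ((\<Sum>i<n. rough_germ1 ?f Z ZZ (D i) (D (Suc i))) - 0) < \<epsilon>"
      if "is_partition u u n D" "0 < \<epsilon>" for n D and \<epsilon> :: real
      using that by fastforce
    then have "has_partition_limit (rough_germ1 ?f Z ZZ) u u 0"
      unfolding has_partition_limit_def using zero_less_one by blast
    then show ?thesis
      unfolding rough_integral1_def using True by (simp add: partition_limit_eqI)
  next
    case False
    then show ?thesis
      using rde that unfolding solves_rde_def has_rough_integral1_def rough_integral1_def
      by (intro partition_limit_eqI) auto
  qed
  define D where "D n k = real k / 2 ^ (j + n)" for n k
  have D: "is_partition 0 T (a * 2 ^ n) (D n)" for n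
    unfolding D_def T_def by (rule is_partition_dyadic)
  have step: "D n (Suc k) - D n k = 1 / 2 ^ (j + n)" for n k by (simp add: D_def field_simps)
  define germ where "germ n k = (x (D n k) $ i) * (x (D n (Suc k)) $ l - x (D n k) $ l)
     + tensor_square_map (?f (Z (D n k))) (ZZ (D n k) (D n (Suc k))) $ Inr (Inl i) $ Inr (Inl l)" for n k
  have germ: "(\<lambda>n. \<Sum>k<a * 2 ^ n. germ n k) \<longlonglongrightarrow> xx 0 T $ i $ l"
  proof -
    let ?\<Xi> = "\<lambda>s t. rough_integral1 ?f Z ZZ 0 s \<otimes>\<^sub>t rough_integral1 ?f Z ZZ s t + tensor_square_map (?f (Z s)) (ZZ s t)"
    have "has_partition_limit ?\<Xi> 0 T (ZZ 0 T)"
      using rde T unfolding solves_rde_def has_rough_integral2_def by simp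
    from has_partition_limit_dyadic[OF this[unfolded T_def]]
    have "(\<lambda>n. \<Sum>k<a * 2 ^ n. ?\<Xi> (D n k) (D n (Suc k))) \<longlonglongrightarrow> ZZ 0 T"
      unfolding D_def T_def .
    then have "(\<lambda>n. (\<Sum>k<a * 2 ^ n. ?\<Xi> (D n k) (D n (Suc k))) $ Inr (Inl i) $ Inr (Inl l)) \<longlonglongrightarrow> ZZ 0 T $ Inr (Inl i) $ Inr (Inl l)"
      by (intro tendsto_vec_nth)
    moreover have "(\<Sum>k<a * 2 ^ n. ?\<Xi> (D n k) (D n (Suc k))) $ Inr (Inl i) $ Inr (Inl l) = (\<Sum>k<a * 2 ^ n. germ n k)" for n
      unfolding sum_component
    proof (rule sum.cong[OF refl])
      fix k assume "k \<in> {..<a * 2 ^ n}"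
      then have k: "0 \<le> D n k" "D n k \<le> T" "D n k \<le> D n (Suc k)" "D n (Suc k) \<le> T"
        using is_partition_range[OF D, of k n] is_partition_range[OF D, of "Suc k" n] step[of n k]
        by (auto simp: algebra_simps)
      show "?\<Xi> (D n k) (D n (Suc k)) $ Inr (Inl i) $ Inr (Inl l) = germ n k"
        using k x0 by (simp add: ri germ_def) (simp add: tensor_def Z_def join3_def)
    qed
    ultimately show ?thesis using xxZ[of 0 T i l] T by simp
  qed
  define tb where "tb n k = ((1/2) * (b (D n k) $ i + b (D n (Suc k)) $ i) - b 0 $ i) * (b (D n (Suc k)) $ l - b (D n k) $ l)" for n k
  have tb: "(\<lambda>n. \<Sum>k<a * 2 ^ n. tb n k) \<longlonglongrightarrow> bb 0 T $ i $ l"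
    using tendsto_vec_nth[OF tendsto_vec_nth[OF canonical_lift_dyadic_limit[OF can p a, of j], of i], of l]
    by (simp add: tb_def D_def T_def tensor_def sum_component del: of_nat_Suc)
  \<comment> \<open>What is left once products of increments of \<open>b\<close> are matched: the
    drift's share in half the product of increments of \<open>x\<close>, and the blocks involving
    time. Both are o(step).\<close>
  define e where "e n k = (1/2) * (x (D n (Suc k)) $ i - x (D n k) $ i) * (x (D n (Suc k)) $ l - x (D n k) $ l)
     - (1/2) * \<sigma>\<^sup>2 * (b (D n (Suc k)) $ i - b (D n k) $ i) * (b (D n (Suc k)) $ l - b (D n k) $ l)
     + \<sigma> * g (D n k) $ l * ZZ (D n k) (D n (Suc k)) $ Inl i $ ?\<tau>
     + \<sigma> * g (D n k) $ i * ZZ (D n k) (D n (Suc k)) $ ?\<tau> $ Inl l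
     - g (D n k) $ i * g (D n k) $ l * ZZ (D n k) (D n (Suc k)) $ ?\<tau> $ ?\<tau>" for n k
  have e0: "(\<lambda>n. \<Sum>k<a * 2 ^ n. e n k) \<longlonglongrightarrow> 0"
  proof (rule dyadic_sum_tendsto_0[where j = j])
    fix \<epsilon> :: real assume \<epsilon>: "\<epsilon> > 0"
    \<comment> \<open>The factor 4 below is two halves from the cross terms with the drift plus 1
      and 2 from the mixed blocks; \<open>K\<close> uses up half of \<epsilon>, and
      \<open>+ 1\<close> covers \<sigma> = 0.\<close>
    define K where "K = \<epsilon> / (8 * \<bar>\<sigma>\<bar> * G + 1)"
    have K: "K > 0" using \<epsilon> G(1) by (simp add: K_def add_nonneg_pos)
    have K': "4 * \<bar>\<sigma>\<bar> * G * K \<le> \<epsilon> / 2"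
    proof -
      have "(8 * \<bar>\<sigma>\<bar> * G) * K \<le> (8 * \<bar>\<sigma>\<bar> * G + 1) * K" using K by simp
      also have "\<dots> = \<epsilon>" using G(1) by (simp add: K_def add_nonneg_pos[THEN less_imp_neq, symmetric])
      finally show ?thesis by simp
    qed
    have "(\<lambda>n. (1/2) ^ n * (1/2) ^ j) \<longlonglongrightarrow> 0 * (1/2 :: real) ^ j"
      by (intro tendsto_mult_right LIMSEQ_power_zero) simp
    then have "(\<lambda>n. 1 / 2 ^ (j + n) :: real) \<longlonglongrightarrow> 0" by (simp add: power_add power_divide mult.commute)
    then have "\<forall>\<^sub>F n in sequentially. 1 / 2 ^ (j + n) < \<epsilon> / (4 * G\<^sup>2)"
      using \<epsilon> G(1) by (intro order_tendstoD(2)) auto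
    moreover note uniformly_close_dyadic[OF cb K, of j]
    ultimately show "\<forall>\<^sub>F n in sequentially. \<forall>k<a * 2 ^ n. \<bar>e n k\<bar> \<le> \<epsilon> / 2 ^ (j + n)"
    proof eventually_elim
      case (elim n)
      show ?case
      proof (intro allI impI)
        fix k assume "k < a * 2 ^ n"
        define s t h where "s = D n k" and "t = D n (Suc k)" and "h = 1 / (2::real) ^ (j + n)"
        have h: "h > 0" "2 * G\<^sup>2 * h \<le> \<epsilon> / 2" using elim(1) G(1) by (auto simp: h_def field_simps)
        have ts: "t - s = h" using step by (simp add: s_def t_def h_def)
        have st: "0 \<le> s" "s < t" "t \<le> T"
          using is_partition_range[OF D, of k n] is_partition_range[OF D, of "Suc k" n] \<open>k < a * 2 ^ n\<close> ts h
          by (auto simp: s_def t_def)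
        have osc: "norm (b r - b s) \<le> K" if "s \<le> r" "r \<le> t" for r
          using elim(2)[rule_format, of s r] that st ts by (simp add: dist_norm h_def)
        note db = driver_part_bounds[OF dr st osc, unfolded ts]
        have bi: "\<bar>b t $ m - b s $ m\<bar> \<le> K" for m
          using component_le_norm_cart[of "b t - b s" m] osc[of t] st by simp
        have gi: "\<bar>g s $ m\<bar> \<le> G" for m
          using component_le_norm_cart[of "g s" m] G(2)[of s] st by simp
        define c where "c m = (x t $ m - x s $ m) - \<sigma> * (b t $ m - b s $ m)" for m
        have ci: "\<bar>c m\<bar> \<le> G * h" for m
          using component_le_norm_cart[of "(x t - x s) - \<sigma> *\<^sub>R (b t - b s)" m] dx[of s t] st ts
          by (simp add: c_def)
        have xi: "x t $ m - x s $ m = \<sigma> * (b t $ m - b s $ m) + c m" for m by (simp add: c_def)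
        have six: "\<bar>(1/2) * A + (1/2) * B + (1/2) * C + P + Q - R\<bar> \<le> (1/2) * a + (1/2) * b + (1/2) * c + p + q + r"
          if "\<bar>A\<bar> \<le> a" "\<bar>B\<bar> \<le> b" "\<bar>C\<bar> \<le> c" "\<bar>P\<bar> \<le> p" "\<bar>Q\<bar> \<le> q" "\<bar>R\<bar> \<le> r"
          for A B C P Q R a b c p q r :: real
          using that by linarith
        have "e n k = (1/2) * (\<sigma> * (b t $ i - b s $ i) * c l) + (1/2) * (c i * (\<sigma> * (b t $ l - b s $ l))) + (1/2) * (c i * c l)
          + \<sigma> * g s $ l * ZZ s t $ Inl i $ ?\<tau> + \<sigma> * g s $ i * ZZ s t $ ?\<tau> $ Inl l
          - g s $ i * g s $ l * ZZ s t $ ?\<tau> $ ?\<tau>"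
          unfolding e_def s_def[symmetric] t_def[symmetric] xi by (simp add: power2_eq_square field_simps)
        also have "\<bar>\<dots>\<bar> \<le> (1/2) * (\<bar>\<sigma>\<bar> * K * (G * h)) + (1/2) * ((G * h) * (\<bar>\<sigma>\<bar> * K)) + (1/2) * ((G * h) * (G * h))
           + \<bar>\<sigma>\<bar> * G * (K * h) + \<bar>\<sigma>\<bar> * G * (2 * K * h) + G * G * (h * h)"
          by (intro six; unfold abs_mult; intro mult_mono bi ci gi db(1)[simplified] db(2)[simplified] db(3)[simplified])
            (use K G(1) h in auto)
        also have "\<dots> = (4 * \<bar>\<sigma>\<bar> * G * K + 3/2 * G\<^sup>2 * h) * h" by (simp add: power2_eq_square algebra_simps)
        also have "\<dots> \<le> \<epsilon> * h"
        proof (rule mult_right_mono)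
          have "3/2 * G\<^sup>2 * h \<le> 2 * G\<^sup>2 * h" using h by (intro mult_right_mono) auto
          then show "4 * \<bar>\<sigma>\<bar> * G * K + 3/2 * G\<^sup>2 * h \<le> \<epsilon>" using K' h(2) by linarith
        qed (use h in auto)
        finally show "\<bar>e n k\<bar> \<le> \<epsilon> / 2 ^ (j + n)" by (simp add: h_def)
      qed
    qed
  qed
  \<comment> \<open>An exact identity for every \<open>n\<close>. Its last summand tends to 0 by the
    canonical lift, although the sums absorbed in it need not converge one by one.\<close>
  have "(\<Sum>k<a * 2 ^ n. (1/2) * (x (D n k) $ i + x (D n (Suc k)) $ i) * (x (D n (Suc k)) $ l - x (D n k) $ l)) =
      (\<Sum>k<a * 2 ^ n. germ n k) + (\<Sum>k<a * 2 ^ n. e n k) + \<sigma>\<^sup>2 * ((\<Sum>k<a * 2 ^ n. tb n k) - bb 0 T $ i $ l)" for n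
  proof -
    have "(\<Sum>k<a * 2 ^ n. bb (D n k) (D n (Suc k))) = bb 0 T - (\<Sum>k<a * 2 ^ n. (b (D n k) - b 0) \<otimes>\<^sub>t (b (D n (Suc k)) - b (D n k)))"
      using chen_sum[OF rp D[of n], of "a * 2 ^ n"] a D[of n] by (simp add: is_partition_def)
    then have "bb 0 T $ i $ l = (\<Sum>k<a * 2 ^ n. bb (D n k) (D n (Suc k)) $ i $ l
         + (b (D n k) $ i - b 0 $ i) * (b (D n (Suc k)) $ l - b (D n k) $ l))"
      by (simp add: vec_eq_iff sum_component sum.distrib tensor_def)
    moreover have "ZZ (D n k) (D n (Suc k)) $ Inl i $ Inl l = bb (D n k) (D n (Suc k)) $ i $ l" if "k < a * 2 ^ n" for k
    proof -
      have "D n k < D n (Suc k)" using step[of n k] by (smt (verit) zero_less_divide_1_iff zero_less_power)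
      then show ?thesis
        using dr is_partition_range[OF D, of k n] is_partition_range[OF D, of "Suc k" n] that unfolding driver_part_def by auto
    qed
    ultimately have bb: "bb 0 T $ i $ l = (\<Sum>k<a * 2 ^ n. ZZ (D n k) (D n (Suc k)) $ Inl i $ Inl l
         + (b (D n k) $ i - b 0 $ i) * (b (D n (Suc k)) $ l - b (D n k) $ l))" by simp
    show ?thesis
      unfolding bb sum_subtractf[symmetric] sum_distrib_left sum.distrib[symmetric]
    proof (rule sum.cong[OF refl])
      fix k
      show "(1/2) * (x (D n k) $ i + x (D n (Suc k)) $ i) * (x (D n (Suc k)) $ l - x (D n k) $ l) =
        germ n k + e n k + \<sigma>\<^sup>2 * (tb n k - (ZZ (D n k) (D n (Suc k)) $ Inl i $ Inl l
         + (b (D n k) $ i - b 0 $ i) * (b (D n (Suc k)) $ l - b (D n k) $ l)))"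
        unfolding germ_def e_def tb_def tensor_square_map_ou_field yZ Let_def g_def[symmetric]
        by (simp add: field_simps power2_eq_square)
    qed
  qed
  moreover have "(\<lambda>n. (\<Sum>k<a * 2 ^ n. germ n k) + (\<Sum>k<a * 2 ^ n. e n k) + \<sigma>\<^sup>2 * ((\<Sum>k<a * 2 ^ n. tb n k) - bb 0 T $ i $ l))
     \<longlonglongrightarrow> xx 0 T $ i $ l + 0 + \<sigma>\<^sup>2 * (bb 0 T $ i $ l - bb 0 T $ i $ l)"
    by (intro tendsto_intros germ e0 tb)
  ultimately show "(\<lambda>n. (\<Sum>k<a * 2 ^ n. ((1/2) *\<^sub>R (x (real k / 2 ^ (j + n)) + x (real (Suc k) / 2 ^ (j + n)))) \<otimes>\<^sub>t
       (x (real (Suc k) / 2 ^ (j + n)) - x (real k / 2 ^ (j + n)))) $ i $ l) \<longlonglongrightarrow> xx 0 (real a / 2 ^ j) $ i $ l"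
    by (simp add: sum_component tensor_def D_def T_def del: of_nat_Suc)
qed

section \<open>Rough path properties of the solution block\<close>

lemma norm_block_le:
  fixes y :: "'b::real_normed_vector ^ 'd::finite" and z :: "'c::real_normed_vector ^ ('e::finite + 'd::finite + 'f::finite)"
  assumes "\<And>i. norm (y $ i) \<le> norm (z $ Inr (Inl i))"
  shows "norm y \<le> norm z"
proof -
  have "(\<Sum>i\<in>UNIV. (norm (y $ i))\<^sup>2) \<le> (\<Sum>i\<in>UNIV. (norm (z $ Inr (Inl i)))\<^sup>2)"
    using assms by (intro sum_mono power_mono) auto
  also have "\<dots> \<le> (\<Sum>k\<in>UNIV. (norm (z $ k))\<^sup>2)"
    by (simp add: sum_UNIV_Plus sum_nonneg add_increasing add_increasing2)
  finally show ?thesis unfolding norm_vec_def L2_set_def by simp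
qed

lemma stratonovich_lift_rough_path:
  fixes x b :: "real \<Rightarrow> real ^ 'd"
  assumes "stratonovich_lift p \<Gamma> \<sigma> b bb x xx" "0 < T"
  shows "rough_path p T x xx"
proof -
  define Z where "Z t = join3 (b t) (x t) t" for t
  have xZ: "x t $ i = Z t $ Inr (Inl i)" for t i by (simp add: Z_def join3_def)
  obtain ZZ where rp: "rough_path p T Z ZZ"
    and xxZ: "\<And>s t i j. 0 \<le> s \<Longrightarrow> s < t \<Longrightarrow> t \<le> T \<Longrightarrow> xx s t $ i $ j = ZZ s t $ Inr (Inl i) $ Inr (Inl j)"
    using assms unfolding stratonovich_lift_def Z_def by meson
  obtain \<omega> where \<omega>: "is_control T \<omega>" "\<And>s t. 0 \<le> s \<Longrightarrow> s < t \<Longrightarrow> t \<le> T \<Longrightarrow>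
      norm (Z t - Z s) \<le> \<omega> s t powr (1/p) \<and> norm (ZZ s t) \<le> \<omega> s t powr (2/p)"
    using rp unfolding rough_path_def by blast
  have "continuous_on {0..T} (\<lambda>t. \<chi> i. Z t $ Inr (Inl i))"
    using rp unfolding rough_path_def by (intro continuous_intros) auto
  moreover have "(\<lambda>t. \<chi> i. Z t $ Inr (Inl i)) = x" by (auto simp: xZ[symmetric] vec_eq_iff)
  moreover have "xx s t - xx s u - xx u t = (x u - x s) \<otimes>\<^sub>t (x t - x u)"
    if "0 \<le> s" "s < u" "u < t" "t \<le> T" for s u t
  proof -
    have "ZZ s t - ZZ s u - ZZ u t = (Z u - Z s) \<otimes>\<^sub>t (Z t - Z u)"
      using rp that unfolding rough_path_def by blast
    then show ?thesis using that by (simp add: vec_eq_iff xxZ xZ tensor_def)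
  qed
  moreover have "norm (x t - x s) \<le> \<omega> s t powr (1/p) \<and> norm (xx s t) \<le> \<omega> s t powr (2/p)"
    if "0 \<le> s" "s < t" "t \<le> T" for s t
  proof -
    have "norm (x t - x s) \<le> norm (Z t - Z s)" by (rule norm_block_le) (simp add: xZ)
    moreover have "norm (xx s t) \<le> norm (ZZ s t)"
      by (intro norm_block_le) (use that in \<open>simp add: xxZ\<close>)
    ultimately show ?thesis using \<omega>(2)[OF that] by linarith
  qed
  ultimately show ?thesis using \<omega>(1) unfolding rough_path_def by auto
qed

text \<open>By Chen's relation \<open>xx 0 t - xx 0 s\<close> is \<open>xx s t\<close> plus a
  product with \<open>x t - x s\<close>. Both vanish as \<open>s\<close> increases to
  \<open>t\<close>, the first because the control is continuous and zero on the diagonal. This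
  carries statements from dyadic times to all positive times.\<close>

lemma rough_path_left_limit:
  assumes rp: "rough_path p T x xx" and p: "0 < p" and t: "t \<le> T"
    and s: "\<And>n. 0 < s n" "\<And>n. s n \<le> t" "s \<longlonglongrightarrow> t"
  shows "(\<lambda>n. xx 0 (s n)) \<longlonglongrightarrow> xx 0 t"
proof -
  obtain \<omega> where \<omega>: "is_control T \<omega>" "\<And>s t. 0 \<le> s \<Longrightarrow> s < t \<Longrightarrow> t \<le> T \<Longrightarrow> norm (xx s t) \<le> \<omega> s t powr (2/p)"
    using rp unfolding rough_path_def by blast
  have t0: "0 < t" using s(1)[of 0] s(2)[of 0] by linarith
  have cx: "continuous_on {0..T} x" using rp unfolding rough_path_def by blast
  have lx: "(\<lambda>n. x (s n)) \<longlonglongrightarrow> x t"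
    by (rule continuous_on_tendsto_compose[OF cx s(3)])
      (use s t t0 in \<open>auto intro!: always_eventually less_imp_le order_trans[OF s(2)]\<close>)
  have "continuous_on {(s, t). 0 \<le> s \<and> s \<le> t \<and> t \<le> T} (\<lambda>(s, t). \<omega> s t)"
    using \<omega>(1) unfolding is_control_def by blast
  then have "(\<lambda>n. case (s n, t) of (s, t) \<Rightarrow> \<omega> s t) \<longlonglongrightarrow> (case (t, t) of (s, t) \<Rightarrow> \<omega> s t)"
    by (rule continuous_on_tendsto_compose)
      (use s t t0 in \<open>auto intro!: always_eventually tendsto_Pair less_imp_le\<close>)
  moreover have "\<omega> t t = 0" using \<omega>(1) t t0 unfolding is_control_def by auto
  ultimately have w0: "(\<lambda>n. \<omega> (s n) t) \<longlonglongrightarrow> 0" by simp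
  have wn: "0 \<le> \<omega> (s n) t" for n
    using \<omega>(1) s(1,2)[of n] t unfolding is_control_def by (auto intro: less_imp_le)
  have wp: "(\<lambda>n. \<omega> (s n) t powr (2/p)) \<longlonglongrightarrow> 0 powr (2/p)"
    by (rule tendsto_powr'[OF w0 tendsto_const]) (use p wn in simp)
  have "(\<lambda>n. \<omega> (s n) t powr (2/p) + norm (x (s n) - x 0) * norm (x t - x (s n)))
      \<longlonglongrightarrow> 0 powr (2/p) + norm (x t - x 0) * norm (x t - x t)"
    by (intro tendsto_add tendsto_mult tendsto_norm tendsto_diff tendsto_const lx wp)
  then have lim: "(\<lambda>n. \<omega> (s n) t powr (2/p) + norm (x (s n) - x 0) * norm (x t - x (s n))) \<longlonglongrightarrow> 0"
    by simp
  have "norm (xx 0 (s n) - xx 0 t) \<le> \<omega> (s n) t powr (2/p) + norm (x (s n) - x 0) * norm (x t - x (s n))" for n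
  proof (cases "s n = t")
    case False
    then have st: "s n < t" using s(2)[of n] by simp
    have "xx 0 t - xx 0 (s n) - xx (s n) t = (x (s n) - x 0) \<otimes>\<^sub>t (x t - x (s n))"
      using rp s(1)[of n] st t unfolding rough_path_def by auto
    then have "xx 0 (s n) - xx 0 t = - (xx (s n) t + (x (s n) - x 0) \<otimes>\<^sub>t (x t - x (s n)))"
      by (simp add: algebra_simps)
    then have "norm (xx 0 (s n) - xx 0 t) \<le> norm (xx (s n) t) + norm (x (s n) - x 0) * norm (x t - x (s n))"
      using norm_triangle_ineq[of "xx (s n) t" "(x (s n) - x 0) \<otimes>\<^sub>t (x t - x (s n))"]
      by (simp only: norm_minus_cancel norm_tensor)
    moreover have "norm (xx (s n) t) \<le> \<omega> (s n) t powr (2/p)"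
      using \<omega>(2) s(1)[of n] st t by auto
    ultimately show ?thesis by linarith
  qed simp
  then have "(\<lambda>n. xx 0 (s n) - xx 0 t) \<longlonglongrightarrow> 0"
    by (intro Lim_null_comparison[OF _ lim] always_eventually allI)
  then show ?thesis by (simp add: LIM_zero_iff)
qed

subsection \<open>Chaining\<close>

text \<open>Binary expansion of \<open>k\<close>: each level contributes at most one dyadic block,
  so one bound per level suffices. The induction strips the last binary digit and doubles the grid
  step.\<close>

lemma dyadic_chaining:
  fixes f :: "nat \<Rightarrow> real"
  assumes "\<And>j i. j \<le> m \<Longrightarrow> i < 2 ^ (m - j) \<Longrightarrow> \<bar>f (Suc i * 2 ^ j) - f (i * 2 ^ j)\<bar> \<le> K j"
    and "k \<le> 2 ^ m"
  shows "\<bar>f k - f 0\<bar> \<le> (\<Sum>j\<le>m. K j)"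
  using assms
proof (induction m arbitrary: f K k)
  case 0
  have "0 \<le> K 0" using 0(1)[of 0 0] by simp
  moreover have "k = 0 \<or> k = 1" using 0(2) by auto
  ultimately show ?case using 0(1)[of 0 0] by auto
next
  case (Suc m)
  define l where "l = k div 2"
  have l: "k = 2 * l \<or> k = Suc (2 * l)" by (auto simp: l_def)
  have "l \<le> 2 ^ m" using Suc.prems(2) by (simp add: l_def)
  have "\<bar>f (2 * l) - f (2 * 0)\<bar> \<le> (\<Sum>j\<le>m. K (Suc j))"
  proof (rule Suc.IH[of "\<lambda>i. f (2 * i)"])
    show "l \<le> 2 ^ m" by fact
    fix j i :: nat assume "j \<le> m" "i < 2 ^ (m - j)"
    then show "\<bar>f (2 * (Suc i * 2 ^ j)) - f (2 * (i * 2 ^ j))\<bar> \<le> K (Suc j)"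
      using Suc.prems(1)[of "Suc j" i] by (simp add: algebra_simps)
  qed
  moreover have "\<bar>f k - f (2 * l)\<bar> \<le> K 0"
    using l
  proof
    assume k: "k = 2 * l"
    then show ?thesis using Suc.prems(1)[of 0 0] by simp
  next
    assume k: "k = Suc (2 * l)"
    then show ?thesis using Suc.prems(1)[of 0 "2 * l"] Suc.prems(2) by simp
  qed
  moreover have "(\<Sum>j\<le>Suc m. K j) = K 0 + (\<Sum>j\<le>m. K (Suc j))" by (rule sum.atMost_Suc_shift)
  ultimately show ?case by simp
qed

subsection \<open>Gaussian spaces\<close>

text \<open>There are eight sign patterns, and the mixed product has coefficient 24 in each fourth
  power, whence \<open>192 = 8 * 24\<close>.\<close>

lemma polarization4:
  fixes a b c d :: real
  shows "a * b * c * d = ((a + b + c + d) ^ 4 - (a + b + c - d) ^ 4 - (a + b - c + d) ^ 4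
    - (a - b + c + d) ^ 4 + (a + b - c - d) ^ 4 + (a - b + c - d) ^ 4 + (a - b - c + d) ^ 4
    - (a - b - c - d) ^ 4) / 192"
  by (simp add: eval_nat_numeral algebra_simps)

text \<open>\<open>S\<close> is the second moment of a signed sum of four variables, with
  \<open>s\<close> the sum of the variances. The same signed combination of
  \<open>3 * S\<^sup>2\<close> removes \<open>s\<close> and leaves the three pairings.\<close>

lemma polarization4_squares:
  fixes s ab ac ad bc bd cd :: real
  defines "S \<equiv> \<lambda>e f g. s + 2 * e * ab + 2 * f * ac + 2 * g * ad + 2 * e * f * bc + 2 * e * g * bd + 2 * f * g * cd"
  shows "(3 * (S 1 1 1)\<^sup>2 - 3 * (S 1 1 (-1))\<^sup>2 - 3 * (S 1 (-1) 1)\<^sup>2 - 3 * (S (-1) 1 1)\<^sup>2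
    + 3 * (S 1 (-1) (-1))\<^sup>2 + 3 * (S (-1) 1 (-1))\<^sup>2 + 3 * (S (-1) (-1) 1)\<^sup>2
    - 3 * (S (-1) (-1) (-1))\<^sup>2) / 192 = ab * cd + ac * bd + ad * bc"
  by (simp add: S_def power2_eq_square algebra_simps)

text \<open>Gaussianity is encoded as a fourth-moment identity on a linear space of variables;
  polarising that identity yields Wick's formula for four factors.\<close>

locale gaussian_space = prob_space M for M :: "'w measure" +
  fixes V :: "('w \<Rightarrow> real) set"
  assumes V_measurable: "Z \<in> V \<Longrightarrow> Z \<in> borel_measurable M"
    and V_zero: "(\<lambda>_. 0) \<in> V"
    and V_lin: "Y \<in> V \<Longrightarrow> Z \<in> V \<Longrightarrow> (\<lambda>w. a * Y w + b * Z w) \<in> V"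
    and V_integrable4: "Z \<in> V \<Longrightarrow> integrable M (\<lambda>w. Z w ^ 4)"
    and V_moment4: "Z \<in> V \<Longrightarrow> expectation (\<lambda>w. Z w ^ 4) = 3 * (expectation (\<lambda>w. (Z w)\<^sup>2))\<^sup>2"
begin

lemma V_add: "Y \<in> V \<Longrightarrow> Z \<in> V \<Longrightarrow> (\<lambda>w. Y w + Z w) \<in> V"
  using V_lin[of Y Z 1 1] by simp

lemma V_diff: "Y \<in> V \<Longrightarrow> Z \<in> V \<Longrightarrow> (\<lambda>w. Y w - Z w) \<in> V"
  using V_lin[of Y Z 1 "-1"] by simp

lemma V_scale: "Z \<in> V \<Longrightarrow> (\<lambda>w. a * Z w) \<in> V"
  using V_lin[of Z Z a 0] by simp

lemma V_sum: "(\<And>i. i \<in> I \<Longrightarrow> Z i \<in> V) \<Longrightarrow> (\<lambda>w. \<Sum>i\<in>I. Z i w) \<in> V"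
  by (induction I rule: infinite_finite_induct) (auto simp: V_zero intro: V_add)

lemma integrable_V2:
  assumes "Z \<in> V" shows "integrable M (\<lambda>w. (Z w)\<^sup>2)"
proof (rule Bochner_Integration.integrable_bound)
  show "integrable M (\<lambda>w. 1 + Z w ^ 4)" using V_integrable4[OF assms] by simp
  show "(\<lambda>w. (Z w)\<^sup>2) \<in> borel_measurable M" using V_measurable[OF assms] by simp
  have "x\<^sup>2 \<le> 1 + x ^ 4" for x :: real
  proof -
    have "0 \<le> (x\<^sup>2 - 1)\<^sup>2 + x ^ 4 + 1" by (intro add_nonneg_nonneg) auto
    then show ?thesis by (simp add: power2_diff flip: power_mult)
  qed
  then show "AE w in M. norm ((Z w)\<^sup>2) \<le> norm (1 + Z w ^ 4)" by simp
qed

lemma integrable_V_mult: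
  assumes "Y \<in> V" "Z \<in> V" shows "integrable M (\<lambda>w. Y w * Z w)"
proof -
  have "(\<lambda>w. Y w * Z w) = (\<lambda>w. ((Y w + Z w)\<^sup>2 - (Y w - Z w)\<^sup>2) / 4)"
    by (auto simp: power2_eq_square algebra_simps)
  then show ?thesis
    using integrable_V2[OF V_add[OF assms]] integrable_V2[OF V_diff[OF assms]] by simp
qed

lemma wick:
  assumes V: "a \<in> V" "b \<in> V" "c \<in> V" "d \<in> V"
  shows "integrable M (\<lambda>w. a w * b w * c w * d w)"
    and "expectation (\<lambda>w. a w * b w * c w * d w) =
      expectation (\<lambda>w. a w * b w) * expectation (\<lambda>w. c w * d w) +
      expectation (\<lambda>w. a w * c w) * expectation (\<lambda>w. b w * d w) +
      expectation (\<lambda>w. a w * d w) * expectation (\<lambda>w. b w * c w)"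
proof -
  define Z where "Z e2 e3 e4 = (\<lambda>w. a w + e2 * b w + e3 * c w + e4 * d w)" for e2 e3 e4
  have Z: "Z e2 e3 e4 \<in> V" for e2 e3 e4
    unfolding Z_def by (intro V_add V_scale V)
  have id: "a w * b w * c w * d w =
     (Z 1 1 1 w ^ 4 - Z 1 1 (-1) w ^ 4 - Z 1 (-1) 1 w ^ 4 - Z (-1) 1 1 w ^ 4
      + Z 1 (-1) (-1) w ^ 4 + Z (-1) 1 (-1) w ^ 4 + Z (-1) (-1) 1 w ^ 4 - Z (-1) (-1) (-1) w ^ 4) / 192" for w
    unfolding Z_def polarization4[of "a w" "b w" "c w" "d w"] by simp
  note i4 = V_integrable4[OF Z]
  show "integrable M (\<lambda>w. a w * b w * c w * d w)"
    unfolding id by (intro Bochner_Integration.integrable_divide Bochner_Integration.integrable_add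
        Bochner_Integration.integrable_diff i4)
  note ii = V[THEN integrable_V2] integrable_V_mult[OF V(1,2)] integrable_V_mult[OF V(1,3)]
    integrable_V_mult[OF V(1,4)] integrable_V_mult[OF V(2,3)] integrable_V_mult[OF V(2,4)]
    integrable_V_mult[OF V(3,4)]
  let ?S = "\<lambda>e f g. (expectation (\<lambda>w. (a w)\<^sup>2) + expectation (\<lambda>w. (b w)\<^sup>2)
      + expectation (\<lambda>w. (c w)\<^sup>2) + expectation (\<lambda>w. (d w)\<^sup>2))
      + 2 * e * expectation (\<lambda>w. a w * b w) + 2 * f * expectation (\<lambda>w. a w * c w)
      + 2 * g * expectation (\<lambda>w. a w * d w) + 2 * e * f * expectation (\<lambda>w. b w * c w)
      + 2 * e * g * expectation (\<lambda>w. b w * d w) + 2 * f * g * expectation (\<lambda>w. c w * d w)"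
  have sq: "expectation (\<lambda>w. (Z e f g w)\<^sup>2) = ?S e f g" if "e\<^sup>2 = 1" "f\<^sup>2 = 1" "g\<^sup>2 = 1" for e f g
  proof -
    have "(\<lambda>w. (Z e f g w)\<^sup>2) = (\<lambda>w. (a w)\<^sup>2 + e\<^sup>2 * (b w)\<^sup>2 + f\<^sup>2 * (c w)\<^sup>2 + g\<^sup>2 * (d w)\<^sup>2
      + (2 * e) * (a w * b w) + (2 * f) * (a w * c w) + (2 * g) * (a w * d w)
      + (2 * e * f) * (b w * c w) + (2 * e * g) * (b w * d w) + (2 * f * g) * (c w * d w))"
      unfolding Z_def by (auto simp: power2_eq_square algebra_simps)
    then show ?thesis using ii unfolding that by simp
  qed
  have mom: "expectation (\<lambda>w. Z e f g w ^ 4) = 3 * (?S e f g)\<^sup>2" if "e\<^sup>2 = 1" "f\<^sup>2 = 1" "g\<^sup>2 = 1" for e f g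
    unfolding V_moment4[OF Z] sq[OF that] ..
  have 1: "(1::real)\<^sup>2 = 1" and m1: "(-1::real)\<^sup>2 = 1" by simp_all
  show "expectation (\<lambda>w. a w * b w * c w * d w) =
      expectation (\<lambda>w. a w * b w) * expectation (\<lambda>w. c w * d w) +
      expectation (\<lambda>w. a w * c w) * expectation (\<lambda>w. b w * d w) +
      expectation (\<lambda>w. a w * d w) * expectation (\<lambda>w. b w * c w)"
    unfolding id
    apply (subst polarization4_squares[symmetric, of _ _ _ _ _ _ "expectation (\<lambda>w. (a w)\<^sup>2) + expectation (\<lambda>w. (b w)\<^sup>2)
      + expectation (\<lambda>w. (c w)\<^sup>2) + expectation (\<lambda>w. (d w)\<^sup>2)"])
    unfolding mom[symmetric, OF 1 1 1] mom[symmetric, OF 1 1 m1] mom[symmetric, OF 1 m1 1] mom[symmetric, OF m1 1 1]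
      mom[symmetric, OF 1 m1 m1] mom[symmetric, OF m1 1 m1] mom[symmetric, OF m1 m1 1] mom[symmetric, OF m1 m1 m1]
    by (simp only: Bochner_Integration.integral_diff Bochner_Integration.integral_add i4
        Bochner_Integration.integrable_add Bochner_Integration.integrable_diff
        integral_divide_zero)
qed

text \<open>Of the three Wick pairings, the two that match some \<open>g\<close> with some
  \<open>d\<close> vanish by orthogonality.\<close>

lemma second_moment_bilinear:
  assumes V: "\<And>i. i \<in> I \<Longrightarrow> g i \<in> V" "\<And>i. i \<in> I \<Longrightarrow> d i \<in> V"
    and orth: "\<And>i j. i \<in> I \<Longrightarrow> j \<in> I \<Longrightarrow> expectation (\<lambda>w. g i w * d j w) = 0"
  shows "integrable M (\<lambda>w. (\<Sum>i\<in>I. g i w * d i w)\<^sup>2)"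
    and "expectation (\<lambda>w. (\<Sum>i\<in>I. g i w * d i w)\<^sup>2) =
      (\<Sum>i\<in>I. \<Sum>j\<in>I. expectation (\<lambda>w. g i w * g j w) * expectation (\<lambda>w. d i w * d j w))"
proof -
  have eq: "(\<Sum>i\<in>I. g i w * d i w)\<^sup>2 = (\<Sum>i\<in>I. \<Sum>j\<in>I. g i w * d i w * g j w * d j w)" for w
    by (simp add: power2_eq_square sum_product mult_ac)
  have int: "integrable M (\<lambda>w. g i w * d i w * g j w * d j w)" if "i \<in> I" "j \<in> I" for i j
    using wick(1)[of "g i" "d i" "g j" "d j"] V that by simp
  show "integrable M (\<lambda>w. (\<Sum>i\<in>I. g i w * d i w)\<^sup>2)"
    unfolding eq using int by simp
  have "expectation (\<lambda>w. g i w * d i w * g j w * d j w) =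
      expectation (\<lambda>w. g i w * g j w) * expectation (\<lambda>w. d i w * d j w)" if "i \<in> I" "j \<in> I" for i j
    using wick(2)[of "g i" "d i" "g j" "d j"] V that orth by simp
  then show "expectation (\<lambda>w. (\<Sum>i\<in>I. g i w * d i w)\<^sup>2) =
      (\<Sum>i\<in>I. \<Sum>j\<in>I. expectation (\<lambda>w. g i w * g j w) * expectation (\<lambda>w. d i w * d j w))"
    unfolding eq using int by (simp add: Bochner_Integration.integral_sum)
qed

end

subsection \<open>The scalar Ornstein--Uhlenbeck equation\<close>

locale ou_path =
  fixes \<mu> \<sigma> :: real and x \<beta> :: "real \<Rightarrow> real"
  assumes \<mu>_pos: "0 < \<mu>" and cont: "continuous_on {0..} x" and x_0: "x 0 = 0"
    and increment: "0 \<le> s \<Longrightarrow> s \<le> t \<Longrightarrow> x t - x s = - \<mu> * integral {s..t} x + \<sigma> * (\<beta> t - \<beta> s)"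
begin

lemma cont_Icc: "0 \<le> s \<Longrightarrow> continuous_on {s..t} x"
  by (rule continuous_on_subset[OF cont]) auto

text \<open>\<open>x\<close> is only as regular as its noise, but \<open>z\<close>, which is
  \<open>x\<close> with the noise since \<open>s\<close> removed, has derivative
  \<open>- \<mu> * x\<close>. With the integrating factor, \<open>z\<close> shifted down or up by
  \<open>\<bar>\<sigma>\<bar> * W\<close> is monotone. One \<open>\<bar>\<sigma>\<bar> * W\<close>
  stems from this comparison, the other from returning to \<open>x\<close>.\<close>

lemma relaxation:
  assumes s: "0 \<le> s" "s \<le> t" and W: "\<And>r. s \<le> r \<Longrightarrow> r \<le> t \<Longrightarrow> \<bar>\<beta> r - \<beta> s\<bar> \<le> W"
  shows "\<bar>x t\<bar> \<le> exp (- \<mu> * (t - s)) * \<bar>x s\<bar> + 2 * \<bar>\<sigma>\<bar> * W"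
proof -
  define z where "z r = x s - \<mu> * integral {s..r} x" for r
  have z: "z r = x r - \<sigma> * (\<beta> r - \<beta> s)" if "s \<le> r" for r
    using increment[OF s(1) that] by (simp add: z_def)
  have int: "x integrable_on {s..t}" by (intro integrable_continuous_interval cont_Icc s)
  have cz: "continuous_on {s..t} z"
    unfolding z_def by (intro continuous_intros indefinite_integral_continuous_1 int)
  have dz: "(z has_real_derivative - \<mu> * x r) (at r)" if "s < r" "r < t" for r
  proof -
    have "((\<lambda>u. integral {s..u} x) has_vector_derivative x r) (at r within {s..t})"
      using that by (intro integral_has_vector_derivative cont_Icc s) auto
    then have "((\<lambda>u. integral {s..u} x) has_real_derivative x r) (at r)"
      unfolding at_within_Icc_at[OF that] has_real_derivative_iff_has_vector_derivative .
    from DERIV_diff[OF DERIV_const DERIV_cmult[OF this, of \<mu>], of "x s"]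
    show ?thesis unfolding z_def by simp
  qed
  have sW: "\<bar>\<sigma> * (\<beta> r - \<beta> s)\<bar> \<le> \<bar>\<sigma>\<bar> * W" if "s \<le> r" "r \<le> t" for r
    using W[OF that] by (auto simp: abs_mult intro: mult_left_mono)
  have sW0: "0 \<le> \<bar>\<sigma>\<bar> * W" using sW[of s] s by simp
  have d: "((\<lambda>r. exp (\<mu> * (r - s)) * (z r + c)) has_real_derivative
      exp (\<mu> * (r - s)) * \<mu> * (c - \<sigma> * (\<beta> r - \<beta> s))) (at r)" if "s < r" "r < t" for r c
  proof -
    have 1: "((\<lambda>r. exp (\<mu> * (r - s))) has_real_derivative exp (\<mu> * (r - s)) * \<mu>) (at r)"
      by (auto intro!: derivative_eq_intros)
    have 2: "((\<lambda>r. z r + c) has_real_derivative - \<mu> * x r) (at r)"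
      using DERIV_add[OF dz[OF that] DERIV_const] by simp
    have "exp (\<mu> * (r - s)) * \<mu> * (z r + c) + - \<mu> * x r * exp (\<mu> * (r - s)) =
        exp (\<mu> * (r - s)) * \<mu> * (c - \<sigma> * (\<beta> r - \<beta> s))"
      using that by (simp add: z algebra_simps)
    with DERIV_mult[OF 1 2] show ?thesis by simp
  qed
  have c: "continuous_on {s..t} (\<lambda>r. exp (\<mu> * (r - s)) * (z r + c))" for c
    by (intro continuous_intros cz)
  have "exp (\<mu> * (t - s)) * (z t + - (\<bar>\<sigma>\<bar> * W)) \<le> exp (\<mu> * (s - s)) * (z s + - (\<bar>\<sigma>\<bar> * W))"
    using s(2) _ c
  proof (rule DERIV_nonpos_imp_decreasing_open)
    fix r assume r: "s < r" "r < t"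
    have "\<mu> * (- (\<bar>\<sigma>\<bar> * W) - \<sigma> * (\<beta> r - \<beta> s)) \<le> 0"
      using sW[of r] r \<mu>_pos by (intro mult_nonneg_nonpos) auto
    then show "\<exists>y. ((\<lambda>r. exp (\<mu> * (r - s)) * (z r + - (\<bar>\<sigma>\<bar> * W))) has_real_derivative y) (at r) \<and> y \<le> 0"
      by - (intro exI conjI, rule d[OF r], simp add: mult.assoc mult_nonneg_nonpos)
  qed
  moreover have "exp (\<mu> * (s - s)) * (z s + \<bar>\<sigma>\<bar> * W) \<le> exp (\<mu> * (t - s)) * (z t + \<bar>\<sigma>\<bar> * W)"
    using s(2) _ c
  proof (rule DERIV_nonneg_imp_increasing_open)
    fix r assume r: "s < r" "r < t"
    have "0 \<le> \<mu> * (\<bar>\<sigma>\<bar> * W - \<sigma> * (\<beta> r - \<beta> s))"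
      using sW[of r] r \<mu>_pos by (intro mult_nonneg_nonneg) auto
    then show "\<exists>y. ((\<lambda>r. exp (\<mu> * (r - s)) * (z r + \<bar>\<sigma>\<bar> * W)) has_real_derivative y) (at r) \<and> 0 \<le> y"
      by - (intro exI conjI, rule d[OF r], simp add: mult.assoc)
  qed
  moreover have "z s = x s" by (simp add: z_def)
  moreover have "exp (- \<mu> * (t - s)) * c = c / exp (\<mu> * (t - s))" for c
    by (simp add: exp_minus divide_inverse mult.commute)
  ultimately have "z t - \<bar>\<sigma>\<bar> * W \<le> exp (- \<mu> * (t - s)) * (x s - \<bar>\<sigma>\<bar> * W)"
    and "exp (- \<mu> * (t - s)) * (x s + \<bar>\<sigma>\<bar> * W) \<le> z t + \<bar>\<sigma>\<bar> * W"
    by (simp_all only: pos_le_divide_eq pos_divide_le_eq exp_gt_zero) (simp_all add: mult.commute)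
  moreover have "exp (- \<mu> * (t - s)) * (x s - \<bar>\<sigma>\<bar> * W) \<le> exp (- \<mu> * (t - s)) * \<bar>x s\<bar>"
    "exp (- \<mu> * (t - s)) * (- \<bar>x s\<bar>) \<le> exp (- \<mu> * (t - s)) * (x s + \<bar>\<sigma>\<bar> * W)"
    using sW0 by (intro mult_left_mono; simp)+
  ultimately have "\<bar>z t\<bar> \<le> exp (- \<mu> * (t - s)) * \<bar>x s\<bar> + \<bar>\<sigma>\<bar> * W"
    unfolding abs_le_iff[of "z t"] mult_minus_right by linarith
  then show ?thesis using z[OF s(2)] sW[OF s(2)] by simp
qed

text \<open>Contraction by \<open>exp (- \<mu>)\<close> per unit of time absorbs the accumulated
  noise, so \<open>x\<close> inherits the growth rate of the oscillation of \<beta> over unit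
  intervals.\<close>

lemma growth:
  assumes a: "0 \<le> a" and c: "0 \<le> c"
    and W: "\<And>k t. real k \<le> t \<Longrightarrow> t \<le> real (Suc k) \<Longrightarrow> \<bar>\<beta> t - \<beta> (real k)\<bar> \<le> c * (real k + 1) powr a"
  shows "\<exists>C\<ge>0. \<forall>t\<ge>0. \<bar>x t\<bar> \<le> C * (t + 1) powr a"
proof -
  define q where "q = exp (- \<mu>)"
  have q: "0 < q" "q < 1" using \<mu>_pos by (auto simp: q_def)
  \<comment> \<open>The fixed point of \<open>C = q * C + 2 * \<bar>\<sigma>\<bar> * c\<close>, the
    recursion over one unit of time.\<close>
  define C where "C = 2 * \<bar>\<sigma>\<bar> * c / (1 - q)"
  have C: "0 \<le> C" using c q by (simp add: C_def)
  have Cq: "q * C + 2 * \<bar>\<sigma>\<bar> * c = C" using q by (simp add: C_def field_simps)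
  have step: "\<bar>x (real k)\<bar> \<le> C * (real k + 1) powr a" for k
  proof (induction k)
    case 0
    then show ?case using C by (simp add: x_0)
  next
    case (Suc k)
    have "\<bar>x (real (Suc k))\<bar> \<le> exp (- \<mu> * (real (Suc k) - real k)) * \<bar>x (real k)\<bar> + 2 * \<bar>\<sigma>\<bar> * (c * (real k + 1) powr a)"
      by (intro relaxation W) auto
    also have "\<dots> \<le> q * (C * (real k + 1) powr a) + 2 * \<bar>\<sigma>\<bar> * (c * (real k + 1) powr a)"
      using Suc q by (auto simp: q_def)
    also have "\<dots> = (q * C + 2 * \<bar>\<sigma>\<bar> * c) * (real k + 1) powr a" by (simp add: algebra_simps)
    also have "\<dots> \<le> C * (real (Suc k) + 1) powr a"
      unfolding Cq using C a by (intro mult_left_mono powr_mono2) auto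
    finally show ?case .
  qed
  have "\<bar>x t\<bar> \<le> (C + 2 * \<bar>\<sigma>\<bar> * c) * (t + 1) powr a" if "t \<ge> 0" for t
  proof -
    define k where "k = nat \<lfloor>t\<rfloor>"
    have k: "real k \<le> t" "t \<le> real (Suc k)" using that by (auto simp: k_def) linarith
    have "\<bar>x t\<bar> \<le> exp (- \<mu> * (t - real k)) * \<bar>x (real k)\<bar> + 2 * \<bar>\<sigma>\<bar> * (c * (real k + 1) powr a)"
      using k by (intro relaxation W) auto
    also have "\<dots> \<le> 1 * (C * (real k + 1) powr a) + 2 * \<bar>\<sigma>\<bar> * (c * (real k + 1) powr a)"
      using step[of k] k \<mu>_pos c by (intro add_mono mult_mono) auto
    also have "\<dots> = (C + 2 * \<bar>\<sigma>\<bar> * c) * (real k + 1) powr a" by (simp add: algebra_simps)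
    also have "\<dots> \<le> (C + 2 * \<bar>\<sigma>\<bar> * c) * (t + 1) powr a"
      using C c a k by (intro mult_left_mono powr_mono2) auto
    finally show ?thesis .
  qed
  then show ?thesis using C c by (intro exI[of _ "C + 2 * \<bar>\<sigma>\<bar> * c"]) auto
qed

end

section \<open>The explicit Euler scheme and its pathwise convergence\<close>

primrec ou_euler :: "real \<Rightarrow> real \<Rightarrow> nat \<Rightarrow> (real \<Rightarrow> real) \<Rightarrow> nat \<Rightarrow> real" where
  "ou_euler \<mu> \<sigma> m \<beta> 0 = 0"
| "ou_euler \<mu> \<sigma> m \<beta> (Suc k) = (1 - \<mu> / 2 ^ m) * ou_euler \<mu> \<sigma> m \<beta> k
     + \<sigma> * (\<beta> (real (Suc k) / 2 ^ m) - \<beta> (real k / 2 ^ m))"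

lemma sum_by_parts:
  fixes g c :: "nat \<Rightarrow> real"
  shows "(\<Sum>k<N. g k * (c (Suc k) - c k)) = g N * c N - g 0 * c 0 - (\<Sum>k<N. (g (Suc k) - g k) * c (Suc k))"
  by (induction N) (auto simp: algebra_simps)

text \<open>The noise cancels in the error, which therefore follows the contraction of the scheme,
  forced by the quadrature error of the drift. The bound on its increments prepares a summation by
  parts against a driver that is merely continuous.\<close>

lemma (in ou_path) euler_error:
  assumes m: "\<mu> / 2 ^ m \<le> 1" and \<eta>: "0 \<le> \<eta>"
    and osc: "\<And>k s. k < N \<Longrightarrow> real k / 2 ^ m \<le> s \<Longrightarrow> s \<le> real (Suc k) / 2 ^ m \<Longrightarrow> \<bar>x s - x (real k / 2 ^ m)\<bar> \<le> \<eta>"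
  defines "e \<equiv> \<lambda>k. ou_euler \<mu> \<sigma> m \<beta> k - x (real k / 2 ^ m)"
  shows "k \<le> N \<Longrightarrow> \<bar>e k\<bar> \<le> \<mu> * \<eta> * (real k / 2 ^ m)"
    and "k < N \<Longrightarrow> \<bar>e (Suc k) - e k\<bar> \<le> \<mu> / 2 ^ m * (\<bar>e k\<bar> + \<eta>)"
proof -
  define I where "I k = integral {real k / 2 ^ m..real (Suc k) / 2 ^ m} (\<lambda>s. x s - x (real k / 2 ^ m))" for k
  have I: "\<bar>I k\<bar> \<le> \<eta> * (1 / 2 ^ m)" if "k < N" for k
  proof -
    have "norm (I k) \<le> \<eta> * (real (Suc k) / 2 ^ m - real k / 2 ^ m)"
      unfolding I_def using osc[OF that]
      by (intro integral_bound continuous_intros cont_Icc) (auto simp: divide_right_mono)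
    then show ?thesis by (simp add: diff_divide_distrib[symmetric])
  qed
  have step: "e (Suc k) = (1 - \<mu> / 2 ^ m) * e k + \<mu> * I k" for k
  proof -
    have le: "real k / 2 ^ m \<le> real (Suc k) / 2 ^ m" by (simp add: divide_right_mono)
    have "x integrable_on {real k / 2 ^ m..real (Suc k) / 2 ^ m}"
      by (intro integrable_continuous_interval cont_Icc) simp
    then have "I k = integral {real k / 2 ^ m..real (Suc k) / 2 ^ m} x - (real (Suc k) / 2 ^ m - real k / 2 ^ m) * x (real k / 2 ^ m)"
      unfolding I_def using le by (subst Henstock_Kurzweil_Integration.integral_diff) auto
    also have "real (Suc k) / 2 ^ m - real k / 2 ^ m = 1 / 2 ^ m" by (simp add: diff_divide_distrib[symmetric])
    finally have "integral {real k / 2 ^ m..real (Suc k) / 2 ^ m} x = I k + x (real k / 2 ^ m) / 2 ^ m" by simp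
    moreover note increment[OF _ le]
    ultimately show ?thesis by (simp add: e_def algebra_simps del: of_nat_Suc)
  qed
  show "\<bar>e k\<bar> \<le> \<mu> * \<eta> * (real k / 2 ^ m)" if "k \<le> N"
    using that
  proof (induction k)
    case 0
    then show ?case by (simp add: e_def x_0)
  next
    case (Suc k)
    have "\<bar>e (Suc k)\<bar> \<le> \<bar>(1 - \<mu> / 2 ^ m) * e k\<bar> + \<bar>\<mu> * I k\<bar>" unfolding step by (rule abs_triangle_ineq)
    also have "\<bar>(1 - \<mu> / 2 ^ m) * e k\<bar> \<le> 1 * \<bar>e k\<bar>"
      unfolding abs_mult using m \<mu>_pos by (intro mult_right_mono) auto
    also have "\<bar>\<mu> * I k\<bar> \<le> \<mu> * (\<eta> * (1 / 2 ^ m))"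
      unfolding abs_mult using \<mu>_pos I[of k] Suc.prems by (intro mult_mono) auto
    finally show ?case using Suc by (simp add: field_simps)
  qed
  show "\<bar>e (Suc k) - e k\<bar> \<le> \<mu> / 2 ^ m * (\<bar>e k\<bar> + \<eta>)" if "k < N"
  proof -
    have "e (Suc k) - e k = \<mu> * I k - \<mu> / 2 ^ m * e k" by (simp add: step algebra_simps)
    then have "\<bar>e (Suc k) - e k\<bar> \<le> \<bar>\<mu> * I k\<bar> + \<bar>\<mu> / 2 ^ m * e k\<bar>" by (simp only: abs_triangle_ineq4)
    also have "\<bar>\<mu> * I k\<bar> \<le> \<mu> * (\<eta> * (1 / 2 ^ m))"
      unfolding abs_mult using \<mu>_pos I[OF that] by (intro mult_mono) auto
    also have "\<bar>\<mu> / 2 ^ m * e k\<bar> = \<mu> / 2 ^ m * \<bar>e k\<bar>" using \<mu>_pos by (simp add: abs_mult)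
    finally show ?thesis by (simp add: field_simps)
  qed
qed

text \<open>Uniform smallness of the error does not control its sum against increments of \<gamma>.
  Summation by parts moves the differences to the error, whose increments are small relative to the
  step.\<close>

lemma (in ou_path) euler_limit:
  assumes c\<gamma>: "continuous_on {0..} \<gamma>"
  shows "(\<lambda>n. ou_euler \<mu> \<sigma> (j + n) \<beta> (a * 2 ^ n)) \<longlonglongrightarrow> x (real a / 2 ^ j)"
    and "(\<lambda>n. (\<Sum>k<a * 2 ^ n. (1/2) * (ou_euler \<mu> \<sigma> (j + n) \<beta> k + ou_euler \<mu> \<sigma> (j + n) \<beta> (Suc k)) *
        (\<gamma> (real (Suc k) / 2 ^ (j + n)) - \<gamma> (real k / 2 ^ (j + n)))) -
      (\<Sum>k<a * 2 ^ n. (1/2) * (x (real k / 2 ^ (j + n)) + x (real (Suc k) / 2 ^ (j + n))) *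
        (\<gamma> (real (Suc k) / 2 ^ (j + n)) - \<gamma> (real k / 2 ^ (j + n))))) \<longlonglongrightarrow> 0"
proof -
  \<comment> \<open>The extra unit leaves room for the grid point after \<open>a / 2 ^ j\<close>,
    which the averages of neighbouring errors reach.\<close>
  define T where "T = real a / 2 ^ j + 1"
  have T: "T \<ge> 1" by (simp add: T_def)
  define e where "e n k = ou_euler \<mu> \<sigma> (j + n) \<beta> k - x (real k / 2 ^ (j + n))" for n k
  define N where "N n = a * 2 ^ n" for n
  have bounds: "\<forall>\<^sub>F n in sequentially. (\<forall>k\<le>Suc (N n). \<bar>e n k\<bar> \<le> \<mu> * \<eta> * T) \<and>
      (\<forall>k<Suc (N n). \<bar>e n (Suc k) - e n k\<bar> \<le> \<mu> / 2 ^ (j + n) * (\<mu> * T + 1) * \<eta>)"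
    if \<eta>: "0 < \<eta>" for \<eta>
  proof -
    have "(\<lambda>n. (1/2) ^ n * (1/2) ^ j) \<longlonglongrightarrow> 0 * (1/2 :: real) ^ j"
      by (intro tendsto_mult_right LIMSEQ_power_zero) simp
    then have "(\<lambda>n. 1 / 2 ^ (j + n) :: real) \<longlonglongrightarrow> 0" by (simp add: power_add power_divide mult.commute)
    then have "\<forall>\<^sub>F n in sequentially. 1 / 2 ^ (j + n) < 1 / \<mu>"
      using \<mu>_pos by (intro order_tendstoD(2)) auto
    moreover have "\<forall>\<^sub>F n in sequentially. \<forall>q r. 0 \<le> q \<and> q \<le> r \<and> r \<le> T + 1 \<and> r \<le> q + 1 / 2 ^ (j + n) \<longrightarrow> dist (x r) (x q) < \<eta>"
      by (rule uniformly_close_dyadic[OF cont_Icc \<eta>]) simp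
    ultimately show ?thesis
    proof eventually_elim
      case (elim n)
      have m: "\<mu> / 2 ^ (j + n) \<le> 1" using elim(1) \<mu>_pos by (simp add: field_simps)
      have Nn: "real (N n) / 2 ^ (j + n) = real a / 2 ^ j" by (simp add: N_def power_add)
      have kT: "real k / 2 ^ (j + n) \<le> T" if "k \<le> Suc (N n)" for k
      proof -
        have "real k / 2 ^ (j + n) \<le> (real (N n) + 1) / 2 ^ (j + n)" using that by (intro divide_right_mono) auto
        also have "\<dots> \<le> T" unfolding T_def add_divide_distrib Nn by simp
        finally show ?thesis .
      qed
      have osc: "\<bar>x s - x (real k / 2 ^ (j + n))\<bar> \<le> \<eta>"
        if "k < Suc (N n)" "real k / 2 ^ (j + n) \<le> s" "s \<le> real (Suc k) / 2 ^ (j + n)" for k s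
        using elim(2)[rule_format, of "real k / 2 ^ (j + n)" s] that kT[of "Suc k"]
        by (simp add: dist_real_def add_divide_distrib)
      note err = euler_error[OF m less_imp_le[OF \<eta>] osc, folded e_def]
      have 1: "\<bar>e n k\<bar> \<le> \<mu> * \<eta> * T" if "k \<le> Suc (N n)" for k
        using err(1)[OF _ _ _ that] kT[OF that] \<mu>_pos \<eta>
        by (smt (verit) mult_left_mono mult_pos_pos)
      have "\<bar>e n (Suc k) - e n k\<bar> \<le> \<mu> / 2 ^ (j + n) * (\<mu> * T + 1) * \<eta>" if "k < Suc (N n)" for k
      proof -
        have "\<bar>e n (Suc k) - e n k\<bar> \<le> \<mu> / 2 ^ (j + n) * (\<bar>e n k\<bar> + \<eta>)" by (rule err(2)[OF _ _ _ that])
        also have "\<dots> \<le> \<mu> / 2 ^ (j + n) * (\<mu> * \<eta> * T + \<eta>)"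
          using 1[of k] that \<mu>_pos by (intro mult_left_mono) auto
        finally show ?thesis by (simp add: algebra_simps)
      qed
      with 1 show ?case by blast
    qed
  qed
  have "(\<lambda>n. e n (N n)) \<longlonglongrightarrow> 0"
  proof (rule tendstoI)
    fix r :: real assume r: "r > 0"
    define \<eta> where "\<eta> = r / (2 * \<mu> * T)"
    have \<eta>: "\<eta> > 0" "\<mu> * \<eta> * T < r" using r \<mu>_pos T by (auto simp: \<eta>_def)
    from bounds[OF \<eta>(1)] show "\<forall>\<^sub>F n in sequentially. dist (e n (N n)) 0 < r"
    proof eventually_elim
      case (elim n)
      then have "\<bar>e n (N n)\<bar> \<le> \<mu> * \<eta> * T" by simp
      also note \<eta>(2)
      finally show ?case by (simp add: dist_real_def)
    qed
  qed
  then show "(\<lambda>n. ou_euler \<mu> \<sigma> (j + n) \<beta> (a * 2 ^ n)) \<longlonglongrightarrow> x (real a / 2 ^ j)"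
    by (simp add: e_def N_def LIM_zero_iff power_add)
  have "continuous_on {0..T} \<gamma>" by (rule continuous_on_subset[OF c\<gamma>]) auto
  then obtain G where G: "0 < G" "\<And>t. 0 \<le> t \<Longrightarrow> t \<le> T \<Longrightarrow> \<bar>\<gamma> t\<bar> \<le> G"
    using compact_imp_bounded[OF compact_continuous_image[OF _ compact_Icc, of 0 T \<gamma>]] unfolding bounded_pos by auto
  define D where "D n k = real k / 2 ^ (j + n)" for n k
  have DT: "0 \<le> D n k" "D n k \<le> T" if "k \<le> N n" for n k
  proof -
    have "D n k \<le> real (N n) / 2 ^ (j + n)" using that by (simp add: D_def divide_right_mono)
    then show "D n k \<le> T" by (simp add: N_def T_def power_add)
  qed (simp add: D_def)
  have main: "(\<lambda>n. \<Sum>k<N n. (1/2) * (e n k + e n (Suc k)) * (\<gamma> (D n (Suc k)) - \<gamma> (D n k))) \<longlonglongrightarrow> 0"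
  proof (rule tendstoI)
    fix r :: real assume r: "r > 0"
    \<comment> \<open>The first summand pays for the two boundary terms of the summation by parts,
      the second for the remaining sum over a time at most \<open>T\<close>.\<close>
    define C where "C = 2 * \<mu> * T * G + T * (\<mu> * (\<mu> * T + 1) * G)"
    have C: "C > 0" unfolding C_def using \<mu>_pos T G(1) by (intro add_pos_pos mult_pos_pos) auto
    define \<eta> where "\<eta> = r / (2 * C)"
    have \<eta>: "\<eta> > 0" "C * \<eta> < r" using r C by (auto simp: \<eta>_def)
    from bounds[OF \<eta>(1)] show "\<forall>\<^sub>F n in sequentially. dist (\<Sum>k<N n. (1/2) * (e n k + e n (Suc k)) * (\<gamma> (D n (Suc k)) - \<gamma> (D n k))) 0 < r"
    proof eventually_elim
      case (elim n)
      define g where "g k = (1/2) * (e n k + e n (Suc k))" for k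
      have g: "\<bar>g k\<bar> \<le> \<mu> * \<eta> * T" if "k \<le> N n" for k
        using elim[THEN conjunct1, rule_format, of k] elim[THEN conjunct1, rule_format, of "Suc k"] that by (simp add: g_def)
      have dg: "\<bar>g (Suc k) - g k\<bar> \<le> \<mu> / 2 ^ (j + n) * (\<mu> * T + 1) * \<eta>" if "k < N n" for k
      proof -
        define c where "c = \<mu> / 2 ^ (j + n) * (\<mu> * T + 1) * \<eta>"
        have "\<bar>e n (Suc k) - e n k\<bar> \<le> c" "\<bar>e n (Suc (Suc k)) - e n (Suc k)\<bar> \<le> c"
          using elim[THEN conjunct2, rule_format, of k] elim[THEN conjunct2, rule_format, of "Suc k"] that
          by (simp_all add: c_def)
        then have "\<bar>e n (Suc (Suc k)) - e n k\<bar> \<le> 2 * c" by linarith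
        moreover have "g (Suc k) - g k = (e n (Suc (Suc k)) - e n k) / 2" by (simp add: g_def field_simps)
        ultimately show ?thesis unfolding c_def[symmetric] by simp
      qed
      have "\<bar>\<Sum>k<N n. (g (Suc k) - g k) * \<gamma> (D n (Suc k))\<bar> \<le> (\<Sum>k<N n. \<mu> / 2 ^ (j + n) * (\<mu> * T + 1) * \<eta> * G)"
      proof (intro order_trans[OF sum_abs] sum_mono)
        fix k assume "k \<in> {..<N n}"
        then have k: "k < N n" "Suc k \<le> N n" by auto
        show "\<bar>(g (Suc k) - g k) * \<gamma> (D n (Suc k))\<bar> \<le> \<mu> / 2 ^ (j + n) * (\<mu> * T + 1) * \<eta> * G"
          unfolding abs_mult using \<mu>_pos T \<eta> by (intro mult_mono dg k G(2) DT) auto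
      qed
      also have "\<dots> = (real (N n) / 2 ^ (j + n)) * (\<mu> * (\<mu> * T + 1) * \<eta> * G)" by simp
      also have "\<dots> \<le> T * (\<mu> * (\<mu> * T + 1) * \<eta> * G)"
        using DT[of "N n" n] \<mu>_pos T \<eta> G by (intro mult_right_mono) (auto simp: D_def)
      finally have 1: "\<bar>\<Sum>k<N n. (g (Suc k) - g k) * \<gamma> (D n (Suc k))\<bar> \<le> T * (\<mu> * (\<mu> * T + 1) * \<eta> * G)" .
      have 2: "\<bar>g k * \<gamma> (D n k)\<bar> \<le> \<mu> * \<eta> * T * G" if "k \<le> N n" for k
        unfolding abs_mult using g[OF that] G(2)[OF DT[OF that]] \<mu>_pos \<eta> T by (intro mult_mono) auto
      have "\<bar>\<Sum>k<N n. g k * (\<gamma> (D n (Suc k)) - \<gamma> (D n k))\<bar> \<le> C * \<eta>"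
        unfolding sum_by_parts[of g "\<lambda>k. \<gamma> (D n k)"] using 1 2[of 0] 2[of "N n"] by (simp add: C_def algebra_simps)
      then show ?case using \<eta>(2) unfolding g_def by (simp add: dist_real_def)
    qed
  qed
  then show "(\<lambda>n. (\<Sum>k<a * 2 ^ n. (1/2) * (ou_euler \<mu> \<sigma> (j + n) \<beta> k + ou_euler \<mu> \<sigma> (j + n) \<beta> (Suc k)) *
        (\<gamma> (real (Suc k) / 2 ^ (j + n)) - \<gamma> (real k / 2 ^ (j + n)))) -
      (\<Sum>k<a * 2 ^ n. (1/2) * (x (real k / 2 ^ (j + n)) + x (real (Suc k) / 2 ^ (j + n))) *
        (\<gamma> (real (Suc k) / 2 ^ (j + n)) - \<gamma> (real k / 2 ^ (j + n))))) \<longlonglongrightarrow> 0"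
    unfolding sum_subtractf[symmetric] e_def N_def D_def by (simp add: algebra_simps del: of_nat_Suc ou_euler.simps)
qed

subsection \<open>The Gaussian space of a fractional Brownian motion\<close>

text \<open>Moments in place of the law, so that degenerate variables fit without a case
  distinction. The vanishing mean removes the odd mixed terms when independent variables are
  added.\<close>

definition gaussian_moments :: "'w measure \<Rightarrow> ('w \<Rightarrow> real) \<Rightarrow> bool" where
  "gaussian_moments M Z \<longleftrightarrow> Z \<in> borel_measurable M \<and> integrable M (\<lambda>w. Z w ^ 4) \<and>
     (\<integral>w. Z w \<partial>M) = 0 \<and> (\<integral>w. Z w ^ 4 \<partial>M) = 3 * (\<integral>w. (Z w)\<^sup>2 \<partial>M)\<^sup>2"

lemma (in prob_space) gaussian_moments_centred_gaussian_rv: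
  assumes "centred_gaussian_rv M Z" shows "gaussian_moments M Z"
proof -
  have Z[measurable]: "Z \<in> borel_measurable M" using assms unfolding centred_gaussian_rv_def by blast
  consider (nondeg) s where "s > 0" "distributed M lborel Z (normal_density 0 s)" | (deg) "AE w in M. Z w = 0"
    using assms unfolding centred_gaussian_rv_def by blast
  then show ?thesis
  proof cases
    case nondeg
    have int: "(\<integral>w. Z w ^ k \<partial>M) = (\<integral>x. normal_density 0 s x * x ^ k \<partial>lborel)" for k
      by (rule distributed_integral[OF nondeg(2), symmetric]) auto
    have "integrable M (\<lambda>w. Z w ^ k)" for k
      by (subst distributed_integrable[OF nondeg(2), symmetric])
        (use integrable_normal_moment[OF nondeg(1), of 0 k] in auto)
    moreover have "(\<integral>w. Z w \<partial>M) = 0"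
      using int[of 1] integral_normal_moment_odd[OF nondeg(1), of 0 0] by simp
    moreover have "(\<integral>w. (Z w)\<^sup>2 \<partial>M) = s\<^sup>2"
      using int[of 2] integral_normal_moment_even[OF nondeg(1), of 0 1] by simp
    moreover have "(\<integral>w. Z w ^ 4 \<partial>M) = 3 * (s\<^sup>2)\<^sup>2"
      using int[of 4] integral_normal_moment_even[OF nondeg(1), of 0 2] by (simp add: fact_numeral power_divide)
    ultimately show ?thesis unfolding gaussian_moments_def by simp
  next
    case deg
    have "AE w in M. Z w ^ k = 0" if "k > 0" for k using deg by eventually_elim (use that in simp)
    then have z: "(\<integral>w. Z w ^ k \<partial>M) = 0" "integrable M (\<lambda>w. Z w ^ k)" if "k > 0" for k
      using integral_cong_AE[of "\<lambda>w. Z w ^ k" M "\<lambda>_. 0"] integrable_cong_AE[of "\<lambda>w. Z w ^ k" M "\<lambda>_. 0"] that by auto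
    then show ?thesis using z[of 1] unfolding gaussian_moments_def by simp
  qed
qed

lemma (in prob_space) integrable_power_le_4:
  fixes Z :: "'a \<Rightarrow> real"
  assumes [measurable]: "Z \<in> borel_measurable M" and int: "integrable M (\<lambda>w. Z w ^ 4)" and k: "k \<le> 4"
  shows "integrable M (\<lambda>w. Z w ^ k)"
proof (rule Bochner_Integration.integrable_bound)
  show "integrable M (\<lambda>w. 1 + Z w ^ 4)" using int by simp
  have "\<bar>x\<bar> ^ k \<le> 1 + x ^ 4" for x :: real
  proof (cases "\<bar>x\<bar> \<le> 1")
    case True
    then have "\<bar>x\<bar> ^ k \<le> 1" by (intro power_le_one) auto
    then show ?thesis by (simp add: add_increasing2)
  next
    case False
    then have "\<bar>x\<bar> ^ k \<le> \<bar>x\<bar> ^ 4" using k by (intro power_increasing) auto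
    then show ?thesis by simp
  qed
  then show "AE w in M. norm (Z w ^ k) \<le> norm (1 + Z w ^ 4)" by (simp add: power_abs)
qed simp

text \<open>Mixed terms with a single factor of one variable vanish with its mean; for variances
  \<open>a\<close>, \<open>b\<close> the rest is \<open>3 * a\<^sup>2 + 6 * a * b + 3 * b\<^sup>2 =
  3 * (a + b)\<^sup>2\<close>.\<close>

lemma (in prob_space) gaussian_moments_add_indep:
  assumes ind: "indep_var borel Y borel Z" and Y: "gaussian_moments M Y" and Z: "gaussian_moments M Z"
  shows "gaussian_moments M (\<lambda>w. Y w + Z w)"
proof -
  have [measurable]: "Y \<in> borel_measurable M" "Z \<in> borel_measurable M"
    using Y Z unfolding gaussian_moments_def by auto
  have iY: "integrable M (\<lambda>w. Y w ^ k)" and iZ: "integrable M (\<lambda>w. Z w ^ k)" if "k \<le> 4" for k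
    using Y Z that unfolding gaussian_moments_def by (auto intro: integrable_power_le_4)
  have ind': "indep_var borel (\<lambda>w. Y w ^ k) borel (\<lambda>w. Z w ^ l)" for k l
    using indep_var_compose[OF ind, of "\<lambda>x. x ^ k" borel "\<lambda>x. x ^ l" borel] by (simp add: comp_def)
  have mix: "integrable M (\<lambda>w. Y w ^ k * Z w ^ l)"
    "(\<integral>w. Y w ^ k * Z w ^ l \<partial>M) = (\<integral>w. Y w ^ k \<partial>M) * (\<integral>w. Z w ^ l \<partial>M)" if "k \<le> 4" "l \<le> 4" for k l
    using indep_var_integrable[OF ind' iY iZ] indep_var_lebesgue_integral[OF ind' iY iZ] that by auto
  have mY: "(\<integral>w. Y w \<partial>M) = 0" and mZ: "(\<integral>w. Z w \<partial>M) = 0"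
    and Y4: "(\<integral>w. Y w ^ 4 \<partial>M) = 3 * (\<integral>w. (Y w)\<^sup>2 \<partial>M)\<^sup>2"
    and Z4: "(\<integral>w. Z w ^ 4 \<partial>M) = 3 * (\<integral>w. (Z w)\<^sup>2 \<partial>M)\<^sup>2"
    using Y Z unfolding gaussian_moments_def by auto
  have e4: "(Y w + Z w) ^ 4 = Y w ^ 4 + 4 * (Y w ^ 3 * Z w ^ 1) + 6 * (Y w ^ 2 * Z w ^ 2) + 4 * (Y w ^ 1 * Z w ^ 3) + Z w ^ 4" for w
    by (simp add: eval_nat_numeral algebra_simps)
  have e2: "(Y w + Z w)\<^sup>2 = Y w ^ 2 + 2 * (Y w ^ 1 * Z w ^ 1) + Z w ^ 2" for w
    by (simp add: power2_eq_square algebra_simps)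
  have i4: "integrable M (\<lambda>w. (Y w + Z w) ^ 4)"
    unfolding e4 by (intro Bochner_Integration.integrable_add Bochner_Integration.integrable_mult_right mix iY iZ) auto
  have m1: "(\<integral>w. Y w + Z w \<partial>M) = 0"
    using iY[of 1] iZ[of 1] mY mZ by simp
  have "(\<integral>w. (Y w + Z w) ^ 4 \<partial>M) = (\<integral>w. Y w ^ 4 \<partial>M) + 6 * ((\<integral>w. Y w ^ 2 \<partial>M) * (\<integral>w. Z w ^ 2 \<partial>M)) + (\<integral>w. Z w ^ 4 \<partial>M)"
    unfolding e4 using mix[of 3 1] mix[of 2 2] mix[of 1 3] iY[of 4] iZ[of 4] mY mZ by simp
  also have "\<dots> = 3 * ((\<integral>w. Y w ^ 2 \<partial>M) + (\<integral>w. Z w ^ 2 \<partial>M))\<^sup>2"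
    unfolding Y4 Z4 by (simp add: power2_sum)
  also have "(\<integral>w. Y w ^ 2 \<partial>M) + (\<integral>w. Z w ^ 2 \<partial>M) = (\<integral>w. (Y w + Z w)\<^sup>2 \<partial>M)"
    unfolding e2 using mix[of 1 1] iY[of 2] iZ[of 2] mY mZ by simp
  finally show ?thesis
    using i4 m1 unfolding gaussian_moments_def by simp
qed

lemma (in prob_space) gaussian_moments_sum_indep:
  assumes "finite I" "indep_vars (\<lambda>_. borel) Y I" "\<And>i. i \<in> I \<Longrightarrow> gaussian_moments M (Y i)"
  shows "gaussian_moments M (\<lambda>w. \<Sum>i\<in>I. Y i w)"
  using assms
proof (induction I rule: finite_induct)
  case empty
  then show ?case by (simp add: gaussian_moments_def)
next
  case (insert i I)
  have "indep_var borel (Y i) borel (\<lambda>w. \<Sum>i\<in>I. Y i w)"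
    by (rule indep_vars_sum[OF insert.hyps insert.prems(1)])
  moreover have "gaussian_moments M (\<lambda>w. \<Sum>i\<in>I. Y i w)"
    by (rule insert.IH) (use insert.prems in \<open>auto intro: indep_vars_subset\<close>)
  ultimately show ?case
    using gaussian_moments_add_indep[of "Y i" "\<lambda>w. \<Sum>i\<in>I. Y i w"] insert.prems(2)[of i] insert.hyps by simp
qed

text \<open>One set of times for all coordinates is no restriction, since coefficients may be
  0.\<close>

definition fbm_span :: "(real \<Rightarrow> 'w \<Rightarrow> real ^ 'd) \<Rightarrow> ('w \<Rightarrow> real) set" where
  "fbm_span B = {Z. \<exists>J c. finite J \<and> J \<subseteq> {0..} \<and> Z = (\<lambda>w. \<Sum>i\<in>UNIV. \<Sum>t\<in>J. c i t * B t w $ i)}"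

lemma fbm_span_lin:
  assumes "Y \<in> fbm_span B" "Z \<in> fbm_span B"
  shows "(\<lambda>w. a * Y w + b * Z w) \<in> fbm_span B"
proof -
  obtain J c J' c' where J: "finite J" "J \<subseteq> {0..}" "Y = (\<lambda>w. \<Sum>i\<in>UNIV. \<Sum>t\<in>J. c i t * B t w $ i)"
    and J': "finite J'" "J' \<subseteq> {0..}" "Z = (\<lambda>w. \<Sum>i\<in>UNIV. \<Sum>t\<in>J'. c' i t * B t w $ i)"
    using assms unfolding fbm_span_def by blast
  define e where "e i t = a * (if t \<in> J then c i t else 0) + b * (if t \<in> J' then c' i t else 0)" for i t
  have ext: "(\<Sum>t\<in>A. f t) = (\<Sum>t\<in>J \<union> J'. if t \<in> A then f t else 0)"
    if "A \<subseteq> J \<union> J'" for A and f :: "real \<Rightarrow> real"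
    using that J(1) J'(1) by (intro sum.mono_neutral_cong_left) auto
  have "a * Y w + b * Z w = (\<Sum>i\<in>UNIV. \<Sum>t\<in>J \<union> J'. e i t * B t w $ i)" for w
  proof -
    have "a * (\<Sum>t\<in>J. c i t * B t w $ i) + b * (\<Sum>t\<in>J'. c' i t * B t w $ i) = (\<Sum>t\<in>J \<union> J'. e i t * B t w $ i)" for i
      unfolding ext[of J, OF Un_upper1] ext[of J', OF Un_upper2] sum_distrib_left sum.distrib[symmetric]
      by (rule sum.cong) (auto simp: e_def algebra_simps)
    then show ?thesis unfolding J(3) J'(3) sum_distrib_left[of _ _ UNIV] sum.distrib[symmetric] by simp
  qed
  then show ?thesis
    unfolding fbm_span_def using J(1,2) J'(1,2) by (intro CollectI exI[of _ "J \<union> J'"] exI[of _ e]) auto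
qed

lemma fbm_span_inner:
  assumes "0 \<le> t" shows "(\<lambda>w. u \<bullet> B t w) \<in> fbm_span B"
  unfolding fbm_span_def using assms
  by (intro CollectI exI[of _ "{t}"] exI[of _ "\<lambda>i _. u $ i"]) (auto simp: inner_vec_def)

text \<open>Independence of the coordinates as path-valued variables is pushed through finite
  evaluations. The times may depend on the coordinate, as the covariance of two coordinates at
  different times requires.\<close>

lemma fractional_brownian_motion_indep_marginals:
  fixes B :: "real \<Rightarrow> 'w \<Rightarrow> real ^ 'd"
  assumes M: "prob_space M" and B: "fractional_brownian_motion M H B"
    and J: "\<And>i. finite (J i)" "\<And>i. J i \<subseteq> {0..}"
  shows "prob_space.indep_vars M (\<lambda>_. borel) (\<lambda>i w. \<Sum>t\<in>J i. c i t * B t w $ i) UNIV"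
    and "gaussian_moments M (\<lambda>w. \<Sum>t\<in>J i. c i t * B t w $ i)"
proof -
  interpret prob_space M by fact
  have "indep_vars (\<lambda>_::'d. PiM {0..} (\<lambda>_. borel)) (\<lambda>i w. \<lambda>t\<in>{0..}. B t w $ i) UNIV"
    using B unfolding fractional_brownian_motion_def by blast
  then have "indep_vars (\<lambda>_. borel) (\<lambda>i w. \<Sum>t\<in>J i. c i t * (\<lambda>t\<in>{0..}. B t w $ i) t) UNIV"
  proof (rule indep_vars_compose2)
    fix i :: 'd
    show "(\<lambda>f. \<Sum>t\<in>J i. c i t * f t) \<in> borel_measurable (PiM {0..} (\<lambda>_. borel))"
      using J(2)[of i] by (intro borel_measurable_sum borel_measurable_times borel_measurable_const
          measurable_component_singleton) auto
  qed
  moreover have "(\<Sum>t\<in>J i. c i t * (\<lambda>t\<in>{0..}. B t w $ i) t) = (\<Sum>t\<in>J i. c i t * B t w $ i)" for i w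
    using J(2)[of i] by (intro sum.cong) auto
  ultimately show "indep_vars (\<lambda>_. borel) (\<lambda>i w. \<Sum>t\<in>J i. c i t * B t w $ i) UNIV" by simp
  have "centred_gaussian_rv M (\<lambda>w. \<Sum>t\<in>J i. c i t * B t w $ i)"
    using B J[of i] unfolding fractional_brownian_motion_def centred_gaussian_process_def by simp
  then show "gaussian_moments M (\<lambda>w. \<Sum>t\<in>J i. c i t * B t w $ i)"
    by (rule gaussian_moments_centred_gaussian_rv)
qed

lemma gaussian_moments_fbm_span:
  fixes B :: "real \<Rightarrow> 'w \<Rightarrow> real ^ 'd"
  assumes M: "prob_space M" and B: "fractional_brownian_motion M H B" and Z: "Z \<in> fbm_span B"
  shows "gaussian_moments M Z"
proof -
  obtain J c where J: "finite J" "J \<subseteq> {0..}" "Z = (\<lambda>w. \<Sum>i\<in>UNIV. \<Sum>t\<in>J. c i t * B t w $ i)"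
    using Z unfolding fbm_span_def by blast
  show ?thesis
    unfolding J(3)
    by (rule prob_space.gaussian_moments_sum_indep[OF M finite
          fractional_brownian_motion_indep_marginals[OF M B J(1,2)]])
qed

lemma gaussian_space_fbm_span:
  fixes B :: "real \<Rightarrow> 'w \<Rightarrow> real ^ 'd"
  assumes M: "prob_space M" and B: "fractional_brownian_motion M H B"
  shows "gaussian_space M (fbm_span B)"
  unfolding gaussian_space_def gaussian_space_axioms_def
proof (intro conjI allI impI)
  show "(\<lambda>_. 0) \<in> fbm_span B"
    unfolding fbm_span_def by (intro CollectI exI[of _ "{}"]) auto
qed (use M gaussian_moments_fbm_span[OF M B] fbm_span_lin in \<open>simp_all add: gaussian_moments_def\<close>)

text \<open>Different coordinates are independent and centred, so only diagonal terms survive the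
  expansion. In particular, orthogonal directions have uncorrelated projections.\<close>

lemma fbm_covariance:
  fixes B :: "real \<Rightarrow> 'w \<Rightarrow> real ^ 'd"
  assumes M: "prob_space M" and B: "fractional_brownian_motion M H B" and st: "0 \<le> s" "0 \<le> t"
  shows "(\<integral>w. (u \<bullet> B s w) * (v \<bullet> B t w) \<partial>M) =
    (u \<bullet> v) * ((1/2) * (s powr (2*H) + t powr (2*H) - \<bar>s - t\<bar> powr (2*H)))"
proof -
  interpret gaussian_space M "fbm_span B" by (rule gaussian_space_fbm_span[OF M B])
  define R where "R = (1/2) * (s powr (2*H) + t powr (2*H) - \<bar>s - t\<bar> powr (2*H))"
  have comp: "(\<lambda>w. B t w $ i) \<in> fbm_span B" if "0 \<le> t" for t i
    using fbm_span_inner[OF that, of "axis i 1" B] by (simp add: inner_axis')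
  have cov: "expectation (\<lambda>w. B s w $ i * B t w $ k) = (if i = k then R else 0)" for i k
  proof (cases "i = k")
    case True
    then show ?thesis using B st unfolding fractional_brownian_motion_def R_def by simp
  next
    case False
    define J where "J l = (if l = i then {s} else {t})" for l
    define Y where "Y l w = (\<Sum>r\<in>J l. 1 * B r w $ l)" for l w
    have J: "finite (J l)" "J l \<subseteq> {0..}" for l using st by (auto simp: J_def)
    have marg: "indep_vars (\<lambda>_. borel) Y UNIV" "gaussian_moments M (Y l)" for l
      using fractional_brownian_motion_indep_marginals[OF M B, of J "\<lambda>_ _. 1"] J unfolding Y_def by blast+
    have Y: "Y i = (\<lambda>w. B s w $ i)" "Y k = (\<lambda>w. B t w $ k)" using False by (auto simp: Y_def J_def)
    have "indep_vars (\<lambda>_. borel) Y (insert i {k})" by (rule indep_vars_subset[OF marg(1)]) auto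
    then have ind: "indep_var borel (Y i) borel (\<lambda>w. \<Sum>l\<in>{k}. Y l w)"
      using False by (intro indep_vars_sum) auto
    have int: "integrable M (Y l)" and zero: "expectation (Y l) = 0" for l
      using marg(2)[of l] integrable_power_le_4[of "Y l" 1] unfolding gaussian_moments_def by auto
    show ?thesis
      using indep_var_lebesgue_integral[OF ind] int[of i] int[of k] zero[of i] False by (simp add: Y)
  qed
  have "(\<lambda>w. (u \<bullet> B s w) * (v \<bullet> B t w)) = (\<lambda>w. \<Sum>i\<in>UNIV. \<Sum>k\<in>UNIV. (u $ i * v $ k) * (B s w $ i * B t w $ k))"
    by (simp add: inner_vec_def sum_product mult_ac)
  then have "expectation (\<lambda>w. (u \<bullet> B s w) * (v \<bullet> B t w)) =
      (\<Sum>i\<in>UNIV. \<Sum>k\<in>UNIV. (u $ i * v $ k) * expectation (\<lambda>w. B s w $ i * B t w $ k))"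
    using integrable_V_mult[OF comp[OF st(1)] comp[OF st(2)]] by (simp add: Bochner_Integration.integral_sum)
  also have "\<dots> = (\<Sum>i\<in>UNIV. \<Sum>k\<in>UNIV. if i = k then u $ i * v $ k * R else 0)"
    unfolding cov by (intro sum.cong) auto
  also have "\<dots> = (u \<bullet> v) * R"
    by (simp add: inner_vec_def sum_distrib_right)
  finally show ?thesis unfolding R_def .
qed

subsection \<open>Second moment estimates\<close>

text \<open>Two mean value theorems give \<open>a * (a - 1) * \<eta> powr (a - 2)\<close> with
  \<open>\<eta> > m - 1\<close>, which is at least \<open>m / 2\<close> once
  \<open>m \<ge> 2\<close>. For \<open>m = 1\<close> this lower bound degenerates to 0, hence the
  separate case.\<close>

lemma powr_second_difference:
  fixes a :: real
  assumes a: "0 < a" "a \<le> 1" and m: "1 \<le> m"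
  shows "\<bar>(real m + 1) powr a + (real m - 1) powr a - 2 * real m powr a\<bar> \<le> real m powr (a - 2)"
proof (cases "m = 1")
  case True
  have "1 \<le> 2 powr a" "2 powr a \<le> 2" using a powr_mono[of a 1 "2::real"] by (auto simp: ge_one_powr_ge_zero)
  then show ?thesis using True by simp
next
  case False
  then have m2: "real m \<ge> 2" using m by simp
  define f where "f x = (x + 1) powr a - x powr a" for x :: real
  define f' where "f' x = a * ((x + 1) powr (a - 1) - x powr (a - 1))" for x :: real
  have df: "(f has_real_derivative f' x) (at x)" if "x > 0" for x
  proof -
    have "((\<lambda>x. (x + 1) powr a) has_real_derivative a * (x + 1) powr (a - 1)) (at x)"
      by (rule DERIV_shift[THEN iffD1, OF has_real_derivative_powr]) (use that in simp)
    from DERIV_diff[OF this has_real_derivative_powr[OF that]]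
    show ?thesis unfolding f_def f'_def by (simp add: right_diff_distrib)
  qed
  obtain \<xi> where \<xi>: "real m - 1 < \<xi>" "\<xi> < real m" "f (real m) - f (real m - 1) = (real m - (real m - 1)) * f' \<xi>"
    using MVT2[of "real m - 1" "real m" f f'] df m2 by auto
  have \<xi>0: "\<xi> > 0" using \<xi>(1) m2 by linarith
  have dg: "((\<lambda>x. x powr (a - 1)) has_real_derivative (a - 1) * x powr (a - 2)) (at x)" if "x > 0" for x
    using has_real_derivative_powr[OF that, of "a - 1"] by simp
  obtain \<eta> where \<eta>: "\<xi> < \<eta>" "\<eta> < \<xi> + 1" "(\<xi> + 1) powr (a - 1) - \<xi> powr (a - 1) = (\<xi> + 1 - \<xi>) * ((a - 1) * \<eta> powr (a - 2))"
    using MVT2[of \<xi> "\<xi> + 1" "\<lambda>x. x powr (a - 1)" "\<lambda>x. (a - 1) * x powr (a - 2)"] dg \<xi>0 by auto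
  have "(real m + 1) powr a + (real m - 1) powr a - 2 * real m powr a = a * (a - 1) * \<eta> powr (a - 2)"
  proof -
    have "(real m + 1) powr a + (real m - 1) powr a - 2 * real m powr a = f (real m) - f (real m - 1)"
      by (simp add: f_def)
    also have "\<dots> = f' \<xi>" using \<xi>(3) by simp
    also have "\<dots> = a * ((a - 1) * \<eta> powr (a - 2))" using \<eta>(3) by (simp add: f'_def)
    finally show ?thesis by simp
  qed
  then have "\<bar>(real m + 1) powr a + (real m - 1) powr a - 2 * real m powr a\<bar> = a * (1 - a) * \<eta> powr (a - 2)"
    using a by (simp add: abs_mult)
  \<comment> \<open>The factor 1/4 compensates the factor of at most 4 caused by replacing the base
    by \<open>m / 2\<close>.\<close>
  also have "\<dots> \<le> (1/4) * \<eta> powr (a - 2)"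
  proof (rule mult_right_mono)
    have "0 \<le> (a - 1/2)\<^sup>2" by simp
    then show "a * (1 - a) \<le> 1/4" by (simp add: power2_eq_square algebra_simps)
  qed simp
  also have "\<dots> \<le> (1/4) * (real m / 2) powr (a - 2)"
    using \<eta>(1) \<xi>(1) m2 a by (intro mult_left_mono powr_mono2') auto
  also have "(real m / 2) powr (a - 2) = real m powr (a - 2) * 2 powr (2 - a)"
    using powr_minus_divide[of 2 "a - 2"] by (simp add: powr_divide)
  also have "(1/4) * (real m powr (a - 2) * 2 powr (2 - a)) \<le> (1/4) * (real m powr (a - 2) * 2 powr 2)"
    using a by (intro mult_left_mono powr_mono) auto
  finally show ?thesis by simp
qed

text \<open>Comparison with telescoping cube roots: if \<open>y ^ 3 - x ^ 3 = 1\<close> and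
  \<open>0 \<le> x \<le> y\<close>, factorising gives
  \<open>1 / y\<^sup>2 \<le> 3 * (y - x)\<close>.\<close>

lemma sum_powr_two_thirds: "(\<Sum>m=1..n. real m powr (-2/3)) \<le> 3 * real n powr (1/3)"
proof (induction n)
  case (Suc n)
  define y where "y = (real n + 1) powr (1/3)"
  define x where "x = real n powr (1/3)"
  have y: "y > 0" "y ^ 3 = real n + 1" by (simp_all add: y_def powr_realpow[symmetric] powr_powr)
  have x: "x \<ge> 0" "x ^ 3 = real n" by (cases "n = 0"; simp add: x_def powr_realpow[symmetric] powr_powr)+
  have xy: "x \<le> y" unfolding x_def y_def by (intro powr_mono2) auto
  have "1 = (y - x) * (y\<^sup>2 + x * y + x\<^sup>2)" using x(2) y(2) by (simp add: eval_nat_numeral algebra_simps)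
  also have "\<dots> \<le> (y - x) * (y\<^sup>2 + y * y + y\<^sup>2)"
    using xy x(1) by (intro mult_left_mono add_mono mult_mono power_mono) auto
  finally have "1 / y\<^sup>2 \<le> 3 * (y - x)" using y(1) by (simp add: field_simps power2_eq_square)
  moreover have "(real n + 1) powr (-2/3) = 1 / y\<^sup>2"
    by (simp add: y_def powr_minus powr_powr powr_realpow[symmetric] field_simps)
  ultimately show ?case using Suc by (simp add: y_def x_def add.commute)
qed simp

locale fractional_gaussian_space = gaussian_space M V for M :: "'w measure" and V +
  fixes H :: real
  assumes H: "1/3 < H" "H \<le> 1/2"
begin

text \<open>Hoelder exponent of the integrands: \<open>\<theta> + 2H = 4/3\<close> exceeds \<open>1\<close> independently of \<open>H\<close>,
  and \<open>\<theta> \<le> 2H\<close> because \<open>H > 1/3\<close>.\<close>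

abbreviation "\<theta> \<equiv> 4/3 - 2 * H"

lemma \<theta>: "0 < \<theta>" "\<theta> \<le> 2 * H" "\<theta> \<le> 2"
  using H by auto

lemma covariance_increments:
  assumes X: "\<And>t. 0 \<le> t \<Longrightarrow> X t \<in> V"
    and cov: "\<And>s t. 0 \<le> s \<Longrightarrow> 0 \<le> t \<Longrightarrow> expectation (\<lambda>w. X s w * X t w) =
      (1/2) * (s powr (2*H) + t powr (2*H) - \<bar>s - t\<bar> powr (2*H))"
    and nn: "0 \<le> s" "0 \<le> t" "0 \<le> s'" "0 \<le> t'"
  shows "expectation (\<lambda>w. (X t w - X s w) * (X t' w - X s' w)) =
    (1/2) * (\<bar>t - s'\<bar> powr (2*H) + \<bar>s - t'\<bar> powr (2*H) - \<bar>t - t'\<bar> powr (2*H) - \<bar>s - s'\<bar> powr (2*H))"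
proof -
  have "(\<lambda>w. (X t w - X s w) * (X t' w - X s' w)) = (\<lambda>w. X t w * X t' w - X t w * X s' w - X s w * X t' w + X s w * X s' w)"
    by (auto simp: algebra_simps)
  then show ?thesis
    using integrable_V_mult[OF X X] nn by (simp add: cov field_simps abs_minus_commute)
qed

lemma increment_moment2:
  assumes X: "\<And>t. 0 \<le> t \<Longrightarrow> X t \<in> V"
    and cov: "\<And>s t. 0 \<le> s \<Longrightarrow> 0 \<le> t \<Longrightarrow> expectation (\<lambda>w. X s w * X t w) =
      (1/2) * (s powr (2*H) + t powr (2*H) - \<bar>s - t\<bar> powr (2*H))"
    and nn: "0 \<le> s" "0 \<le> t"
  shows "expectation (\<lambda>w. (X t w - X s w)\<^sup>2) = \<bar>t - s\<bar> powr (2*H)"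
  unfolding power2_eq_square using covariance_increments[OF X cov nn nn] H by (simp add: abs_minus_commute)

lemma increment_moment4:
  assumes X: "\<And>t. 0 \<le> t \<Longrightarrow> X t \<in> V"
    and cov: "\<And>s t. 0 \<le> s \<Longrightarrow> 0 \<le> t \<Longrightarrow> expectation (\<lambda>w. X s w * X t w) =
      (1/2) * (s powr (2*H) + t powr (2*H) - \<bar>s - t\<bar> powr (2*H))"
    and nn: "0 \<le> s" "0 \<le> t"
  shows "expectation (\<lambda>w. (X t w - X s w) ^ 4) = 3 * \<bar>t - s\<bar> powr (4*H)"
proof -
  have "expectation (\<lambda>w. (X t w - X s w) ^ 4) = 3 * (expectation (\<lambda>w. (X t w - X s w)\<^sup>2))\<^sup>2"
    by (rule V_moment4[OF V_diff[OF X X]]) (use nn in auto)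
  also have "\<dots> = 3 * \<bar>t - s\<bar> powr (4*H)"
  proof -
    have m2: "expectation (\<lambda>w. (X t w - X s w)\<^sup>2) = \<bar>t - s\<bar> powr (2*H)"
      by (rule increment_moment2[OF X cov nn])
    show ?thesis unfolding m2 by (simp add: power2_eq_square powr_add[symmetric])
  qed
  finally show ?thesis .
qed

lemma V_square_sum_le:
  assumes "Y \<in> V" "Z \<in> V"
  shows "expectation (\<lambda>w. (Y w + Z w)\<^sup>2) \<le> 2 * expectation (\<lambda>w. (Y w)\<^sup>2) + 2 * expectation (\<lambda>w. (Z w)\<^sup>2)"
proof -
  have "expectation (\<lambda>w. (Y w + Z w)\<^sup>2) \<le> expectation (\<lambda>w. 2 * (Y w)\<^sup>2 + 2 * (Z w)\<^sup>2)"
  proof (rule integral_mono)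
    show "(Y w + Z w)\<^sup>2 \<le> 2 * (Y w)\<^sup>2 + 2 * (Z w)\<^sup>2" for w
      using zero_le_power2[of "Y w - Z w"] by (simp add: power2_eq_square algebra_simps)
  qed (use integrable_V2[OF V_add[OF assms]] assms[THEN integrable_V2] in auto)
  then show ?thesis using assms[THEN integrable_V2] by simp
qed

lemma V_average_square_le:
  assumes "Y \<in> V" "Z \<in> V"
    and "expectation (\<lambda>w. (Y w)\<^sup>2) \<le> K" "expectation (\<lambda>w. (Z w)\<^sup>2) \<le> K"
  shows "expectation (\<lambda>w. ((1/2) * (Y w + Z w))\<^sup>2) \<le> K"
proof -
  have "expectation (\<lambda>w. ((1/2) * (Y w + Z w))\<^sup>2) = (1/4) * expectation (\<lambda>w. (Y w + Z w)\<^sup>2)"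
    by (simp add: power_mult_distrib power2_eq_square)
  then show ?thesis using V_square_sum_le[OF assms(1,2)] assms(3,4) by simp
qed

text \<open>Each side of \<open>k\<close> contributes at most one sum over the distances from 1 to
  \<open>N\<close>, whence \<open>6 = 2 * 3\<close>.\<close>

lemma sum_off_diagonal_le:
  assumes k: "k < N"
  shows "(\<Sum>l\<in>{..<N} - {k}. \<bar>real k - real l\<bar> powr (-2/3)) \<le> 6 * real N powr (1/3)"
proof -
  let ?f = "\<lambda>m. real m powr (-2/3)"
  have "{..<N} - {k} = {..<k} \<union> {k<..<N}" using k by auto
  moreover have "{..<k} \<inter> {k<..<N} = {}" by auto
  ultimately have "(\<Sum>l\<in>{..<N} - {k}. \<bar>real k - real l\<bar> powr (-2/3)) =
      (\<Sum>l<k. \<bar>real k - real l\<bar> powr (-2/3)) + (\<Sum>l\<in>{k<..<N}. \<bar>real k - real l\<bar> powr (-2/3))"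
    by (metis sum.union_disjoint finite_lessThan finite_greaterThanLessThan)
  also have "(\<Sum>l<k. \<bar>real k - real l\<bar> powr (-2/3)) = (\<Sum>m=1..k. ?f m)"
    by (rule sum.reindex_bij_witness[of _ "\<lambda>m. k - m" "\<lambda>l. k - l"]) (auto simp: of_nat_diff)
  also have "\<dots> \<le> (\<Sum>m=1..N. ?f m)" using k by (intro sum_mono2) auto
  also have "(\<Sum>l\<in>{k<..<N}. \<bar>real k - real l\<bar> powr (-2/3)) = (\<Sum>m=1..N - Suc k. ?f m)"
    by (rule sum.reindex_bij_witness[of _ "\<lambda>m. k + m" "\<lambda>l. l - k"]) (auto simp: of_nat_diff)
  also have "\<dots> \<le> (\<Sum>m=1..N. ?f m)" by (intro sum_mono2) auto
  finally show ?thesis using sum_powr_two_thirds[of N] by linarith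
qed

end

text \<open>Two uncorrelated drivers inside one Gaussian space. They will be the projections of the
  fractional Brownian motion onto two orthonormal eigenvectors of \<Gamma>.\<close>

locale fbm_pair = fractional_gaussian_space M V H for M :: "'w measure" and V and H :: real +
  fixes \<beta> \<gamma> :: "real \<Rightarrow> 'w \<Rightarrow> real"
  assumes \<beta>_V: "0 \<le> t \<Longrightarrow> \<beta> t \<in> V" and \<gamma>_V: "0 \<le> t \<Longrightarrow> \<gamma> t \<in> V"
    and \<beta>_cov: "0 \<le> s \<Longrightarrow> 0 \<le> t \<Longrightarrow> expectation (\<lambda>w. \<beta> s w * \<beta> t w) =
      (1/2) * (s powr (2*H) + t powr (2*H) - \<bar>s - t\<bar> powr (2*H))"
    and \<gamma>_cov: "0 \<le> s \<Longrightarrow> 0 \<le> t \<Longrightarrow> expectation (\<lambda>w. \<gamma> s w * \<gamma> t w) =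
      (1/2) * (s powr (2*H) + t powr (2*H) - \<bar>s - t\<bar> powr (2*H))"
    and \<beta>\<gamma>_cov: "0 \<le> s \<Longrightarrow> 0 \<le> t \<Longrightarrow> expectation (\<lambda>w. \<beta> s w * \<gamma> t w) = 0"
begin

text \<open>The polarised form of \<open>E[g\<^sub>k g\<^sub>l]\<close> separates a part in which the increments of \<open>\<gamma>\<close> telescope
  from a part that vanishes on the diagonal, where the increments are strongly correlated.\<close>

lemma second_moment_riemann_sum:
  assumes h: "0 < h" and a: "0 \<le> a" and C: "0 \<le> C"
    and g: "\<And>k. k < N \<Longrightarrow> g k \<in> V"
    and orth: "\<And>k t. k < N \<Longrightarrow> 0 \<le> t \<Longrightarrow> expectation (\<lambda>w. g k w * \<gamma> t w) = 0"
    and K: "\<And>k. k < N \<Longrightarrow> expectation (\<lambda>w. (g k w)\<^sup>2) \<le> K"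
    and hoelder: "\<And>k l. k < N \<Longrightarrow> l < N \<Longrightarrow> expectation (\<lambda>w. (g k w - g l w)\<^sup>2) \<le> C * (\<bar>real k - real l\<bar> * h) powr \<theta>"
  shows "expectation (\<lambda>w. (\<Sum>k<N. g k w * (\<gamma> (a + real (Suc k) * h) w - \<gamma> (a + real k * h) w))\<^sup>2)
    \<le> K * (real N * h) powr (2*H) + 4 * C * (real N * h) powr (4/3)"
proof -
  define d where "d k w = \<gamma> (a + real (Suc k) * h) w - \<gamma> (a + real k * h) w" for k w
  have nn: "0 \<le> a + real k * h" for k using a h by simp
  have d: "d k \<in> V" for k unfolding d_def by (intro V_diff \<gamma>_V nn)
  define \<rho> where "\<rho> k l = expectation (\<lambda>w. d k w * d l w)" for k l
  define r where "r k l = expectation (\<lambda>w. g k w * g l w)" for k l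
  define D where "D k l = expectation (\<lambda>w. (g k w - g l w)\<^sup>2)" for k l
  have od: "expectation (\<lambda>w. g k w * d l w) = 0" if "k < N" for k l
    unfolding d_def right_diff_distrib
    using integrable_V_mult[OF g[OF that] \<gamma>_V[OF nn]] orth[OF that nn] by (simp del: of_nat_Suc)
  have rD: "r k l = (1/2) * (r k k + r l l) - (1/2) * D k l" if "k < N" "l < N" for k l
  proof -
    have "D k l = expectation (\<lambda>w. g k w * g k w + g l w * g l w - 2 * (g k w * g l w))"
      unfolding D_def by (simp add: power2_eq_square algebra_simps)
    then show ?thesis
      using integrable_V_mult[OF g[OF that(1)] g[OF that(1)]] integrable_V_mult[OF g[OF that(2)] g[OF that(2)]]
        integrable_V_mult[OF g[OF that(1)] g[OF that(2)]] by (simp add: r_def field_simps)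
  qed
  have rsym: "\<rho> k l = \<rho> l k" for k l by (simp add: \<rho>_def mult.commute)
  \<comment> \<open>The covariance is a second difference of \<open>powr (2*H)\<close>, so it decays
    like the distance to the power \<open>2*H - 2\<close>.\<close>
  have \<rho>: "\<bar>\<rho> k l\<bar> \<le> h powr (2*H) * \<bar>real k - real l\<bar> powr (2*H - 2)" if "k \<noteq> l" for k l
  proof -
    have *: "\<bar>\<rho> k l\<bar> \<le> h powr (2*H) * \<bar>real k - real l\<bar> powr (2*H - 2)" if kl: "l < k" for k l
    proof -
      define m where "m = k - l"
      have m: "real k = real l + real m" "1 \<le> m" using kl by (auto simp: m_def)
      have "\<rho> k l = (1/2) * (\<bar>(real m + 1) * h\<bar> powr (2*H) + \<bar>(real m - 1) * h\<bar> powr (2*H) - \<bar>real m * h\<bar> powr (2*H) - \<bar>real m * h\<bar> powr (2*H))"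
        unfolding \<rho>_def d_def using covariance_increments[of \<gamma>, OF \<gamma>_V \<gamma>_cov nn nn nn nn, of k "Suc k" l "Suc l"]
        by (simp add: m(1) algebra_simps)
      also have "\<dots> = (1/2) * (h powr (2*H) * ((real m + 1) powr (2*H) + (real m - 1) powr (2*H) - 2 * real m powr (2*H)))"
      proof -
        have p: "\<bar>c * h\<bar> powr (2*H) = h powr (2*H) * c powr (2*H)" if "0 \<le> c" for c
          using that h by (simp add: abs_mult powr_mult)
        have "\<bar>(real m - 1) * h\<bar> powr (2*H) = h powr (2*H) * (real m - 1) powr (2*H)"
          using m(2) by (intro p) simp
        moreover have "\<bar>(real m + 1) * h\<bar> powr (2*H) = h powr (2*H) * (real m + 1) powr (2*H)" by (rule p) simp
        moreover have "\<bar>real m * h\<bar> powr (2*H) = h powr (2*H) * real m powr (2*H)" by (rule p) simp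
        ultimately show ?thesis by (simp only: right_diff_distrib distrib_left)
      qed
      finally have e: "\<rho> k l = (1/2) * (h powr (2*H) * ((real m + 1) powr (2*H) + (real m - 1) powr (2*H) - 2 * real m powr (2*H)))" .
      have "\<bar>\<rho> k l\<bar> = (1/2) * (h powr (2*H) * \<bar>(real m + 1) powr (2*H) + (real m - 1) powr (2*H) - 2 * real m powr (2*H)\<bar>)"
        unfolding e abs_mult by simp
      also have "\<dots> \<le> (1/2) * (h powr (2*H) * real m powr (2*H - 2))"
        using H m(2) by (intro mult_left_mono powr_second_difference) auto
      also have "\<dots> \<le> h powr (2*H) * real m powr (2*H - 2)" by simp
      finally show ?thesis using m by simp
    qed
    show ?thesis using *[of k l] *[of l k] that rsym[of k l] by (cases "l < k") (auto simp: abs_minus_commute)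
  qed
  \<comment> \<open>A row sum is the covariance of one increment with the increment over the whole
    range, hence explicit and nonnegative even where single covariances are negative. Nonnegative
    rows allow \<open>r k k\<close> to be replaced by its bound \<open>K\<close>.\<close>
  have row: "0 \<le> (\<Sum>l<N. \<rho> k l)" if "k < N" for k
  proof -
    have sumd: "(\<Sum>l<N. d l w) = \<gamma> (a + real N * h) w - \<gamma> (a + real 0 * h) w" for w
      unfolding d_def by (rule sum_lessThan_telescope)
    have "(\<Sum>l<N. \<rho> k l) = expectation (\<lambda>w. d k w * (\<gamma> (a + real N * h) w - \<gamma> (a + real 0 * h) w))"
      unfolding sumd[symmetric] \<rho>_def sum_distrib_left
      by (rule Bochner_Integration.integral_sum[symmetric]) (intro integrable_V_mult d)
    also have "\<dots> = (1/2) * (\<bar>real (Suc k) * h\<bar> powr (2*H) + \<bar>real k * h - real N * h\<bar> powr (2*H)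
        - \<bar>real (Suc k) * h - real N * h\<bar> powr (2*H) - \<bar>real k * h\<bar> powr (2*H))"
      unfolding d_def using covariance_increments[of \<gamma>, OF \<gamma>_V \<gamma>_cov nn nn nn nn, of "Suc k" k N 0] by simp
    also have "\<dots> \<ge> 0"
    proof -
      have "\<bar>real k * h\<bar> powr (2*H) \<le> \<bar>real (Suc k) * h\<bar> powr (2*H)"
        using h H by (intro powr_mono2) (auto simp: abs_mult intro!: mult_right_mono)
      moreover have "\<bar>real (Suc k) * h - real N * h\<bar> powr (2*H) \<le> \<bar>real k * h - real N * h\<bar> powr (2*H)"
      proof (intro powr_mono2)
        show "\<bar>real (Suc k) * h - real N * h\<bar> \<le> \<bar>real k * h - real N * h\<bar>"
          unfolding left_diff_distrib[symmetric] abs_mult using that h by (intro mult_right_mono) auto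
      qed (use H in auto)
      ultimately show ?thesis by simp
    qed
    finally show ?thesis .
  qed
  have total: "(\<Sum>k<N. \<Sum>l<N. \<rho> k l) = (real N * h) powr (2*H)"
  proof -
    have sumd: "(\<Sum>l<N. d l w) = \<gamma> (a + real N * h) w - \<gamma> (a + real 0 * h) w" for w
      unfolding d_def by (rule sum_lessThan_telescope)
    have "(\<Sum>k<N. \<Sum>l<N. \<rho> k l) = expectation (\<lambda>w. (\<gamma> (a + real N * h) w - \<gamma> (a + real 0 * h) w)\<^sup>2)"
      unfolding sumd[symmetric] \<rho>_def power2_eq_square sum_product
      using integrable_V_mult[OF d d] by (simp add: Bochner_Integration.integral_sum)
    also have "\<dots> = (real N * h) powr (2*H)"
      using increment_moment2[of \<gamma>, OF \<gamma>_V \<gamma>_cov nn nn, of N 0] h by simp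
    finally show ?thesis .
  qed
  have K0: "r k k \<le> K" if "k < N" for k using K[OF that] by (simp add: r_def power2_eq_square)
  \<comment> \<open>The diagonal is absent because \<open>D k k = 0\<close>. Off it the exponents
    combine to \<open>\<theta> + (2*H - 2) = -2/3\<close> for the distance and
    \<open>\<theta> + 2*H = 4/3\<close> for the step.\<close>
  have offdiag: "(\<Sum>k<N. \<Sum>l<N. \<bar>D k l * \<rho> k l\<bar>) \<le> 8 * C * (real N * h) powr (4/3)"
  proof -
    have "(\<Sum>l<N. \<bar>D k l * \<rho> k l\<bar>) \<le> C * h powr (4/3) * (6 * real N powr (1/3))" if k: "k < N" for k
    proof -
      have "D k k = 0" by (simp add: D_def)
      then have "(\<Sum>l<N. \<bar>D k l * \<rho> k l\<bar>) = (\<Sum>l\<in>{..<N} - {k}. \<bar>D k l * \<rho> k l\<bar>)"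
        using k by (simp add: sum.remove[of "{..<N}" k])
      also have "\<dots> \<le> (\<Sum>l\<in>{..<N} - {k}. C * h powr (4/3) * \<bar>real k - real l\<bar> powr (-2/3))"
      proof (rule sum_mono)
        fix l assume l: "l \<in> {..<N} - {k}"
        define m where "m = \<bar>real k - real l\<bar>"
        have m: "m > 0" using l by (auto simp: m_def)
        have D0: "0 \<le> D k l" by (simp add: D_def)
        have "\<bar>D k l * \<rho> k l\<bar> \<le> (C * (m * h) powr \<theta>) * (h powr (2*H) * m powr (2*H - 2))"
          unfolding abs_mult using hoelder[OF k, of l] \<rho>[of k l] l D0 C
          by (intro mult_mono) (auto simp: D_def m_def)
        also have "\<dots> = C * (h powr \<theta> * h powr (2*H)) * (m powr \<theta> * m powr (2*H - 2))"
          using m h by (simp add: powr_mult)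
        also have "h powr \<theta> * h powr (2*H) = h powr (4/3)" by (simp add: powr_add[symmetric])
        also have "m powr \<theta> * m powr (2*H - 2) = m powr (-2/3)" by (simp add: powr_add[symmetric])
        finally show "\<bar>D k l * \<rho> k l\<bar> \<le> C * h powr (4/3) * \<bar>real k - real l\<bar> powr (-2/3)" by (simp add: m_def)
      qed
      also have "\<dots> \<le> C * h powr (4/3) * (6 * real N powr (1/3))"
        unfolding sum_distrib_left[symmetric] using C by (intro mult_left_mono sum_off_diagonal_le k) auto
      finally show ?thesis .
    qed
    then have "(\<Sum>k<N. \<Sum>l<N. \<bar>D k l * \<rho> k l\<bar>) \<le> (\<Sum>k<N. C * h powr (4/3) * (6 * real N powr (1/3)))"
      by (intro sum_mono) auto
    also have "\<dots> = 6 * C * (h powr (4/3) * (real N * real N powr (1/3)))" by simp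
    also have "real N * real N powr (1/3) = real N powr (4/3)"
      by (cases "N = 0") (auto simp: powr_mult_base)
    also have "6 * C * (h powr (4/3) * real N powr (4/3)) = 6 * C * (real N * h) powr (4/3)"
      using h by (simp add: powr_mult)
    also have "\<dots> \<le> 8 * C * (real N * h) powr (4/3)"
    proof -
      have "0 \<le> C * (real N * h) powr (4/3)" using C by simp
      then show ?thesis by linarith
    qed
    finally show ?thesis .
  qed
  have E: "expectation (\<lambda>w. (\<Sum>k<N. g k w * d k w)\<^sup>2) = (\<Sum>k<N. \<Sum>l<N. r k l * \<rho> k l)"
    unfolding r_def \<rho>_def by (rule second_moment_bilinear(2)) (use g d od in auto)
  have "r k l * \<rho> k l = (1/2) * (r k k * \<rho> k l) + (1/2) * (r l l * \<rho> k l) - (1/2) * (D k l * \<rho> k l)"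
    if "k < N" "l < N" for k l
    unfolding rD[OF that] by (simp add: algebra_simps)
  then have "(\<Sum>k<N. \<Sum>l<N. r k l * \<rho> k l) =
      (\<Sum>k<N. \<Sum>l<N. (1/2) * (r k k * \<rho> k l) + (1/2) * (r l l * \<rho> k l) - (1/2) * (D k l * \<rho> k l))"
    by (intro sum.cong refl) simp
  then have "expectation (\<lambda>w. (\<Sum>k<N. g k w * d k w)\<^sup>2) =
      (1/2) * (\<Sum>k<N. \<Sum>l<N. r k k * \<rho> k l) + (1/2) * (\<Sum>k<N. \<Sum>l<N. r l l * \<rho> k l)
      - (1/2) * (\<Sum>k<N. \<Sum>l<N. D k l * \<rho> k l)"
    unfolding E by (simp only: sum.distrib sum_subtractf sum_distrib_left)
  moreover have "(\<Sum>k<N. \<Sum>l<N. r l l * \<rho> k l) = (\<Sum>k<N. \<Sum>l<N. r k k * \<rho> k l)"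
    by (subst sum.swap) (simp only: rsym)
  moreover have "(\<Sum>k<N. \<Sum>l<N. r k k * \<rho> k l) \<le> K * (real N * h) powr (2*H)"
  proof -
    have "(\<Sum>k<N. \<Sum>l<N. r k k * \<rho> k l) \<le> (\<Sum>k<N. K * (\<Sum>l<N. \<rho> k l))"
      using K0 row by (intro sum_mono) (simp add: sum_distrib_left[symmetric] mult_right_mono)
    also have "\<dots> = K * (\<Sum>k<N. \<Sum>l<N. \<rho> k l)" by (rule sum_distrib_left[symmetric])
    finally show ?thesis unfolding total .
  qed
  moreover have "\<bar>\<Sum>k<N. \<Sum>l<N. D k l * \<rho> k l\<bar> \<le> (\<Sum>k<N. \<Sum>l<N. \<bar>D k l * \<rho> k l\<bar>)"
    by (intro order_trans[OF sum_abs] sum_mono) simp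
  moreover have "0 \<le> C * (real N * h) powr (4/3)" using C by simp
  ultimately have "expectation (\<lambda>w. (\<Sum>k<N. g k w * d k w)\<^sup>2) \<le> K * (real N * h) powr (2*H) + 4 * C * (real N * h) powr (4/3)"
    using offdiag by linarith
  then show ?thesis unfolding d_def .
qed

end

subsection \<open>Moments of the Euler scheme\<close>

text \<open>Discrete form of the moving average of \<open>\<beta> t - \<beta> (t - s)\<close> with
  exponentially decaying weights. The weights \<open>(1 - q) * q ^ k\<close> and
  \<open>q ^ l\<close> sum to 1, which opens the way to moment bounds uniform in time.\<close>

lemma ou_euler_eq_average:
  fixes \<beta> :: "real \<Rightarrow> real"
  defines "b \<equiv> \<lambda>m k. \<beta> (real k / 2 ^ m)"
  shows "ou_euler \<mu> \<sigma> m \<beta> l = \<sigma> * ((1 - \<mu> / 2 ^ m) ^ l * (b m l - b m 0)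
     + (\<Sum>k<l. (\<mu> / 2 ^ m) * (1 - \<mu> / 2 ^ m) ^ k * (b m l - b m (l - Suc k))))"
proof -
  define q where "q = 1 - \<mu> / 2 ^ m"
  have q: "\<mu> / 2 ^ m = 1 - q" by (simp add: q_def)
  have gp: "(1 - q) * (\<Sum>i<l. q ^ i) = 1 - q ^ l" for l
    by (rule one_diff_power_eq[symmetric])
  have 1: "ou_euler \<mu> \<sigma> m \<beta> l = \<sigma> * (b m l - b m 0) - \<sigma> * (1 - q) * (\<Sum>i<l. q ^ (l - Suc i) * (b m i - b m 0))" for l
  proof (induction l)
    case (Suc l)
    have "(\<Sum>i<l. q ^ (Suc l - Suc i) * (b m i - b m 0)) = q * (\<Sum>i<l. q ^ (l - Suc i) * (b m i - b m 0))"
      unfolding sum_distrib_left by (intro sum.cong refl) (simp add: Suc_diff_Suc[symmetric])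
    then have S: "(\<Sum>i<Suc l. q ^ (Suc l - Suc i) * (b m i - b m 0)) =
        q * (\<Sum>i<l. q ^ (l - Suc i) * (b m i - b m 0)) + (b m l - b m 0)" by simp
    have "ou_euler \<mu> \<sigma> m \<beta> (Suc l) = q * ou_euler \<mu> \<sigma> m \<beta> l + \<sigma> * (b m (Suc l) - b m l)"
      by (simp add: q_def b_def)
    then show ?case unfolding Suc S by (simp add: algebra_simps)
  qed (simp add: b_def)
  have "(\<Sum>i<l. q ^ (l - Suc i) * (b m i - b m 0)) = (\<Sum>k<l. q ^ k * (b m (l - Suc k) - b m 0))"
    by (subst sum.nat_diff_reindex[symmetric]) (intro sum.cong refl, simp add: Suc_diff_Suc)
  then have "ou_euler \<mu> \<sigma> m \<beta> l = \<sigma> * ((b m l - b m 0) - (1 - q) * (\<Sum>k<l. q ^ k * (b m (l - Suc k) - b m 0)))"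
    unfolding 1 by (simp add: algebra_simps)
  also have "(1 - q) * (\<Sum>k<l. q ^ k * (b m (l - Suc k) - b m 0)) =
      (1 - q ^ l) * (b m l - b m 0) - (\<Sum>k<l. (1 - q) * q ^ k * (b m l - b m (l - Suc k)))"
    unfolding gp[symmetric] sum_distrib_left sum_distrib_right sum_subtractf[symmetric]
    by (intro sum.cong refl) (simp add: algebra_simps)
  finally show ?thesis unfolding q q_def[symmetric] by (simp add: algebra_simps)
qed

text \<open>Jensen's inequality for the square, by Cauchy--Schwarz with each weight split into two
  square roots.\<close>

lemma convex_combination_square_le:
  fixes w a :: "nat \<Rightarrow> real"
  assumes w: "\<And>k. k \<in> I \<Longrightarrow> 0 \<le> w k" "(\<Sum>k\<in>I. w k) = 1"
  shows "(\<Sum>k\<in>I. w k * a k)\<^sup>2 \<le> (\<Sum>k\<in>I. w k * (a k)\<^sup>2)"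
proof -
  have "(\<Sum>k\<in>I. w k * a k) = (\<Sum>k\<in>I. sqrt (w k) * (sqrt (w k) * a k))"
    using w(1) by (intro sum.cong refl) (simp add: mult.assoc[symmetric])
  also have "\<dots>\<^sup>2 \<le> (\<Sum>k\<in>I. (sqrt (w k))\<^sup>2) * (\<Sum>k\<in>I. (sqrt (w k) * a k)\<^sup>2)"
    by (rule Cauchy_Schwarz_ineq_sum)
  also have "(\<Sum>k\<in>I. (sqrt (w k))\<^sup>2) = 1" using w by (simp cong: sum.cong)
  also have "(\<Sum>k\<in>I. (sqrt (w k) * a k)\<^sup>2) = (\<Sum>k\<in>I. w k * (a k)\<^sup>2)"
    using w(1) by (intro sum.cong refl) (simp add: power_mult_distrib)
  finally show ?thesis by simp
qed

context fbm_pair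
begin

abbreviation euler :: "real \<Rightarrow> real \<Rightarrow> nat \<Rightarrow> nat \<Rightarrow> 'w \<Rightarrow> real" where
  "euler \<mu> \<sigma> m k w \<equiv> ou_euler \<mu> \<sigma> m (\<lambda>t. \<beta> t w) k"

lemma euler_V: "euler \<mu> \<sigma> m k \<in> V"
proof (induction k)
  case 0
  then show ?case using V_zero by simp
next
  case (Suc k)
  show ?case
    unfolding ou_euler.simps by (intro V_add V_scale Suc V_diff \<beta>_V) auto
qed

lemma euler_\<gamma>_orth:
  assumes "0 \<le> t" shows "expectation (\<lambda>w. euler \<mu> \<sigma> m k w * \<gamma> t w) = 0"
proof (induction k)
  case (Suc k)
  let ?d = "\<lambda>w. \<beta> (real (Suc k) / 2 ^ m) w - \<beta> (real k / 2 ^ m) w"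
  have eq: "euler \<mu> \<sigma> m (Suc k) w * \<gamma> t w = (1 - \<mu> / 2 ^ m) * (euler \<mu> \<sigma> m k w * \<gamma> t w)
      + \<sigma> * (\<beta> (real (Suc k) / 2 ^ m) w * \<gamma> t w - \<beta> (real k / 2 ^ m) w * \<gamma> t w)" for w
    by (simp add: algebra_simps)
  have i: "integrable M (\<lambda>w. \<beta> s w * \<gamma> t w)" if "0 \<le> s" for s
    by (intro integrable_V_mult \<beta>_V \<gamma>_V that assms)
  show ?case
    unfolding eq using integrable_V_mult[OF euler_V \<gamma>_V[OF assms]] i \<beta>\<gamma>_cov[OF _ assms] Suc
    by (simp del: of_nat_Suc ou_euler.simps)
qed simp

text \<open>By Jensen the second moment is at most an average of lag times raised to
  \<open>2*H\<close>, each at most 1 plus the lag, and the mean lag time under geometric weights is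
  at most \<open>1 / \<mu>\<close>.\<close>

lemma euler_moment2:
  assumes \<mu>: "0 < \<mu>" "\<mu> / 2 ^ m < 1"
  shows "expectation (\<lambda>w. (euler \<mu> \<sigma> m l w)\<^sup>2) \<le> \<sigma>\<^sup>2 * (1 + 1 / \<mu>)"
proof -
  define q where "q = 1 - \<mu> / 2 ^ m"
  have q: "0 < q" "q < 1" "\<mu> / 2 ^ m = 1 - q" using \<mu> by (auto simp: q_def)
  \<comment> \<open>A geometric waiting time truncated at \<open>l\<close>: the last weight
    \<open>q ^ l\<close> carries the comparison with time 0.\<close>
  define wt where "wt k = (if k < l then (1 - q) * q ^ k else q ^ l)" for k
  define lag where "lag k = (if k < l then Suc k else l)" for k
  define a where "a k w = \<beta> (real l / 2 ^ m) w - \<beta> (real (l - lag k) / 2 ^ m) w" for k w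
  have lag: "lag k \<le> l" for k by (auto simp: lag_def)
  have wt: "0 \<le> wt k" for k using q by (simp add: wt_def)
  have wt1: "(\<Sum>k\<le>l. wt k) = 1"
  proof -
    have "(\<Sum>k\<le>l. wt k) = (\<Sum>k<l. (1 - q) * q ^ k) + q ^ l"
      by (simp add: lessThan_Suc_atMost[symmetric] wt_def)
    then show ?thesis using one_diff_power_eq[of q l] by (simp add: sum_distrib_left[symmetric])
  qed
  \<comment> \<open>The mean of the truncated geometric variable is the sum of its tails
    \<open>q ^ k\<close>.\<close>
  have wlag: "(\<Sum>k\<le>l. wt k * real (lag k)) = (\<Sum>k<l. q ^ k)"
  proof -
    have "(\<Sum>k\<le>l. wt k * real (lag k)) = (\<Sum>k<l. (1 - q) * q ^ k * real (Suc k)) + q ^ l * real l"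
      by (simp add: lessThan_Suc_atMost[symmetric] wt_def lag_def)
    also have "\<dots> = (\<Sum>k<l. q ^ k)"
      by (induction l) (simp_all add: algebra_simps)
    finally show ?thesis .
  qed
  have eu: "euler \<mu> \<sigma> m l w = \<sigma> * (\<Sum>k\<le>l. wt k * a k w)" for w
  proof -
    have "(\<Sum>k\<le>l. wt k * a k w) = (\<Sum>k<l. (1 - q) * q ^ k * (\<beta> (real l / 2 ^ m) w - \<beta> (real (l - Suc k) / 2 ^ m) w))
        + q ^ l * (\<beta> (real l / 2 ^ m) w - \<beta> (real 0 / 2 ^ m) w)"
      by (simp add: lessThan_Suc_atMost[symmetric] wt_def a_def lag_def)
    then show ?thesis unfolding ou_euler_eq_average q(3) by simp
  qed
  have aV: "a k \<in> V" for k unfolding a_def by (intro V_diff \<beta>_V) auto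
  have a2: "expectation (\<lambda>w. (a k w)\<^sup>2) \<le> 1 + real (lag k) / 2 ^ m" for k
  proof -
    have "expectation (\<lambda>w. (a k w)\<^sup>2) = \<bar>real l / 2 ^ m - real (l - lag k) / 2 ^ m\<bar> powr (2*H)"
      unfolding a_def by (rule increment_moment2[OF \<beta>_V \<beta>_cov]) auto
    also have "real l / 2 ^ m - real (l - lag k) / 2 ^ m = real (lag k) / 2 ^ m"
      using lag[of k] by (simp add: of_nat_diff diff_divide_distrib[symmetric])
    also have "\<bar>real (lag k) / 2 ^ m\<bar> powr (2*H) \<le> 1 + real (lag k) / 2 ^ m"
    proof (cases "real (lag k) / 2 ^ m \<le> 1")
      case True
      then have "\<bar>real (lag k) / 2 ^ m\<bar> powr (2*H) \<le> 1 powr (2*H)" using H by (intro powr_mono2) auto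
      then show ?thesis by (simp add: add_increasing2)
    next
      case False
      then have "\<bar>real (lag k) / 2 ^ m\<bar> powr (2*H) \<le> (real (lag k) / 2 ^ m) powr 1"
        using H powr_mono[of "2*H" 1 "real (lag k) / 2 ^ m"] by simp
      then show ?thesis by simp
    qed
    finally show ?thesis .
  qed
  have "expectation (\<lambda>w. (euler \<mu> \<sigma> m l w)\<^sup>2) \<le> expectation (\<lambda>w. \<sigma>\<^sup>2 * (\<Sum>k\<le>l. wt k * (a k w)\<^sup>2))"
  proof (rule integral_mono)
    show "integrable M (\<lambda>w. (euler \<mu> \<sigma> m l w)\<^sup>2)" by (rule integrable_V2[OF euler_V])
    show "integrable M (\<lambda>w. \<sigma>\<^sup>2 * (\<Sum>k\<le>l. wt k * (a k w)\<^sup>2))"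
      using integrable_V2[OF aV] by (intro Bochner_Integration.integrable_mult_right Bochner_Integration.integrable_sum) auto
    show "(euler \<mu> \<sigma> m l w)\<^sup>2 \<le> \<sigma>\<^sup>2 * (\<Sum>k\<le>l. wt k * (a k w)\<^sup>2)" for w
      unfolding eu power_mult_distrib using wt wt1 by (intro mult_left_mono convex_combination_square_le) auto
  qed
  also have "\<dots> = \<sigma>\<^sup>2 * (\<Sum>k\<le>l. wt k * expectation (\<lambda>w. (a k w)\<^sup>2))"
    using integrable_V2[OF aV] by (simp add: Bochner_Integration.integral_sum)
  also have "\<dots> \<le> \<sigma>\<^sup>2 * (\<Sum>k\<le>l. wt k * (1 + real (lag k) / 2 ^ m))"
    using wt a2 by (intro mult_left_mono sum_mono) auto
  also have "(\<Sum>k\<le>l. wt k * (1 + real (lag k) / 2 ^ m)) = 1 + (\<Sum>k<l. q ^ k) / 2 ^ m"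
    by (simp add: distrib_left sum.distrib wt1 wlag[symmetric] sum_divide_distrib)
  also have "(\<Sum>k<l. q ^ k) / 2 ^ m \<le> 1 / \<mu>"
  proof -
    have "(\<Sum>k<l. q ^ k) * (1 - q) \<le> 1"
      using one_diff_power_eq[of q l] zero_le_power[of q l] q(1) by (simp only: mult.commute) linarith
    then have "(\<Sum>k<l. q ^ k) * \<mu> / 2 ^ m \<le> 1" using q(3)[symmetric] by simp
    then show ?thesis using \<mu>(1) by (simp add: field_simps)
  qed
  finally show ?thesis by (simp add: mult_left_mono)
qed

lemma euler_telescope:
  "euler \<mu> \<sigma> m (l + n) w - euler \<mu> \<sigma> m l w =
    - (\<mu> / 2 ^ m) * (\<Sum>i<n. euler \<mu> \<sigma> m (l + i) w) + \<sigma> * (\<beta> (real (l + n) / 2 ^ m) w - \<beta> (real l / 2 ^ m) w)"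
  by (induction n) (simp_all add: algebra_simps)

text \<open>Up to unit time the drift contributes the square of the elapsed time, by
  Cauchy--Schwarz, and the noise its power \<open>2*H\<close>; both are dominated by the power
  \<theta>. Beyond unit time the uniform second moment bound suffices.\<close>

lemma euler_increment:
  fixes \<mu> \<sigma> :: real
  assumes \<mu>: "0 < \<mu>" "\<mu> / 2 ^ m < 1"
  defines "C \<equiv> \<sigma>\<^sup>2 * (1 + 1 / \<mu>)"
  shows "expectation (\<lambda>w. (euler \<mu> \<sigma> m k w - euler \<mu> \<sigma> m l w)\<^sup>2)
    \<le> (2 * \<mu>\<^sup>2 * C + 2 * \<sigma>\<^sup>2 + 4 * C) * (\<bar>real k - real l\<bar> / 2 ^ m) powr \<theta>"
proof -
  have C0: "0 \<le> C" using \<mu> by (simp add: C_def)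
  define C1 where "C1 = 2 * \<mu>\<^sup>2 * C + 2 * \<sigma>\<^sup>2 + 4 * C"
  have C1: "2 * \<mu>\<^sup>2 * C + 2 * \<sigma>\<^sup>2 \<le> C1" "4 * C \<le> C1" using C0 by (auto simp: C1_def)
  have m2: "expectation (\<lambda>w. (euler \<mu> \<sigma> m l w)\<^sup>2) \<le> C" for l
    unfolding C_def by (rule euler_moment2[OF \<mu>])
  have main: "expectation (\<lambda>w. (euler \<mu> \<sigma> m (l + n) w - euler \<mu> \<sigma> m l w)\<^sup>2) \<le> C1 * (real n / 2 ^ m) powr \<theta>" for l n
  proof (cases "real n / 2 ^ m \<le> 1")
    case False
    have "expectation (\<lambda>w. (euler \<mu> \<sigma> m (l + n) w - euler \<mu> \<sigma> m l w)\<^sup>2) =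
        expectation (\<lambda>w. (euler \<mu> \<sigma> m (l + n) w + -1 * euler \<mu> \<sigma> m l w)\<^sup>2)" by simp
    also have "\<dots> \<le> 2 * expectation (\<lambda>w. (euler \<mu> \<sigma> m (l + n) w)\<^sup>2) + 2 * expectation (\<lambda>w. (-1 * euler \<mu> \<sigma> m l w)\<^sup>2)"
      by (intro V_square_sum_le V_scale euler_V)
    also have "\<dots> \<le> 4 * C" using m2[of "l + n"] m2[of l] by simp
    also have "\<dots> \<le> C1 * 1 powr \<theta>" using C1(2) by simp
    also have "\<dots> \<le> C1 * (real n / 2 ^ m) powr \<theta>"
      using False \<theta> C1 C0 by (intro mult_left_mono powr_mono2) auto
    finally show ?thesis .
  next
    case True
    define h where "h = real n / 2 ^ m"
    have h: "0 \<le> h" "h \<le> 1" using True by (auto simp: h_def)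
    define Y where "Y w = - (\<mu> / 2 ^ m) * (\<Sum>i<n. euler \<mu> \<sigma> m (l + i) w)" for w
    define Z where "Z w = \<sigma> * (\<beta> (real (l + n) / 2 ^ m) w - \<beta> (real l / 2 ^ m) w)" for w
    have V: "Y \<in> V" "Z \<in> V"
      unfolding Y_def Z_def by (intro V_scale V_sum euler_V V_diff \<beta>_V; simp)+
    have "expectation (\<lambda>w. (Z w)\<^sup>2) = \<sigma>\<^sup>2 * expectation (\<lambda>w. (\<beta> (real (l + n) / 2 ^ m) w - \<beta> (real l / 2 ^ m) w)\<^sup>2)"
      by (simp add: Z_def power_mult_distrib)
    also have "expectation (\<lambda>w. (\<beta> (real (l + n) / 2 ^ m) w - \<beta> (real l / 2 ^ m) w)\<^sup>2) = \<bar>real (l + n) / 2 ^ m - real l / 2 ^ m\<bar> powr (2*H)"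
      by (rule increment_moment2[OF \<beta>_V \<beta>_cov]) auto
    also have "\<bar>real (l + n) / 2 ^ m - real l / 2 ^ m\<bar> = h" by (simp add: h_def add_divide_distrib)
    finally have Z2: "expectation (\<lambda>w. (Z w)\<^sup>2) = \<sigma>\<^sup>2 * h powr (2*H)" .
    have "expectation (\<lambda>w. (Y w)\<^sup>2) \<le> expectation (\<lambda>w. (\<mu> / 2 ^ m)\<^sup>2 * (real n * (\<Sum>i<n. (euler \<mu> \<sigma> m (l + i) w)\<^sup>2)))"
    proof (rule integral_mono)
      show "integrable M (\<lambda>w. (\<mu> / 2 ^ m)\<^sup>2 * (real n * (\<Sum>i<n. (euler \<mu> \<sigma> m (l + i) w)\<^sup>2)))"
        using integrable_V2[OF euler_V] by (intro Bochner_Integration.integrable_mult_right Bochner_Integration.integrable_sum) auto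
      show "(Y w)\<^sup>2 \<le> (\<mu> / 2 ^ m)\<^sup>2 * (real n * (\<Sum>i<n. (euler \<mu> \<sigma> m (l + i) w)\<^sup>2))" for w
        unfolding Y_def power_mult_distrib power2_minus
        using Cauchy_Schwarz_ineq_sum[of "\<lambda>_. 1" "\<lambda>i. euler \<mu> \<sigma> m (l + i) w" "{..<n}"]
        by (intro mult_left_mono) auto
    qed (rule integrable_V2[OF V(1)])
    also have "\<dots> = (\<mu> / 2 ^ m)\<^sup>2 * (real n * (\<Sum>i<n. expectation (\<lambda>w. (euler \<mu> \<sigma> m (l + i) w)\<^sup>2)))"
      using integrable_V2[OF euler_V] by (simp add: Bochner_Integration.integral_sum)
    also have "\<dots> \<le> (\<mu> / 2 ^ m)\<^sup>2 * (real n * (\<Sum>i<n. C))"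
      using m2 by (intro mult_left_mono sum_mono) auto
    also have "\<dots> = \<mu>\<^sup>2 * C * h\<^sup>2" by (simp add: h_def power2_eq_square)
    finally have Y2: "expectation (\<lambda>w. (Y w)\<^sup>2) \<le> \<mu>\<^sup>2 * C * h\<^sup>2" .
    have "expectation (\<lambda>w. (euler \<mu> \<sigma> m (l + n) w - euler \<mu> \<sigma> m l w)\<^sup>2) = expectation (\<lambda>w. (Y w + Z w)\<^sup>2)"
      unfolding euler_telescope Y_def Z_def by simp
    also have "\<dots> \<le> 2 * (\<mu>\<^sup>2 * C * h\<^sup>2) + 2 * (\<sigma>\<^sup>2 * h powr (2*H))"
      using V_square_sum_le[OF V] Y2 Z2 by simp
    also have "\<dots> \<le> 2 * (\<mu>\<^sup>2 * C * h powr \<theta>) + 2 * (\<sigma>\<^sup>2 * h powr \<theta>)"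
    proof (intro add_mono mult_left_mono)
      show "h powr (2*H) \<le> h powr \<theta>" using h \<theta> by (intro powr_mono') auto
      have "h\<^sup>2 = h powr 2" using h by simp
      also have "\<dots> \<le> h powr \<theta>" using h \<theta> by (intro powr_mono') auto
      finally show "h\<^sup>2 \<le> h powr \<theta>" .
    qed (use C0 in auto)
    also have "\<dots> = (2 * \<mu>\<^sup>2 * C + 2 * \<sigma>\<^sup>2) * h powr \<theta>" by (simp add: algebra_simps)
    also have "\<dots> \<le> C1 * h powr \<theta>" using C1 by (intro mult_right_mono) auto
    finally show ?thesis unfolding h_def .
  qed
  show ?thesis
  proof (cases "l \<le> k")
    case True
    then show ?thesis using main[of l "k - l"] by (simp add: C1_def of_nat_diff)
  next
    case False
    then show ?thesis using main[of k "l - k"] by (simp add: C1_def of_nat_diff power2_commute)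
  qed
qed

text \<open>Two instances of \<open>second_moment_riemann_sum\<close>. Centring the integrand at the
  left end lowers its second moment to order \<theta>, so the term of order \<open>2*H\<close> in
  the general bound improves to \<open>4/3\<close>; on short intervals this gain is
  decisive.\<close>

lemma euler_sum_moment:
  fixes \<mu> \<sigma> :: real
  assumes \<mu>: "0 < \<mu>" "\<mu> / 2 ^ m < 1"
  defines "C \<equiv> \<sigma>\<^sup>2 * (1 + 1 / \<mu>)"
  defines "C1 \<equiv> 2 * \<mu>\<^sup>2 * C + 2 * \<sigma>\<^sup>2 + 4 * C"
  shows "expectation (\<lambda>w. (\<Sum>k<N. ((1/2) * (euler \<mu> \<sigma> m (l + k) w + euler \<mu> \<sigma> m (l + Suc k) w)) *
      (\<gamma> (real (l + Suc k) / 2 ^ m) w - \<gamma> (real (l + k) / 2 ^ m) w))\<^sup>2)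
    \<le> C * (real N / 2 ^ m) powr (2*H) + 4 * C1 * (real N / 2 ^ m) powr (4/3)"
    and "expectation (\<lambda>w. (\<Sum>k<N. ((1/2) * (euler \<mu> \<sigma> m (l + k) w + euler \<mu> \<sigma> m (l + Suc k) w) - euler \<mu> \<sigma> m l w) *
      (\<gamma> (real (l + Suc k) / 2 ^ m) w - \<gamma> (real (l + k) / 2 ^ m) w))\<^sup>2)
    \<le> 5 * C1 * (real N / 2 ^ m) powr (4/3)"
proof -
  let ?x = "euler \<mu> \<sigma> m"
  have C0: "0 \<le> C" using \<mu> by (simp add: C_def)
  have C1: "0 \<le> C1" using C0 by (simp add: C1_def)
  have inc: "expectation (\<lambda>w. (?x k w - ?x l w)\<^sup>2) \<le> C1 * (\<bar>real k - real l\<bar> / 2 ^ m) powr \<theta>" for k l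
    unfolding C1_def C_def by (rule euler_increment[OF \<mu>])
  have m2: "expectation (\<lambda>w. (?x k w)\<^sup>2) \<le> C" for k unfolding C_def by (rule euler_moment2[OF \<mu>])
  define g where "g k w = (1/2) * (?x (l + k) w + ?x (l + Suc k) w)" for k w
  have gV: "g k \<in> V" for k unfolding g_def by (intro V_scale V_add euler_V)
  have g2: "expectation (\<lambda>w. (g k w)\<^sup>2) \<le> C" for k
    unfolding g_def by (intro V_average_square_le euler_V m2)
  have gh: "expectation (\<lambda>w. (g k w - g k' w)\<^sup>2) \<le> C1 * (\<bar>real k - real k'\<bar> * (1 / 2 ^ m)) powr \<theta>" for k k'
  proof -
    have "g k w - g k' w = (1/2) * ((?x (l + k) w - ?x (l + k') w) + (?x (l + Suc k) w - ?x (l + Suc k') w))" for w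
      unfolding g_def by (simp add: algebra_simps del: ou_euler.simps add_Suc_right)
    then show ?thesis
      using inc[of "l + k" "l + k'"] inc[of "l + Suc k" "l + Suc k'"]
      by (simp only:) (intro V_average_square_le V_diff euler_V, auto)
  qed
  have x\<gamma>: "expectation (\<lambda>w. ?x k w * \<gamma> t w) = 0" "integrable M (\<lambda>w. ?x k w * \<gamma> t w)" if "0 \<le> t" for k t
    using euler_\<gamma>_orth[OF that] integrable_V_mult[OF euler_V \<gamma>_V[OF that]] by auto
  have g\<gamma>: "expectation (\<lambda>w. g k w * \<gamma> t w) = 0" "integrable M (\<lambda>w. g k w * \<gamma> t w)" if "0 \<le> t" for k t
  proof -
    have "(\<lambda>w. g k w * \<gamma> t w) = (\<lambda>w. (1/2) * (?x (l + k) w * \<gamma> t w + ?x (l + Suc k) w * \<gamma> t w))"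
      by (simp add: g_def algebra_simps del: ou_euler.simps add_Suc_right)
    then show "expectation (\<lambda>w. g k w * \<gamma> t w) = 0" using x\<gamma>[OF that] by (simp del: ou_euler.simps add_Suc_right)
    show "integrable M (\<lambda>w. g k w * \<gamma> t w)" by (intro integrable_V_mult gV \<gamma>_V that)
  qed
  have grid: "real l / 2 ^ m + real k * (1 / 2 ^ m) = real (l + k) / 2 ^ m" for k
    by (simp add: add_divide_distrib)
  have "expectation (\<lambda>w. (\<Sum>k<N. g k w * (\<gamma> (real l / 2 ^ m + real (Suc k) * (1 / 2 ^ m)) w - \<gamma> (real l / 2 ^ m + real k * (1 / 2 ^ m)) w))\<^sup>2)
    \<le> C * (real N * (1 / 2 ^ m)) powr (2*H) + 4 * C1 * (real N * (1 / 2 ^ m)) powr (4/3)"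
    by (rule second_moment_riemann_sum) (use C1 gV g\<gamma> g2 gh in auto)
  then show "expectation (\<lambda>w. (\<Sum>k<N. ((1/2) * (?x (l + k) w + ?x (l + Suc k) w)) *
      (\<gamma> (real (l + Suc k) / 2 ^ m) w - \<gamma> (real (l + k) / 2 ^ m) w))\<^sup>2)
    \<le> C * (real N / 2 ^ m) powr (2*H) + 4 * C1 * (real N / 2 ^ m) powr (4/3)"
    unfolding grid g_def by simp
  let ?t = "real N / 2 ^ m"
  have "expectation (\<lambda>w. (\<Sum>k<N. (g k w - ?x l w) * (\<gamma> (real l / 2 ^ m + real (Suc k) * (1 / 2 ^ m)) w - \<gamma> (real l / 2 ^ m + real k * (1 / 2 ^ m)) w))\<^sup>2)
    \<le> (C1 * ?t powr \<theta>) * (real N * (1 / 2 ^ m)) powr (2*H) + 4 * C1 * (real N * (1 / 2 ^ m)) powr (4/3)"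
  proof (rule second_moment_riemann_sum)
    fix k assume k: "k < N"
    show "(\<lambda>w. g k w - ?x l w) \<in> V" by (intro V_diff gV euler_V)
    show "expectation (\<lambda>w. (g k w - ?x l w) * \<gamma> t w) = 0" if "0 \<le> t" for t
      unfolding left_diff_distrib using g\<gamma>[OF that] x\<gamma>[OF that] by simp
    have eq: "g k w - ?x l w = (1/2) * ((?x (l + k) w - ?x l w) + (?x (l + Suc k) w - ?x l w))" for w
      unfolding g_def by (simp add: algebra_simps del: ou_euler.simps add_Suc_right)
    have bound: "expectation (\<lambda>w. (?x (l + i) w - ?x l w)\<^sup>2) \<le> C1 * ?t powr \<theta>" if "i \<le> N" for i
    proof -
      have "expectation (\<lambda>w. (?x (l + i) w - ?x l w)\<^sup>2) \<le> C1 * (\<bar>real (l + i) - real l\<bar> / 2 ^ m) powr \<theta>" by (rule inc)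
      also have "\<dots> \<le> C1 * ?t powr \<theta>"
        using that C1 \<theta> by (intro mult_left_mono powr_mono2 divide_right_mono) auto
      finally show ?thesis .
    qed
    show "expectation (\<lambda>w. (g k w - ?x l w)\<^sup>2) \<le> C1 * ?t powr \<theta>"
      unfolding eq using k by (intro V_average_square_le V_diff euler_V bound) simp_all
  next
    fix k k'
    show "expectation (\<lambda>w. ((g k w - ?x l w) - (g k' w - ?x l w))\<^sup>2) \<le> C1 * (\<bar>real k - real k'\<bar> * (1 / 2 ^ m)) powr \<theta>"
      using gh[of k k'] by simp
  qed (use C1 in auto)
  also have "\<dots> = 5 * C1 * ?t powr (4/3)"
  proof -
    have "?t powr \<theta> * ?t powr (2*H) = ?t powr (4/3)" by (simp add: powr_add[symmetric])
    then show ?thesis by (simp add: mult.assoc)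
  qed
  finally show "expectation (\<lambda>w. (\<Sum>k<N. ((1/2) * (?x (l + k) w + ?x (l + Suc k) w) - ?x l w) *
      (\<gamma> (real (l + Suc k) / 2 ^ m) w - \<gamma> (real (l + k) / 2 ^ m) w))\<^sup>2)
    \<le> 5 * C1 * ?t powr (4/3)"
    unfolding grid g_def .
qed

end

subsection \<open>Almost sure bounds\<close>

text \<open>The whole double series has finite expectation, so it is almost surely finite, and its
  value bounds every term at once.\<close>

lemma AE_bounded_of_summable_moments:
  fixes F :: "nat \<Rightarrow> nat \<Rightarrow> 'w \<Rightarrow> ennreal" and a b :: "nat \<Rightarrow> real"
  assumes [measurable]: "\<And>k j. F k j \<in> borel_measurable M"
    and F: "\<And>k j. (\<integral>\<^sup>+w. F k j w \<partial>M) \<le> ennreal (a k * b j)"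
    and a: "summable a" "\<And>k. 0 \<le> a k" and b: "summable b" "\<And>j. 0 \<le> b j"
  shows "AE w in M. \<exists>C\<ge>0. \<forall>k j. F k j w \<le> ennreal C"
proof -
  let ?G = "\<lambda>w. \<Sum>k. \<Sum>j. F k j w"
  have "(\<integral>\<^sup>+w. ?G w \<partial>M) = (\<Sum>k. \<Sum>j. \<integral>\<^sup>+w. F k j w \<partial>M)"
    by (simp add: nn_integral_suminf)
  also have "\<dots> \<le> (\<Sum>k. \<Sum>j. ennreal (a k) * ennreal (b j))"
    using F a(2) b(2) by (intro suminf_le allI) (auto simp: ennreal_mult)
  also have "\<dots> = (\<Sum>k. ennreal (a k)) * (\<Sum>j. ennreal (b j))"
    by simp
  also have "\<dots> = ennreal (suminf a * suminf b)"
    using a b by (simp add: suminf_ennreal2 ennreal_mult suminf_nonneg)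
  finally have "(\<integral>\<^sup>+w. ?G w \<partial>M) < \<infinity>" by (rule le_less_trans) simp
  then have "AE w in M. ?G w \<noteq> \<infinity>" by (intro nn_integral_PInf_AE) auto
  then show ?thesis
  proof eventually_elim
    case (elim w)
    have "F k j w \<le> ?G w" for k j
    proof -
      have "F k j w \<le> (\<Sum>j. F k j w)" using sum_le_suminf[of "\<lambda>j. F k j w" "{j}"] by simp
      also have "\<dots> \<le> ?G w" using sum_le_suminf[of "\<lambda>k. \<Sum>j. F k j w" "{k}"] by simp
      finally show ?thesis .
    qed
    then show ?case
      using elim by (intro exI[of _ "enn2real (?G w)"]) (auto simp: less_top)
  qed
qed

text \<open>A maximum over \<open>n k j\<close> terms is dominated by their sum. The weight
  \<open>wt k j\<close> is the rate to be gained almost surely, limited by summability of the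
  weighted totals.\<close>

lemma AE_weighted_bound:
  fixes A :: "nat \<Rightarrow> nat \<Rightarrow> nat \<Rightarrow> 'w \<Rightarrow> ennreal" and e wt :: "nat \<Rightarrow> nat \<Rightarrow> real"
  assumes A[measurable]: "\<And>k j i. A k j i \<in> borel_measurable M"
    and e: "\<And>k j i. (\<integral>\<^sup>+w. A k j i w \<partial>M) \<le> ennreal (e k j)" "\<And>k j. 0 \<le> e k j"
    and wt: "\<And>k j. 0 < wt k j"
    and le: "\<And>k j. real (n k j) * e k j * wt k j \<le> a k * b j"
    and a: "summable a" "\<And>k. 0 \<le> a k" and b: "summable b" "\<And>j. 0 \<le> b j"
  shows "AE w in M. \<exists>C\<ge>0. \<forall>k j i. i < n k j \<longrightarrow> A k j i w \<le> ennreal (C / wt k j)"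
proof -
  define F where "F k j w = (\<Sum>i<n k j. A k j i w) * ennreal (wt k j)" for k j w
  have [measurable]: "F k j \<in> borel_measurable M" for k j unfolding F_def by measurable
  have FE: "(\<integral>\<^sup>+w. F k j w \<partial>M) \<le> ennreal (a k * b j)" for k j
  proof -
    have "(\<integral>\<^sup>+w. F k j w \<partial>M) = (\<Sum>i<n k j. \<integral>\<^sup>+w. A k j i w \<partial>M) * ennreal (wt k j)"
      unfolding F_def by (simp add: nn_integral_multc nn_integral_sum)
    also have "\<dots> \<le> (\<Sum>i<n k j. ennreal (e k j)) * ennreal (wt k j)"
      using e(1) by (intro mult_right_mono sum_mono) auto
    also have "(\<Sum>i<n k j. ennreal (e k j)) = ennreal (\<Sum>i<n k j. e k j)"
      using e(2) by (intro sum_ennreal) auto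
    also have "(\<Sum>i<n k j. e k j) = real (n k j) * e k j" by simp
    also have "ennreal (real (n k j) * e k j) * ennreal (wt k j) = ennreal (real (n k j) * e k j * wt k j)"
      using e(2) wt[of k j] by (intro ennreal_mult[symmetric]) auto
    finally show ?thesis using le[of k j] by (meson ennreal_leI order_trans)
  qed
  have "AE w in M. \<exists>C\<ge>0. \<forall>k j. F k j w \<le> ennreal C"
    by (rule AE_bounded_of_summable_moments[OF _ FE a b]) simp
  then show ?thesis
  proof eventually_elim
    case (elim w)
    then obtain C where C: "0 \<le> C" "\<And>k j. F k j w \<le> ennreal C" by blast
    have "A k j i w \<le> ennreal (C / wt k j)" if "i < n k j" for k j i
    proof -
      have "A k j i w * ennreal (wt k j) \<le> F k j w"
        unfolding F_def using that by (intro mult_right_mono member_le_sum) auto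
      also have "\<dots> \<le> ennreal C" by (rule C(2))
      finally have le: "A k j i w * ennreal (wt k j) \<le> ennreal C" .
      have "ennreal (wt k j) * ennreal (1 / wt k j) = 1"
        using wt[of k j] by (subst ennreal_mult[symmetric]) auto
      then have "A k j i w = A k j i w * ennreal (wt k j) * ennreal (1 / wt k j)" by (simp add: mult.assoc)
      also have "\<dots> \<le> ennreal C * ennreal (1 / wt k j)" by (intro mult_right_mono le) simp
      also have "\<dots> = ennreal (C / wt k j)" using C(1) wt[of k j] by (subst ennreal_mult[symmetric]) auto
      finally show ?thesis .
    qed
    then show ?case using C(1) by blast
  qed
qed

text \<open>Fatou's lemma. The bound is asked for eventually only, since Euler moments are
  controlled once \<open>\<mu> / 2 ^ m < 1\<close>.\<close>

lemma nn_integral_liminf_le: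
  fixes f :: "nat \<Rightarrow> 'w \<Rightarrow> ennreal"
  assumes [measurable]: "\<And>n. f n \<in> borel_measurable M"
    and le: "\<forall>\<^sub>F n in sequentially. (\<integral>\<^sup>+w. f n w \<partial>M) \<le> B"
  shows "(\<integral>\<^sup>+w. liminf (\<lambda>n. f n w) \<partial>M) \<le> B"
proof -
  have "(\<integral>\<^sup>+w. liminf (\<lambda>n. f n w) \<partial>M) \<le> liminf (\<lambda>n. \<integral>\<^sup>+w. f n w \<partial>M)"
    by (rule nn_integral_liminf) simp
  also have "\<dots> \<le> limsup (\<lambda>n. \<integral>\<^sup>+w. f n w \<partial>M)" by (rule Liminf_le_Limsup) simp
  also have "\<dots> \<le> B" by (rule Limsup_bounded[OF le])
  finally show ?thesis .
qed

lemma sum_lessThan_add: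
  fixes f :: "nat \<Rightarrow> 'a::comm_monoid_add"
  shows "(\<Sum>k<a + b. f k) = (\<Sum>k<a. f k) + (\<Sum>k<b. f (a + k))"
  by (induction b) (auto simp: add.assoc)

text \<open>Chaining bounds the values on the grid of level \<open>m\<close> by a geometric series,
  uniformly in \<open>m\<close>; a general \<open>t\<close> is then approached by dyadic points from
  the left.\<close>

lemma unit_interval_chaining:
  fixes f :: "real \<Rightarrow> real"
  assumes p: "0 \<le> p" "p < 1" and K: "0 \<le> K"
    and inc: "\<And>j i. i < 2 ^ j \<Longrightarrow> \<bar>f (real (k * 2 ^ j + Suc i) / 2 ^ j) - f (real (k * 2 ^ j + i) / 2 ^ j)\<bar> \<le> K * p ^ j"
    and lim: "\<And>s. (\<And>n. real k \<le> s n \<and> s n \<le> t) \<Longrightarrow> s \<longlonglongrightarrow> t \<Longrightarrow> (\<lambda>n. f (s n)) \<longlonglongrightarrow> f t"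
    and t: "real k \<le> t" "t \<le> real (Suc k)"
  shows "\<bar>f t - f (real k)\<bar> \<le> K / (1 - p)"
proof -
  have grid: "\<bar>f (real (k * 2 ^ m + i) / 2 ^ m) - f (real k)\<bar> \<le> K / (1 - p)" if "i \<le> 2 ^ m" for m i
  proof -
    let ?g = "\<lambda>i. f (real (k * 2 ^ m + i) / 2 ^ m)"
    \<comment> \<open>Block level \<open>j\<close> in the index on a grid of \<open>2 ^ m\<close>
      cells is level \<open>m - j\<close> in time.\<close>
    have "\<bar>?g i - ?g 0\<bar> \<le> (\<Sum>j\<le>m. K * p ^ (m - j))"
    proof (rule dyadic_chaining[OF _ that])
      fix j i :: nat assume j: "j \<le> m" and i: "i < 2 ^ (m - j)"
      have m: "(2::nat) ^ m = 2 ^ (m - j) * 2 ^ j" using j by (simp flip: power_add)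
      have *: "real (k * 2 ^ m + r * 2 ^ j) / 2 ^ m = real (k * 2 ^ (m - j) + r) / 2 ^ (m - j)" for r
      proof -
        have "real (k * 2 ^ m + r * 2 ^ j) = real (k * 2 ^ (m - j) + r) * 2 ^ j"
          unfolding m by (simp add: algebra_simps)
        moreover have "(2::real) ^ m = 2 ^ (m - j) * 2 ^ j" using j by (simp flip: power_add)
        ultimately show ?thesis by simp
      qed
      show "\<bar>?g (Suc i * 2 ^ j) - ?g (i * 2 ^ j)\<bar> \<le> K * p ^ (m - j)"
        unfolding * by (rule inc[OF i])
    qed
    also have "(\<Sum>j\<le>m. K * p ^ (m - j)) = K * (\<Sum>j\<le>m. p ^ j)"
      unfolding sum_distrib_left[symmetric] using sum.nat_diff_reindex[of "\<lambda>j. p ^ j" "Suc m"]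
      by (simp add: lessThan_Suc_atMost)
    also have "\<dots> \<le> K * (1 / (1 - p))"
    proof (rule mult_left_mono[OF _ K])
      have "(1 - p) * (\<Sum>j<Suc m. p ^ j) = 1 - p ^ Suc m" by (rule one_diff_power_eq[symmetric])
      moreover have "0 \<le> p ^ Suc m" using p by simp
      ultimately have "(1 - p) * (\<Sum>j\<le>m. p ^ j) \<le> 1" unfolding lessThan_Suc_atMost by linarith
      then show "(\<Sum>j\<le>m. p ^ j) \<le> 1 / (1 - p)"
        using p by (simp add: pos_le_divide_eq mult.commute)
    qed
    finally show ?thesis by simp
  qed
  define s where "s n = real k + of_int \<lfloor>(t - real k) * 2 ^ n\<rfloor> / 2 ^ n" for n
  have s: "real k \<le> s n" "s n \<le> t" "t - 1 / 2 ^ n \<le> s n" for n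
  proof -
    have "of_int \<lfloor>(t - real k) * 2 ^ n\<rfloor> \<le> (t - real k) * 2 ^ n" by simp
    then show "s n \<le> t" by (simp add: s_def field_simps)
    have "(t - real k) * 2 ^ n - 1 \<le> of_int \<lfloor>(t - real k) * 2 ^ n\<rfloor>" by linarith
    then have "((t - real k) * 2 ^ n - 1) / 2 ^ n \<le> of_int \<lfloor>(t - real k) * 2 ^ n\<rfloor> / 2 ^ n"
      by (intro divide_right_mono) auto
    then show "t - 1 / 2 ^ n \<le> s n" by (simp add: s_def diff_divide_distrib)
    show "real k \<le> s n" using t(1) by (simp add: s_def)
  qed
  have "s \<longlonglongrightarrow> t"
  proof (rule tendsto_sandwich[OF _ _ _ tendsto_const])
    show "(\<lambda>n. t - 1 / 2 ^ n) \<longlonglongrightarrow> t"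
      using tendsto_diff[OF tendsto_const[of t] LIMSEQ_power_zero[of "1/2 :: real"]] by (simp add: power_divide)
  qed (use s in auto)
  then have "(\<lambda>n. \<bar>f (s n) - f (real k)\<bar>) \<longlonglongrightarrow> \<bar>f t - f (real k)\<bar>"
    using s by (intro tendsto_intros lim) auto
  moreover have "\<bar>f (s n) - f (real k)\<bar> \<le> K / (1 - p)" for n
  proof -
    define i where "i = nat \<lfloor>(t - real k) * 2 ^ n\<rfloor>"
    have fl: "0 \<le> \<lfloor>(t - real k) * 2 ^ n\<rfloor>" using t(1) by simp
    have "(t - real k) * 2 ^ n \<le> 1 * 2 ^ n" using t(2) by (intro mult_right_mono) auto
    then have "(t - real k) * 2 ^ n \<le> of_int (2 ^ n)" by simp
    then have "\<lfloor>(t - real k) * 2 ^ n\<rfloor> \<le> 2 ^ n" by linarith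
    then have "i \<le> 2 ^ n" unfolding i_def by (simp add: nat_le_iff)
    moreover have "s n = real (k * 2 ^ n + i) / 2 ^ n"
      using fl by (simp add: s_def i_def add_divide_distrib)
    ultimately show ?thesis using grid[of i n] by simp
  qed
  ultimately show ?thesis by (intro LIMSEQ_le_const2) auto
qed

text \<open>All exponents of \<open>2\<close> in the dyadic moment bounds are multiples of \<open>1/24\<close>, hence
  natural powers of this number.\<close>

definition rt24 :: real where "rt24 = 2 powr (1/24)"

lemma rt24_gt_1: "1 < rt24"
  unfolding rt24_def using powr_less_mono[of 0 "1/24" "2::real"] by simp

lemma rt24_power: "rt24 ^ 24 = 2"
  by (simp add: rt24_def powr_realpow[symmetric] powr_powr)

lemma rt24_four_thirds: "(2 ^ j) powr (4/3) = rt24 ^ (32 * j)"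
  by (simp add: rt24_def powr_realpow[symmetric] powr_powr mult.commute)

lemma power_2_rt24: "2 ^ j = rt24 ^ (24 * j)"
  by (simp add: power_mult rt24_power)

lemma summable_powr_nat: "summable (\<lambda>k. (real k + 1) powr (-5/4))"
proof -
  have "summable (\<lambda>k. real (Suc k) powr (-5/4))"
    by (subst summable_Suc_iff) (simp add: summable_real_powr_iff)
  then show ?thesis by (simp add: add.commute)
qed

section \<open>Dyadic increments of the drivers\<close>

context fractional_gaussian_space
begin

definition fbm_coordinate :: "(real \<Rightarrow> 'w \<Rightarrow> real) \<Rightarrow> bool" where
  "fbm_coordinate X \<longleftrightarrow> (\<forall>t\<ge>0. X t \<in> V) \<and> (\<forall>s\<ge>0. \<forall>t\<ge>0. expectation (\<lambda>w. X s w * X t w) =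
      (1/2) * (s powr (2*H) + t powr (2*H) - \<bar>s - t\<bar> powr (2*H)))"

text \<open>Fourth moments are at most \<open>3 * (1 / rt24) ^ (32 * j)\<close> since
  \<open>4*H > 4/3\<close>. Summing over \<open>2 ^ j\<close> intervals leaves eight powers of
  \<open>1 / rt24\<close> per level: four secure summability, four become the rate, which is one
  power after the fourth root. The weight \<open>-5/4\<close> in \<open>k\<close> is summable and
  turns into the growth exponent \<open>5/16\<close>.\<close>

lemma increments_bound:
  assumes fbm: "fbm_coordinate X"
  shows "AE w in M. \<exists>C\<ge>0. \<forall>k j i. i < 2 ^ j \<longrightarrow>
    \<bar>X (real (k * 2 ^ j + Suc i) / 2 ^ j) w - X (real (k * 2 ^ j + i) / 2 ^ j) w\<bar> \<le> C * (real k + 1) powr (5/16) * (1 / rt24) ^ j"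
proof -
  have X: "X t \<in> V" if "0 \<le> t" for t using fbm that unfolding fbm_coordinate_def by blast
  have cov: "expectation (\<lambda>w. X s w * X t w) = (1/2) * (s powr (2*H) + t powr (2*H) - \<bar>s - t\<bar> powr (2*H))"
    if "0 \<le> s" "0 \<le> t" for s t using fbm that unfolding fbm_coordinate_def by blast
  define d where "d k j i w = X (real (k * 2 ^ j + Suc i) / 2 ^ j) w - X (real (k * 2 ^ j + i) / 2 ^ j) w" for k j i w
  have dV: "d k j i \<in> V" for k j i unfolding d_def by (intro V_diff X) auto
  have d4: "expectation (\<lambda>w. d k j i w ^ 4) \<le> 3 * (1 / rt24) ^ (32 * j)" for k j i
  proof -
    have "expectation (\<lambda>w. d k j i w ^ 4) = 3 * \<bar>real (k * 2 ^ j + Suc i) / 2 ^ j - real (k * 2 ^ j + i) / 2 ^ j\<bar> powr (4*H)"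
      unfolding d_def by (rule increment_moment4[OF X cov]) auto
    also have "\<bar>real (k * 2 ^ j + Suc i) / 2 ^ j - real (k * 2 ^ j + i) / 2 ^ j\<bar> = 1 / 2 ^ j"
      by (simp add: diff_divide_distrib[symmetric])
    also have "(1 / 2 ^ j :: real) powr (4*H) \<le> (1 / 2 ^ j) powr (4/3)"
      using H by (intro powr_mono') auto
    also have "\<dots> = (1 / rt24) ^ (32 * j)" by (simp add: powr_divide rt24_four_thirds power_divide)
    finally show ?thesis by simp
  qed
  have "AE w in M. \<exists>C\<ge>0. \<forall>k j i. i < 2 ^ j \<longrightarrow> ennreal (d k j i w ^ 4) \<le> ennreal (C / (rt24 ^ (4 * j) * (real k + 1) powr (-5/4)))"
  proof (rule AE_weighted_bound)
    fix k j i
    show "(\<lambda>w. ennreal (d k j i w ^ 4)) \<in> borel_measurable M" using V_measurable[OF dV] by simp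
    show "(\<integral>\<^sup>+w. ennreal (d k j i w ^ 4) \<partial>M) \<le> ennreal (3 * (1 / rt24) ^ (32 * j))"
      using d4[of k j i] by (subst nn_integral_eq_integral[OF V_integrable4[OF dV]]) (auto intro: ennreal_leI)
    have "rt24 ^ (32 * j) = rt24 ^ (24 * j) * rt24 ^ (4 * j) * rt24 ^ (4 * j)" by (simp flip: power_add)
    then show "real (2 ^ j) * (3 * (1 / rt24) ^ (32 * j)) * (rt24 ^ (4 * j) * (real k + 1) powr (-5/4))
        \<le> (real k + 1) powr (-5/4) * (3 * (1 / rt24 ^ 4) ^ j)"
      using rt24_gt_1 by (simp add: power_2_rt24 power_divide power_mult) (simp add: mult.commute)
    show "summable (\<lambda>j. 3 * (1 / rt24 ^ 4) ^ j)"
      using rt24_gt_1 by (intro summable_mult summable_geometric) (auto simp: one_less_power)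
  qed (use rt24_gt_1 summable_powr_nat in auto)
  then show ?thesis
  proof eventually_elim
    case (elim w)
    then obtain C where C: "0 \<le> C" "\<And>k j i. i < 2 ^ j \<Longrightarrow> ennreal (d k j i w ^ 4) \<le> ennreal (C / (rt24 ^ (4 * j) * (real k + 1) powr (-5/4)))"
      by blast
    have "\<bar>d k j i w\<bar> \<le> C powr (1/4) * (real k + 1) powr (5/16) * (1 / rt24) ^ j" if "i < 2 ^ j" for k j i
    proof -
      have "0 \<le> C / (rt24 ^ (4 * j) * (real k + 1) powr (-5/4))" using C(1) rt24_gt_1 by simp
      then have "d k j i w ^ 4 \<le> C / (rt24 ^ (4 * j) * (real k + 1) powr (-5/4))"
        using C(2)[OF that, of k] by (simp only: ennreal_le_iff)
      also have "\<dots> = C * (real k + 1) powr (5/4) * (1 / rt24 ^ (4 * j))"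
        using powr_minus_divide[of "real k + 1" "5/4"] by simp
      also have "\<dots> = (C powr (1/4) * (real k + 1) powr (5/16) * (1 / rt24) ^ j) ^ 4"
      proof -
        have "(C powr (1/4)) ^ 4 = C" using C(1) by (cases "C = 0") (auto simp: powr_realpow[symmetric] powr_powr)
        moreover have "((real k + 1) powr (5/16)) ^ 4 = (real k + 1) powr (5/4)"
          by (simp add: powr_realpow[symmetric] powr_powr)
        ultimately show ?thesis by (simp add: power_mult_distrib power_divide power_mult[symmetric] mult.commute)
      qed
      finally have "\<bar>d k j i w\<bar> ^ 4 \<le> (C powr (1/4) * (real k + 1) powr (5/16) * (1 / rt24) ^ j) ^ 4" by simp
      then show ?thesis
        by (rule power_mono_iff[THEN iffD1, rotated 3]) (use rt24_gt_1 in auto)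
    qed
    then show ?case unfolding d_def using C(1) by (intro exI[of _ "C powr (1/4)"]) auto
  qed
qed

end

section \<open>Limiting moments of the trapezoidal sums\<close>

context fbm_pair
begin

text \<open>Trapezoidal sum over \<open>N\<close> cells from grid index \<open>l\<close>: plain for
  \<open>c = 0\<close>, centred at the left value of the integrand for \<open>c = 1\<close>.\<close>

definition esum :: "real \<Rightarrow> real \<Rightarrow> real \<Rightarrow> nat \<Rightarrow> nat \<Rightarrow> nat \<Rightarrow> 'w \<Rightarrow> real" where
  "esum c \<mu> \<sigma> m l N w = (\<Sum>k<N. ((1/2) * (euler \<mu> \<sigma> m (l + k) w + euler \<mu> \<sigma> m (l + Suc k) w) - c * euler \<mu> \<sigma> m l w) *
      (\<gamma> (real (l + Suc k) / 2 ^ m) w - \<gamma> (real (l + k) / 2 ^ m) w))"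

lemma esum_measurable [measurable]: "esum c \<mu> \<sigma> m l N \<in> borel_measurable M"
proof -
  have [measurable]: "euler \<mu> \<sigma> m k \<in> borel_measurable M" for k by (intro V_measurable euler_V)
  have [measurable]: "\<gamma> (real k / 2 ^ m) \<in> borel_measurable M" for k by (intro V_measurable \<gamma>_V) simp
  show ?thesis unfolding esum_def by measurable
qed

lemma esum_square_integrable: "integrable M (\<lambda>w. (esum c \<mu> \<sigma> m l N w)\<^sup>2)"
  unfolding esum_def
proof (rule second_moment_bilinear(1))
  fix i j
  show g: "(\<lambda>w. (1/2) * (euler \<mu> \<sigma> m (l + i) w + euler \<mu> \<sigma> m (l + Suc i) w) - c * euler \<mu> \<sigma> m l w) \<in> V" for i
    by (intro V_diff V_scale V_add euler_V)
  show "(\<lambda>w. \<gamma> (real (l + Suc i) / 2 ^ m) w - \<gamma> (real (l + i) / 2 ^ m) w) \<in> V"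
    by (intro V_diff \<gamma>_V) auto
  have z: "expectation (\<lambda>w. euler \<mu> \<sigma> m k w * \<gamma> t w) = 0" "integrable M (\<lambda>w. euler \<mu> \<sigma> m k w * \<gamma> t w)"
    if "0 \<le> t" for k t
    using euler_\<gamma>_orth[OF that] integrable_V_mult[OF euler_V \<gamma>_V[OF that]] by auto
  have "((1/2) * (euler \<mu> \<sigma> m (l + i) w + euler \<mu> \<sigma> m (l + Suc i) w) - c * euler \<mu> \<sigma> m l w) *
      (\<gamma> (real (l + Suc j) / 2 ^ m) w - \<gamma> (real (l + j) / 2 ^ m) w) =
     (1/2) * (euler \<mu> \<sigma> m (l + i) w * \<gamma> (real (l + Suc j) / 2 ^ m) w) + (1/2) * (euler \<mu> \<sigma> m (l + Suc i) w * \<gamma> (real (l + Suc j) / 2 ^ m) w)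
     - c * (euler \<mu> \<sigma> m l w * \<gamma> (real (l + Suc j) / 2 ^ m) w)
     - ((1/2) * (euler \<mu> \<sigma> m (l + i) w * \<gamma> (real (l + j) / 2 ^ m) w) + (1/2) * (euler \<mu> \<sigma> m (l + Suc i) w * \<gamma> (real (l + j) / 2 ^ m) w)
     - c * (euler \<mu> \<sigma> m l w * \<gamma> (real (l + j) / 2 ^ m) w))" for w
    by (simp add: algebra_simps del: ou_euler.simps add_Suc_right)
  then show "expectation (\<lambda>w. ((1/2) * (euler \<mu> \<sigma> m (l + i) w + euler \<mu> \<sigma> m (l + Suc i) w) - c * euler \<mu> \<sigma> m l w) *
      (\<gamma> (real (l + Suc j) / 2 ^ m) w - \<gamma> (real (l + j) / 2 ^ m) w)) = 0"
    using z by (simp del: ou_euler.simps add_Suc_right)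
qed

text \<open>The liminf is measurable without reference to a pathwise limit. Centred sums serve
  intervals of length \<open>2 ^ -j\<close>; plain sums serve length \<open>2 ^ j\<close>, where
  \<open>2*H \<le> 4/3\<close> makes the order \<open>4/3\<close> dominant.\<close>

lemma liminf_esum_moment:
  fixes \<mu> \<sigma> :: real
  assumes \<mu>: "0 < \<mu>"
  obtains C where "0 \<le> C"
    and "\<And>j a. (\<integral>\<^sup>+w. liminf (\<lambda>n. ennreal ((esum 1 \<mu> \<sigma> (j + n) (a * 2 ^ n) (2 ^ n) w)\<^sup>2)) \<partial>M) \<le> ennreal (C * (1 / rt24) ^ (32 * j))"
    and "\<And>j a. (\<integral>\<^sup>+w. liminf (\<lambda>n. ennreal ((esum 0 \<mu> \<sigma> n (a * 2 ^ n) (2 ^ j * 2 ^ n) w)\<^sup>2)) \<partial>M) \<le> ennreal (C * rt24 ^ (32 * j))"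
proof
  define C0 where "C0 = \<sigma>\<^sup>2 * (1 + 1 / \<mu>)"
  define C1 where "C1 = 2 * \<mu>\<^sup>2 * C0 + 2 * \<sigma>\<^sup>2 + 4 * C0"
  have C0: "0 \<le> C0" using \<mu> by (simp add: C0_def)
  have C1: "0 \<le> C1" using C0 by (simp add: C1_def)
  show "0 \<le> C0 + 5 * C1" using C0 C1 by simp
  have ev: "\<forall>\<^sub>F n in sequentially. \<mu> / 2 ^ (j + n) < 1" for j
  proof -
    have "(\<lambda>n. \<mu> * (1/2) ^ (n + j)) \<longlonglongrightarrow> \<mu> * 0"
      by (intro tendsto_mult_left LIMSEQ_ignore_initial_segment LIMSEQ_power_zero) simp
    then have "\<forall>\<^sub>F n in sequentially. \<mu> * (1/2) ^ (n + j) < 1" by (intro order_tendstoD(2)) auto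
    then show ?thesis by eventually_elim (simp add: power_divide add.commute)
  qed
  have nn: "(\<integral>\<^sup>+w. ennreal ((esum c \<mu> \<sigma> m l N w)\<^sup>2) \<partial>M) = ennreal (expectation (\<lambda>w. (esum c \<mu> \<sigma> m l N w)\<^sup>2))" for c m l N
    by (rule nn_integral_eq_integral[OF esum_square_integrable]) simp
  show "(\<integral>\<^sup>+w. liminf (\<lambda>n. ennreal ((esum 1 \<mu> \<sigma> (j + n) (a * 2 ^ n) (2 ^ n) w)\<^sup>2)) \<partial>M) \<le> ennreal ((C0 + 5 * C1) * (1 / rt24) ^ (32 * j))" for j a
  proof (rule nn_integral_liminf_le)
    show "\<forall>\<^sub>F n in sequentially. (\<integral>\<^sup>+w. ennreal ((esum 1 \<mu> \<sigma> (j + n) (a * 2 ^ n) (2 ^ n) w)\<^sup>2) \<partial>M) \<le> ennreal ((C0 + 5 * C1) * (1 / rt24) ^ (32 * j))"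
      using ev[of j]
    proof eventually_elim
      case (elim n)
      have "expectation (\<lambda>w. (esum 1 \<mu> \<sigma> (j + n) (a * 2 ^ n) (2 ^ n) w)\<^sup>2) \<le> 5 * C1 * (real (2 ^ n) / 2 ^ (j + n)) powr (4/3)"
        unfolding esum_def mult_1 C1_def C0_def by (rule euler_sum_moment(2)[OF \<mu> elim])
      also have "real (2 ^ n) / 2 ^ (j + n) = 1 / 2 ^ j" by (simp add: power_add)
      also have "(1 / 2 ^ j :: real) powr (4/3) = (1 / rt24) ^ (32 * j)" by (simp add: powr_divide rt24_four_thirds power_divide)
      also have "5 * C1 * (1 / rt24) ^ (32 * j) \<le> (C0 + 5 * C1) * (1 / rt24) ^ (32 * j)"
        using C0 rt24_gt_1 by (intro mult_right_mono) auto
      finally show ?case unfolding nn by (rule ennreal_leI)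
    qed
  qed simp
  show "(\<integral>\<^sup>+w. liminf (\<lambda>n. ennreal ((esum 0 \<mu> \<sigma> n (a * 2 ^ n) (2 ^ j * 2 ^ n) w)\<^sup>2)) \<partial>M) \<le> ennreal ((C0 + 5 * C1) * rt24 ^ (32 * j))" for j a
  proof (rule nn_integral_liminf_le)
    show "\<forall>\<^sub>F n in sequentially. (\<integral>\<^sup>+w. ennreal ((esum 0 \<mu> \<sigma> n (a * 2 ^ n) (2 ^ j * 2 ^ n) w)\<^sup>2) \<partial>M) \<le> ennreal ((C0 + 5 * C1) * rt24 ^ (32 * j))"
      using ev[of 0]
    proof eventually_elim
      case (elim n)
      then have \<mu>n: "\<mu> / 2 ^ n < 1" by simp
      have "expectation (\<lambda>w. (esum 0 \<mu> \<sigma> n (a * 2 ^ n) (2 ^ j * 2 ^ n) w)\<^sup>2) \<le>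
          C0 * (real (2 ^ j * 2 ^ n) / 2 ^ n) powr (2*H) + 4 * C1 * (real (2 ^ j * 2 ^ n) / 2 ^ n) powr (4/3)"
        unfolding esum_def mult_zero_left diff_0_right C1_def C0_def by (rule euler_sum_moment(1)[OF \<mu> \<mu>n])
      also have "real (2 ^ j * 2 ^ n) / 2 ^ n = (2::real) ^ j" by simp
      also have "C0 * (2 ^ j) powr (2*H) + 4 * C1 * (2 ^ j) powr (4/3) \<le> C0 * (2 ^ j) powr (4/3) + 5 * C1 * (2 ^ j) powr (4/3)"
        using C0 C1 H by (intro add_mono mult_left_mono mult_right_mono powr_mono) auto
      also have "\<dots> = (C0 + 5 * C1) * rt24 ^ (32 * j)" by (simp add: rt24_four_thirds algebra_simps)
      finally show ?case unfolding nn by (rule ennreal_leI)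
    qed
  qed simp
qed

end

lemma sublinear_tendsto_0:
  fixes f :: "real \<Rightarrow> real"
  assumes a: "a < 1" and f: "\<And>t. 1 \<le> t \<Longrightarrow> \<bar>f t\<bar> \<le> C * t powr a"
  shows "((\<lambda>t. f t / t) \<longlongrightarrow> 0) at_top"
proof (rule Lim_null_comparison)
  show "\<forall>\<^sub>F t in at_top. norm (f t / t) \<le> C * t powr (a - 1)"
    using eventually_ge_at_top[of 1]
  proof eventually_elim
    case (elim t)
    then have "\<bar>f t\<bar> / t \<le> C * t powr a / t" using f[of t] by (intro divide_right_mono) auto
    then show ?case using elim by (simp add: powr_diff abs_divide)
  qed
  have "((\<lambda>t::real. C * t powr (a - 1)) \<longlongrightarrow> C * 0) at_top"
    by (intro tendsto_mult_left tendsto_neg_powr filterlim_ident) (use a in auto)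
  then show "((\<lambda>t::real. C * t powr (a - 1)) \<longlongrightarrow> 0) at_top" by simp
qed

text \<open>For \<sigma> \<noteq> 0 the sequence \<open>e\<close> converges and its liminf is a
  limit; for \<sigma> = 0 convergence of \<open>e\<close> is unknown, but
  \<open>L = 0\<close>.\<close>

lemma liminf_square_bound:
  fixes e :: "nat \<Rightarrow> real"
  assumes lim: "(\<lambda>n. \<sigma> * e n) \<longlonglongrightarrow> L" and K: "0 \<le> K"
    and le: "liminf (\<lambda>n. ennreal ((e n)\<^sup>2)) \<le> ennreal (K\<^sup>2)"
  shows "\<bar>L\<bar> \<le> \<bar>\<sigma>\<bar> * K"
proof (cases "\<sigma> = 0")
  case True
  then have "L = 0" using LIMSEQ_unique[OF lim, of 0] by simp
  then show ?thesis using K by simp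
next
  case False
  have "(\<lambda>n. (1 / \<sigma>) * (\<sigma> * e n)) \<longlonglongrightarrow> (1 / \<sigma>) * L" by (intro tendsto_mult_left lim)
  then have "(\<lambda>n. e n) \<longlonglongrightarrow> L / \<sigma>" using False by simp
  then have "(\<lambda>n. ennreal ((e n)\<^sup>2)) \<longlonglongrightarrow> ennreal ((L / \<sigma>)\<^sup>2)"
    by (intro tendsto_ennrealI tendsto_power)
  from lim_imp_Liminf[OF sequentially_bot this] le
  have "ennreal ((L / \<sigma>)\<^sup>2) \<le> ennreal (K\<^sup>2)" by (simp only:)
  then have "(L / \<sigma>)\<^sup>2 \<le> K\<^sup>2" by (simp add: ennreal_le_iff)
  then have "\<bar>L / \<sigma>\<bar> \<le> K" using K by (metis abs_le_square_iff abs_of_nonneg)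
  then show ?thesis using False by (simp add: abs_divide field_simps)
qed

section \<open>Sublinear growth of the noise integrals\<close>

text \<open>The deterministic relations between two driver paths, a solution \<open>x\<close> and a
  noise integral \<open>N\<close>. Quantifying over \<open>x\<close> and \<open>N\<close> after the
  outcome is fixed makes the null set depend on the drivers alone, so \<open>N\<close> may come from
  a lift without measurability.\<close>

definition good_path ::
  "real \<Rightarrow> real \<Rightarrow> (real \<Rightarrow> real) \<Rightarrow> (real \<Rightarrow> real) \<Rightarrow> (real \<Rightarrow> real) \<Rightarrow> (real \<Rightarrow> real) \<Rightarrow> bool" where
  "good_path \<mu> \<sigma> b g x N \<longleftrightarrow>
     continuous_on {0..} b \<and> continuous_on {0..} g \<and> ou_path \<mu> \<sigma> x b \<and> N 0 = 0 \<and>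
     (\<forall>a j. 0 < a \<longrightarrow> (\<lambda>n. \<Sum>k<a * 2 ^ n. \<sigma> * ((1/2) * (x (real k / 2 ^ (j + n)) + x (real (Suc k) / 2 ^ (j + n))) *
        (g (real (Suc k) / 2 ^ (j + n)) - g (real k / 2 ^ (j + n))))) \<longlonglongrightarrow> N (real a / 2 ^ j)) \<and>
     (\<forall>t s. (\<forall>n. 0 < s n \<and> s n \<le> t) \<longrightarrow> s \<longlonglongrightarrow> t \<longrightarrow> (\<lambda>n. N (s n)) \<longlonglongrightarrow> N t)"

lemma square_sublinear:
  fixes x :: "real \<Rightarrow> real"
  assumes C: "0 \<le> C" and x: "\<And>t. 0 \<le> t \<Longrightarrow> \<bar>x t\<bar> \<le> C * (t + 1) powr (5/16)"
  shows "((\<lambda>t. (x t)\<^sup>2 / t) \<longlongrightarrow> 0) at_top"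
proof -
  have xb: "\<bar>(x t)\<^sup>2\<bar> \<le> C\<^sup>2 * 2 powr (5/8) * t powr (5/8)" if t: "1 \<le> t" for t
  proof -
    have "\<bar>x t\<bar> \<le> C * (2 * t) powr (5/16)"
      using C t by (intro order_trans[OF x] mult_left_mono powr_mono2) auto
    then have "\<bar>x t\<bar>\<^sup>2 \<le> (C * (2 * t) powr (5/16))\<^sup>2" by (intro power_mono) auto
    also have "\<dots> = C\<^sup>2 * ((2 * t) powr (5/16) * (2 * t) powr (5/16))" by (simp add: power2_eq_square)
    also have "(2 * t) powr (5/16) * (2 * t) powr (5/16) = 2 powr (5/8) * t powr (5/8)"
    proof -
      have "(2 * t) powr (5/16) * (2 * t) powr (5/16) = (2 * t) powr (5/16 + 5/16)" by (rule powr_add[symmetric])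
      also have "\<dots> = 2 powr (5/8) * t powr (5/8)" using t by (simp add: powr_mult)
      finally show ?thesis .
    qed
    finally show ?thesis by simp
  qed
  show ?thesis by (rule sublinear_tendsto_0[OF _ xb]) simp_all
qed

text \<open>Chaining turns the dyadic increments into oscillations over unit intervals, and
  relaxation transfers their growth to every solution driven by the path.\<close>

lemma (in fractional_gaussian_space) ou_growth:
  assumes fbm: "fbm_coordinate X"
  shows "AE w in M. \<forall>x. continuous_on {0..} (\<lambda>t. X t w) \<and> ou_path \<mu> \<sigma> x (\<lambda>t. X t w) \<longrightarrow>
    (\<exists>C\<ge>0. \<forall>t\<ge>0. \<bar>x t\<bar> \<le> C * (t + 1) powr (5/16))"
  using increments_bound[OF fbm]
proof eventually_elim
  case (elim w)
  define p where "p = 1 / rt24"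
  have p: "0 \<le> p" "p < 1" using rt24_gt_1 by (auto simp: p_def)
  obtain C where C: "0 \<le> C" "\<And>k j i. i < 2 ^ j \<Longrightarrow>
    \<bar>X (real (k * 2 ^ j + Suc i) / 2 ^ j) w - X (real (k * 2 ^ j + i) / 2 ^ j) w\<bar> \<le> C * (real k + 1) powr (5/16) * p ^ j"
    using elim unfolding p_def by blast
  show ?case
  proof (intro allI impI)
    fix x assume x: "continuous_on {0..} (\<lambda>t. X t w) \<and> ou_path \<mu> \<sigma> x (\<lambda>t. X t w)"
    interpret ou_path \<mu> \<sigma> x "\<lambda>t. X t w" using x by blast
    have "\<bar>X t w - X (real k) w\<bar> \<le> C * (real k + 1) powr (5/16) / (1 - p)"
      if t: "real k \<le> t" "t \<le> real (Suc k)" for k t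
    proof (rule unit_interval_chaining[OF p _ C(2) _ t])
      fix s :: "nat \<Rightarrow> real" assume s: "\<And>n. real k \<le> s n \<and> s n \<le> t" "s \<longlonglongrightarrow> t"
      have "0 \<le> s n" for n using s(1)[of n] by (meson of_nat_0_le_iff order_trans)
      moreover have "0 \<le> t" using t(1) by (meson of_nat_0_le_iff order_trans)
      ultimately show "(\<lambda>n. X (s n) w) \<longlonglongrightarrow> X t w"
        using x by (intro continuous_on_tendsto_compose[OF _ s(2), of "{0..}" "\<lambda>t. X t w"]) auto
    qed (use C(1) in auto)
    then show "\<exists>C\<ge>0. \<forall>t\<ge>0. \<bar>x t\<bar> \<le> C * (t + 1) powr (5/16)"
      using C(1) p by (intro growth[where c = "C / (1 - p)"]) auto
  qed
qed

context fbm_pair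
begin

text \<open>A block sum is a difference of sums started at 0, and the centring term telescopes to
  one increment of \<gamma>. In the limit the Euler values become values of
  \<open>x\<close>.\<close>

lemma esum_limit:
  assumes good: "good_path \<mu> \<sigma> (\<lambda>t. \<beta> t w) (\<lambda>t. \<gamma> t w) x N"
  shows "(\<lambda>n. \<sigma> * esum c \<mu> \<sigma> (j + n) (a * 2 ^ n) (b * 2 ^ n) w) \<longlonglongrightarrow>
    N (real (a + b) / 2 ^ j) - N (real a / 2 ^ j) - c * (\<sigma> * x (real a / 2 ^ j) * (\<gamma> (real (a + b) / 2 ^ j) w - \<gamma> (real a / 2 ^ j) w))"
proof -
  interpret ou_path \<mu> \<sigma> x "\<lambda>t. \<beta> t w" using good unfolding good_path_def by blast
  have c\<gamma>: "continuous_on {0..} (\<lambda>t. \<gamma> t w)" using good unfolding good_path_def by blast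
  define G where "G n k = \<gamma> (real k / 2 ^ (j + n)) w" for n k
  define e where "e n k = euler \<mu> \<sigma> (j + n) k w" for n k
  define P where "P a n = (\<Sum>k<a * 2 ^ n. (1/2) * (e n k + e n (Suc k)) * (G n (Suc k) - G n k))" for a n
  have G: "G n (a * 2 ^ n) = \<gamma> (real a / 2 ^ j) w" for n a by (simp add: G_def power_add)
  have P: "(\<lambda>n. \<sigma> * P a n) \<longlonglongrightarrow> N (real a / 2 ^ j)" for a
  proof (cases "a = 0")
    case True
    then show ?thesis using good unfolding good_path_def by (simp add: P_def)
  next
    case False
    let ?S = "\<lambda>n. \<Sum>k<a * 2 ^ n. (1/2) * (x (real k / 2 ^ (j + n)) + x (real (Suc k) / 2 ^ (j + n))) * (G n (Suc k) - G n k)"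
    have "(\<lambda>n. P a n - ?S n) \<longlonglongrightarrow> 0"
      unfolding P_def e_def G_def by (rule euler_limit(2)[OF c\<gamma>])
    then have "(\<lambda>n. \<sigma> * (P a n - ?S n)) \<longlonglongrightarrow> \<sigma> * 0" by (rule tendsto_mult_left)
    moreover have "(\<lambda>n. \<sigma> * ?S n) \<longlonglongrightarrow> N (real a / 2 ^ j)"
      using good False unfolding good_path_def G_def sum_distrib_left by blast
    ultimately have "(\<lambda>n. \<sigma> * (P a n - ?S n) + \<sigma> * ?S n) \<longlonglongrightarrow> \<sigma> * 0 + N (real a / 2 ^ j)"
      by (rule tendsto_add)
    then show ?thesis by (simp add: algebra_simps)
  qed
  have lim: "(\<lambda>n. \<sigma> * P (a + b) n - \<sigma> * P a n - c * (\<sigma> * e n (a * 2 ^ n) * (\<gamma> (real (a + b) / 2 ^ j) w - \<gamma> (real a / 2 ^ j) w))) \<longlonglongrightarrow>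
    N (real (a + b) / 2 ^ j) - N (real a / 2 ^ j) - c * (\<sigma> * x (real a / 2 ^ j) * (\<gamma> (real (a + b) / 2 ^ j) w - \<gamma> (real a / 2 ^ j) w))"
    unfolding e_def by (intro tendsto_diff tendsto_mult tendsto_const P euler_limit(1)[OF c\<gamma>])
  have "\<sigma> * esum c \<mu> \<sigma> (j + n) (a * 2 ^ n) (b * 2 ^ n) w =
     \<sigma> * P (a + b) n - \<sigma> * P a n - c * (\<sigma> * e n (a * 2 ^ n) * (\<gamma> (real (a + b) / 2 ^ j) w - \<gamma> (real a / 2 ^ j) w))" for n
  proof -
    let ?l = "a * 2 ^ n" and ?N = "b * 2 ^ n"
    define S where "S = (\<Sum>k<?N. (1/2) * (e n (?l + k) + e n (?l + Suc k)) * (G n (?l + Suc k) - G n (?l + k)))"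
    have 1: "P (a + b) n = P a n + S"
      unfolding P_def S_def distrib_right sum_lessThan_add by simp
    have 2: "esum c \<mu> \<sigma> (j + n) ?l ?N w = S - c * e n ?l * (\<Sum>k<?N. G n (?l + Suc k) - G n (?l + k))"
      unfolding S_def esum_def G_def e_def sum_distrib_left sum_subtractf[symmetric]
      by (intro sum.cong refl) (simp only: left_diff_distrib)
    have 3: "(\<Sum>k<?N. G n (?l + Suc k) - G n (?l + k)) = \<gamma> (real (a + b) / 2 ^ j) w - \<gamma> (real a / 2 ^ j) w"
      using sum_lessThan_telescope[of "\<lambda>k. G n (?l + k)" ?N] G[of n a] G[of n "a + b"] by (simp add: distrib_right)
    show ?thesis unfolding 2 3 1 by (simp add: algebra_simps)
  qed
  then show ?thesis using lim by simp
qed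

text \<open>Summing \<open>2 ^ j\<close> second moments of order
  \<open>(1 / rt24) ^ (32 * j)\<close> leaves eight powers per level: six secure summability, two
  become the rate, which is one power after the square root.\<close>

lemma local_area_bound:
  fixes \<mu> \<sigma> :: real
  assumes \<mu>: "0 < \<mu>"
  shows "AE w in M. \<exists>C\<ge>0. \<forall>k j i. i < 2 ^ j \<longrightarrow>
    liminf (\<lambda>n. ennreal ((esum 1 \<mu> \<sigma> (j + n) ((k * 2 ^ j + i) * 2 ^ n) (2 ^ n) w)\<^sup>2))
      \<le> ennreal ((C * (real k + 1) powr (5/8) * (1 / rt24) ^ j)\<^sup>2)"
proof -
  obtain C where C: "0 \<le> C"
    "\<And>j a. (\<integral>\<^sup>+w. liminf (\<lambda>n. ennreal ((esum 1 \<mu> \<sigma> (j + n) (a * 2 ^ n) (2 ^ n) w)\<^sup>2)) \<partial>M) \<le> ennreal (C * (1 / rt24) ^ (32 * j))"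
    "\<And>j a. (\<integral>\<^sup>+w. liminf (\<lambda>n. ennreal ((esum 0 \<mu> \<sigma> n (a * 2 ^ n) (2 ^ j * 2 ^ n) w)\<^sup>2)) \<partial>M) \<le> ennreal (C * rt24 ^ (32 * j))"
    by (rule liminf_esum_moment[OF \<mu>, of \<sigma>]) (rule that)
  define A where "A k j i w = liminf (\<lambda>n. ennreal ((esum 1 \<mu> \<sigma> (j + n) ((k * 2 ^ j + i) * 2 ^ n) (2 ^ n) w)\<^sup>2))" for k j i w
  have "AE w in M. \<exists>K\<ge>0. \<forall>k j i. i < 2 ^ j \<longrightarrow> A k j i w \<le> ennreal (K / (rt24 ^ (2 * j) * (real k + 1) powr (-5/4)))"
  proof (rule AE_weighted_bound)
    fix k j i
    show "A k j i \<in> borel_measurable M" unfolding A_def by measurable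
    show "(\<integral>\<^sup>+w. A k j i w \<partial>M) \<le> ennreal (C * (1 / rt24) ^ (32 * j))" unfolding A_def by (rule C(2))
    have "rt24 ^ (32 * j) = rt24 ^ (24 * j) * rt24 ^ (2 * j) * rt24 ^ (6 * j)" by (simp flip: power_add)
    then show "real (2 ^ j) * (C * (1 / rt24) ^ (32 * j)) * (rt24 ^ (2 * j) * (real k + 1) powr (-5/4))
        \<le> (real k + 1) powr (-5/4) * (C * (1 / rt24 ^ 6) ^ j)"
      using rt24_gt_1 by (simp add: power_2_rt24 power_divide power_mult) (simp add: mult.commute)
    show "summable (\<lambda>j. C * (1 / rt24 ^ 6) ^ j)"
      using rt24_gt_1 by (intro summable_mult summable_geometric) (auto simp: one_less_power)
  qed (use rt24_gt_1 summable_powr_nat C(1) in auto)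
  then show ?thesis
  proof eventually_elim
    case (elim w)
    then obtain K where K: "0 \<le> K" "\<And>k j i. i < 2 ^ j \<Longrightarrow> A k j i w \<le> ennreal (K / (rt24 ^ (2 * j) * (real k + 1) powr (-5/4)))"
      by blast
    have "K / (rt24 ^ (2 * j) * (real k + 1) powr (-5/4)) = (sqrt K * (real k + 1) powr (5/8) * (1 / rt24) ^ j)\<^sup>2" for k j
    proof -
      have "((real k + 1) powr (5/8))\<^sup>2 = (real k + 1) powr (5/4)"
        by (simp add: power2_eq_square powr_add[symmetric])
      moreover have "((1 / rt24) ^ j)\<^sup>2 = 1 / rt24 ^ (2 * j)"
        by (simp only: power_mult[symmetric] mult.commute[of 2 j] power_one_over)
      ultimately show ?thesis
        using K(1) powr_minus_divide[of "real k + 1" "5/4"] by (simp add: power_mult_distrib)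
    qed
    with K(2) have "\<forall>k j i. i < 2 ^ j \<longrightarrow> A k j i w \<le> ennreal ((sqrt K * (real k + 1) powr (5/8) * (1 / rt24) ^ j)\<^sup>2)"
      by (simp only:) simp
    then show ?case unfolding A_def using K(1) by (intro exI[of _ "sqrt K"]) simp
  qed
qed

text \<open>The first \<open>2 ^ r\<close> blocks of length \<open>2 ^ j\<close> cover the horizon
  \<open>2 ^ (r + j)\<close>. Their total has exponent \<open>24 * r + 32 * j\<close> against the
  allowance \<open>44 * (r + j)\<close>, leaving a convergent double series. The square root of the
  allowance is the horizon to the power \<open>11/12\<close>.\<close>

lemma global_area_bound:
  fixes \<mu> \<sigma> :: real
  assumes \<mu>: "0 < \<mu>"
  shows "AE w in M. \<exists>C\<ge>0. \<forall>r j i. i < 2 ^ r \<longrightarrow>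
    liminf (\<lambda>n. ennreal ((esum 0 \<mu> \<sigma> n (i * 2 ^ j * 2 ^ n) (2 ^ j * 2 ^ n) w)\<^sup>2))
      \<le> ennreal ((C * rt24 ^ (22 * (r + j)))\<^sup>2)"
proof -
  obtain C where C: "0 \<le> C"
    "\<And>j a. (\<integral>\<^sup>+w. liminf (\<lambda>n. ennreal ((esum 1 \<mu> \<sigma> (j + n) (a * 2 ^ n) (2 ^ n) w)\<^sup>2)) \<partial>M) \<le> ennreal (C * (1 / rt24) ^ (32 * j))"
    "\<And>j a. (\<integral>\<^sup>+w. liminf (\<lambda>n. ennreal ((esum 0 \<mu> \<sigma> n (a * 2 ^ n) (2 ^ j * 2 ^ n) w)\<^sup>2)) \<partial>M) \<le> ennreal (C * rt24 ^ (32 * j))"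
    by (rule liminf_esum_moment[OF \<mu>, of \<sigma>]) (rule that)
  define A where "A j i w = liminf (\<lambda>n. ennreal ((esum 0 \<mu> \<sigma> n (i * 2 ^ j * 2 ^ n) (2 ^ j * 2 ^ n) w)\<^sup>2))" for j i w
  have "AE w in M. \<exists>K\<ge>0. \<forall>r j i. i < 2 ^ r \<longrightarrow> A j i w \<le> ennreal (K / (1 / rt24 ^ (44 * (r + j))))"
  proof (rule AE_weighted_bound)
    fix r j i
    show "A j i \<in> borel_measurable M" unfolding A_def by measurable
    show "(\<integral>\<^sup>+w. A j i w \<partial>M) \<le> ennreal (C * rt24 ^ (32 * j))" unfolding A_def by (rule C(3))
    have "rt24 ^ (44 * (r + j)) = rt24 ^ (24 * r) * rt24 ^ (20 * r) * (rt24 ^ (32 * j) * rt24 ^ (12 * j))"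
      by (simp flip: power_add)
    then show "real (2 ^ r) * (C * rt24 ^ (32 * j)) * (1 / rt24 ^ (44 * (r + j))) \<le> (1 / rt24 ^ 20) ^ r * (C * (1 / rt24 ^ 12) ^ j)"
      using rt24_gt_1 by (simp add: power_2_rt24 power_divide power_mult[symmetric])
    show "summable (\<lambda>j. C * (1 / rt24 ^ 12) ^ j)"
      using rt24_gt_1 by (intro summable_mult summable_geometric) (auto simp: one_less_power)
    show "summable (\<lambda>r. (1 / rt24 ^ 20) ^ r)"
      using rt24_gt_1 by (intro summable_geometric) (auto simp: one_less_power)
  qed (use rt24_gt_1 C(1) in auto)
  then show ?thesis
  proof eventually_elim
    case (elim w)
    then obtain K where K: "0 \<le> K" "\<And>r j i. i < 2 ^ r \<Longrightarrow> A j i w \<le> ennreal (K / (1 / rt24 ^ (44 * (r + j))))" by blast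
    have "K / (1 / rt24 ^ (44 * (r + j))) = (sqrt K * rt24 ^ (22 * (r + j)))\<^sup>2" for r j
    proof -
      have "(rt24 ^ (22 * (r + j)))\<^sup>2 = rt24 ^ (44 * (r + j))" by (simp only: power_mult[symmetric]) simp
      then show ?thesis using K(1) by (simp add: power_mult_distrib)
    qed
    with K(2) have "\<forall>r j i. i < 2 ^ r \<longrightarrow> A j i w \<le> ennreal ((sqrt K * rt24 ^ (22 * (r + j)))\<^sup>2)"
      by (simp only:) simp
    then show ?case unfolding A_def using K(1) by (intro exI[of _ "sqrt K"]) simp
  qed
qed

lemma fbm_coordinates: "fbm_coordinate \<beta>" "fbm_coordinate \<gamma>"
  unfolding fbm_coordinate_def by (simp_all add: \<beta>_V \<gamma>_V \<beta>_cov \<gamma>_cov)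

text \<open>Integer times are reached by chaining over dyadic blocks from 0, the rest by chaining
  inside a unit interval. Both rates stay below 1: \<open>23/24\<close> and
  \<open>5/8\<close>.\<close>

lemma good_path_sublinear:
  fixes \<mu> \<sigma> :: real
  assumes \<mu>: "0 < \<mu>"
  shows "AE w in M. \<forall>x N. good_path \<mu> \<sigma> (\<lambda>t. \<beta> t w) (\<lambda>t. \<gamma> t w) x N \<longrightarrow> ((\<lambda>t. N t / t) \<longlongrightarrow> 0) at_top"
  using ou_growth[OF fbm_coordinates(1), of \<mu> \<sigma>] increments_bound[OF fbm_coordinates(2)]
    local_area_bound[OF \<mu>, of \<sigma>] global_area_bound[OF \<mu>, of \<sigma>]
proof eventually_elim
  case (elim w)
  define p where "p = 1 / rt24"
  have p: "0 \<le> p" "p < 1" using rt24_gt_1 by (auto simp: p_def)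
  obtain C\<gamma> where C\<gamma>: "0 \<le> C\<gamma>" "\<And>k j i. i < 2 ^ j \<Longrightarrow>
    \<bar>\<gamma> (real (k * 2 ^ j + Suc i) / 2 ^ j) w - \<gamma> (real (k * 2 ^ j + i) / 2 ^ j) w\<bar> \<le> C\<gamma> * (real k + 1) powr (5/16) * p ^ j"
    using elim(2) unfolding p_def by blast
  obtain CA where CA: "0 \<le> CA" "\<And>k j i. i < 2 ^ j \<Longrightarrow>
    liminf (\<lambda>n. ennreal ((esum 1 \<mu> \<sigma> (j + n) ((k * 2 ^ j + i) * 2 ^ n) (2 ^ n) w)\<^sup>2))
      \<le> ennreal ((CA * (real k + 1) powr (5/8) * p ^ j)\<^sup>2)"
    using elim(3) unfolding p_def by blast
  obtain CG where CG: "0 \<le> CG" "\<And>r j i. i < 2 ^ r \<Longrightarrow>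
    liminf (\<lambda>n. ennreal ((esum 0 \<mu> \<sigma> n (i * 2 ^ j * 2 ^ n) (2 ^ j * 2 ^ n) w)\<^sup>2))
      \<le> ennreal ((CG * rt24 ^ (22 * (r + j)))\<^sup>2)"
    using elim(4) by blast
  show ?case
  proof (intro allI impI)
    fix x N assume good: "good_path \<mu> \<sigma> (\<lambda>t. \<beta> t w) (\<lambda>t. \<gamma> t w) x N"
    have N0: "N 0 = 0" and Nlim: "\<And>t s. (\<And>n. 0 < s n \<and> s n \<le> t) \<Longrightarrow> s \<longlonglongrightarrow> t \<Longrightarrow> (\<lambda>n. N (s n)) \<longlonglongrightarrow> N t"
      using good unfolding good_path_def by blast+
    have "continuous_on {0..} (\<lambda>t. \<beta> t w) \<and> ou_path \<mu> \<sigma> x (\<lambda>t. \<beta> t w)"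
      using good unfolding good_path_def by simp
    from elim(1)[THEN spec, THEN mp, OF this]
    obtain Cx where Cx: "0 \<le> Cx" "\<And>t. 0 \<le> t \<Longrightarrow> \<bar>x t\<bar> \<le> Cx * (t + 1) powr (5/16)"
      by blast
    \<comment> \<open>An increment of \<open>N\<close> is a centred sum plus
      \<open>\<sigma> * x\<close> times an increment of \<gamma>; the growth exponents
      \<open>5/16\<close> of the two factors add up to \<open>5/8\<close>.\<close>
    define K where "K k = \<bar>\<sigma>\<bar> * (CA + Cx * C\<gamma>) * (real k + 2) powr (5/8)" for k
    have K: "0 \<le> K k" for k using CA(1) Cx(1) C\<gamma>(1) by (simp add: K_def)
    \<comment> \<open>Left limits of \<open>N\<close> are available along positive times only, hence
      \<open>k \<ge> 1\<close>.\<close>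
    have loc: "\<bar>N t - N (real k)\<bar> \<le> K k / (1 - p)"
      if k: "1 \<le> k" and t: "real k \<le> t" "t \<le> real (Suc k)" for k t
    proof (rule unit_interval_chaining[OF p K _ _ t])
      fix s :: "nat \<Rightarrow> real" assume s: "\<And>n. real k \<le> s n \<and> s n \<le> t" "s \<longlonglongrightarrow> t"
      have "0 < s n" for n using s(1)[of n] k by linarith
      then show "(\<lambda>n. N (s n)) \<longlonglongrightarrow> N t" using s by (intro Nlim) auto
    next
      fix j i :: nat assume i: "i < 2 ^ j"
      let ?a = "k * 2 ^ j + i"
      define \<Delta> where "\<Delta> = \<gamma> (real (?a + 1) / 2 ^ j) w - \<gamma> (real ?a / 2 ^ j) w"
      have "\<bar>N (real (?a + 1) / 2 ^ j) - N (real ?a / 2 ^ j) - 1 * (\<sigma> * x (real ?a / 2 ^ j) * \<Delta>)\<bar>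
          \<le> \<bar>\<sigma>\<bar> * (CA * (real k + 1) powr (5/8) * p ^ j)"
        unfolding \<Delta>_def
        by (rule liminf_square_bound[OF esum_limit[OF good]]) (use CA i p in auto)
      moreover have "\<bar>\<sigma> * x (real ?a / 2 ^ j) * \<Delta>\<bar> \<le> \<bar>\<sigma>\<bar> * (Cx * (real k + 2) powr (5/16)) * (C\<gamma> * (real k + 2) powr (5/16) * p ^ j)"
        unfolding abs_mult
      proof (intro mult_mono order_refl)
        have "real ?a \<le> real ((k + 1) * 2 ^ j)" using i by (intro of_nat_mono) simp
        also have "\<dots> = (real k + 1) * 2 ^ j" by (simp add: algebra_simps)
        finally have "real ?a / 2 ^ j \<le> real k + 1" by (simp add: pos_divide_le_eq)
        then show "\<bar>x (real ?a / 2 ^ j)\<bar> \<le> Cx * (real k + 2) powr (5/16)"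
          using Cx(1) by (intro order_trans[OF Cx(2)] mult_left_mono powr_mono2) auto
        have "\<bar>\<Delta>\<bar> \<le> C\<gamma> * (real k + 1) powr (5/16) * p ^ j" unfolding \<Delta>_def using C\<gamma>(2)[OF i, of k] by simp
        also have "\<dots> \<le> C\<gamma> * (real k + 2) powr (5/16) * p ^ j"
          using C\<gamma>(1) p by (intro mult_right_mono mult_left_mono powr_mono2) auto
        finally show "\<bar>\<Delta>\<bar> \<le> C\<gamma> * (real k + 2) powr (5/16) * p ^ j" .
      qed (use Cx(1) C\<gamma>(1) in auto)
      moreover have "\<bar>\<sigma>\<bar> * (CA * (real k + 1) powr (5/8) * p ^ j) \<le> \<bar>\<sigma>\<bar> * (CA * (real k + 2) powr (5/8) * p ^ j)"
        using CA(1) p by (intro mult_right_mono mult_left_mono powr_mono2) auto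
      moreover have "\<bar>\<sigma>\<bar> * (Cx * (real k + 2) powr (5/16)) * (C\<gamma> * (real k + 2) powr (5/16) * p ^ j)
          = \<bar>\<sigma>\<bar> * (Cx * C\<gamma>) * (real k + 2) powr (5/8) * p ^ j"
      proof -
        have "(real k + 2) powr (5/8) = (real k + 2) powr (5/16) * (real k + 2) powr (5/16)" by (simp flip: powr_add)
        then show ?thesis by simp
      qed
      moreover have "K k * p ^ j = \<bar>\<sigma>\<bar> * (CA * (real k + 2) powr (5/8) * p ^ j) + \<bar>\<sigma>\<bar> * (Cx * C\<gamma>) * (real k + 2) powr (5/8) * p ^ j"
        by (simp add: K_def algebra_simps)
      ultimately have "\<bar>N (real (?a + 1) / 2 ^ j) - N (real ?a / 2 ^ j)\<bar> \<le> K k * p ^ j"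
        by linarith
      then show "\<bar>N (real (k * 2 ^ j + Suc i) / 2 ^ j) - N (real (k * 2 ^ j + i) / 2 ^ j)\<bar> \<le> K k * p ^ j"
        by simp
    qed
    \<comment> \<open>The \<open>m + 1\<close> levels of the chaining are absorbed into one further
      power \<open>rt24 ^ m\<close> by Bernoulli's inequality, at the cost of the denominator; this
      raises \<open>22/24\<close> to \<open>23/24\<close>.\<close>
    define CN where "CN = \<bar>\<sigma>\<bar> * CG / (rt24 - 1)"
    have rt1: "rt24 \<le> 2" using self_le_power[of rt24 24] rt24_gt_1 by (simp add: rt24_power)
    have glob2: "\<bar>N (real k)\<bar> \<le> CN * (2 ^ m) powr (23/24)" if k: "k \<le> 2 ^ m" for k m
    proof -
      have "\<bar>N (real k) - N (real 0)\<bar> \<le> (\<Sum>j\<le>m. \<bar>\<sigma>\<bar> * (CG * rt24 ^ (22 * m)))"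
      proof (rule dyadic_chaining[OF _ k])
        fix j i :: nat assume j: "j \<le> m" and i: "i < 2 ^ (m - j)"
        have "\<bar>N (real (i * 2 ^ j + 2 ^ j) / 2 ^ 0) - N (real (i * 2 ^ j) / 2 ^ 0) - 0 * (\<sigma> * x (real (i * 2 ^ j) / 2 ^ 0) * (\<gamma> (real (i * 2 ^ j + 2 ^ j) / 2 ^ 0) w - \<gamma> (real (i * 2 ^ j) / 2 ^ 0) w))\<bar>
            \<le> \<bar>\<sigma>\<bar> * (CG * rt24 ^ (22 * ((m - j) + j)))"
          by (rule liminf_square_bound[OF esum_limit[OF good]]) (use CG(1) CG(2)[OF i, of j] rt24_gt_1 in auto)
        then show "\<bar>N (real (Suc i * 2 ^ j)) - N (real (i * 2 ^ j))\<bar> \<le> \<bar>\<sigma>\<bar> * (CG * rt24 ^ (22 * m))"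
          using j by (simp add: algebra_simps)
      qed
      then have "\<bar>N (real k)\<bar> \<le> (real m + 1) * (\<bar>\<sigma>\<bar> * (CG * rt24 ^ (22 * m)))" using N0 by (simp add: algebra_simps)
      also have "\<dots> \<le> (rt24 ^ m / (rt24 - 1)) * (\<bar>\<sigma>\<bar> * (CG * rt24 ^ (22 * m)))"
      proof (rule mult_right_mono)
        have "1 + real m * (rt24 - 1) \<le> (1 + (rt24 - 1)) ^ m"
          using rt24_gt_1 by (intro Bernoulli_inequality) simp
        then have "(real m + 1) * (rt24 - 1) \<le> rt24 ^ m" using rt1 by (simp add: algebra_simps)
        then show "real m + 1 \<le> rt24 ^ m / (rt24 - 1)" using rt24_gt_1 by (simp add: pos_le_divide_eq)
      qed (use CG(1) rt24_gt_1 in auto)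
      also have "\<dots> = CN * (rt24 ^ m * rt24 ^ (22 * m))" by (simp add: CN_def)
      also have "rt24 ^ m * rt24 ^ (22 * m) = (2 ^ m) powr (23/24)"
        by (simp add: rt24_def powr_realpow[symmetric] powr_powr powr_add[symmetric] add_divide_distrib[symmetric] mult.commute)
      finally show ?thesis .
    qed
    have CN: "0 \<le> CN" using CG(1) rt24_gt_1 by (simp add: CN_def)
    have glob: "\<bar>N (real k)\<bar> \<le> CN * (2 * real k) powr (23/24)" if k: "1 \<le> k" for k
    proof -
      define m where "m = (LEAST m. k \<le> 2 ^ m)"
      have km: "k \<le> 2 ^ m" unfolding m_def by (rule LeastI[of _ k]) (simp add: less_imp_le)
      have "2 ^ m \<le> 2 * k"
      proof (cases m)
        case (Suc l)
        then have "\<not> k \<le> 2 ^ l" using not_less_Least[of l "\<lambda>m. k \<le> 2 ^ m"] unfolding m_def[symmetric] by simp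
        then show ?thesis using Suc by simp
      qed (use k in simp)
      then have "real (2 ^ m) \<le> real (2 * k)" by (intro of_nat_mono)
      then have "(2 ^ m) powr (23/24) \<le> (2 * real k) powr (23/24)" by (intro powr_mono2) auto
      then show ?thesis using glob2[OF km] CN by (meson mult_left_mono order_trans)
    qed
    \<comment> \<open>The bases 2 and 3 come from \<open>2 ^ m \<le> 2 * k\<close> and
      \<open>k + 2 \<le> 3 * t\<close>.\<close>
    define CT where "CT = CN * 2 powr (23/24) + \<bar>\<sigma>\<bar> * (CA + Cx * C\<gamma>) * 3 powr (5/8) / (1 - p)"
    have Nb: "\<bar>N t\<bar> \<le> CT * t powr (23/24)" if t: "1 \<le> t" for t
    proof -
      define k where "k = nat \<lfloor>t\<rfloor>"
      have k: "1 \<le> k" "real k \<le> t" "t \<le> real (Suc k)" using t by (auto simp: k_def le_nat_iff) linarith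
      have "\<bar>N t\<bar> \<le> \<bar>N (real k)\<bar> + \<bar>N t - N (real k)\<bar>" by linarith
      also have "\<bar>N (real k)\<bar> \<le> CN * (2 * t) powr (23/24)"
        using k CN by (intro order_trans[OF glob] mult_left_mono powr_mono2) auto
      also have "(2 * t) powr (23/24) = 2 powr (23/24) * t powr (23/24)" using t by (simp add: powr_mult)
      also have "\<bar>N t - N (real k)\<bar> \<le> (\<bar>\<sigma>\<bar> * (CA + Cx * C\<gamma>) * (3 powr (5/8) * t powr (23/24))) / (1 - p)"
      proof (rule order_trans[OF loc[OF k]], rule divide_right_mono)
        have "(real k + 2) powr (5/8) \<le> (3 * t) powr (5/8)" using k t by (intro powr_mono2) auto
        also have "\<dots> = 3 powr (5/8) * t powr (5/8)" using t by (simp add: powr_mult)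
        also have "\<dots> \<le> 3 powr (5/8) * t powr (23/24)" using t by (intro mult_left_mono powr_mono) auto
        finally show "K k \<le> \<bar>\<sigma>\<bar> * (CA + Cx * C\<gamma>) * (3 powr (5/8) * t powr (23/24))"
          unfolding K_def using CA(1) Cx(1) C\<gamma>(1) by (intro mult_left_mono) auto
      qed (use p in auto)
      finally show ?thesis by (simp add: CT_def algebra_simps)
    qed
    show "((\<lambda>t. N t / t) \<longlongrightarrow> 0) at_top" by (rule sublinear_tendsto_0[OF _ Nb]) simp_all
  qed
qed

end

subsection \<open>The long time limit\<close>

lemma dyadic_left_approximation:
  fixes t :: real
  assumes "0 < t"
  shows "\<exists>s :: nat \<Rightarrow> real. (\<forall>n. 0 < s n \<and> s n \<le> t \<and> (\<exists>a j. 0 < a \<and> s n = real a / 2 ^ j)) \<and> s \<longlonglongrightarrow> t"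
proof -
  \<comment> \<open>Starting at a level finer than \<open>t\<close> keeps all approximations
    positive.\<close>
  obtain n0 where n0: "(1/2) ^ n0 < t" using real_arch_pow_inv[of t "1/2"] assms by auto
  define s :: "nat \<Rightarrow> real" where "s n = of_int \<lfloor>t * 2 ^ (n + n0)\<rfloor> / 2 ^ (n + n0)" for n
  have one: "1 \<le> \<lfloor>t * 2 ^ (n + n0)\<rfloor>" for n
  proof -
    have "1 = (1/2 :: real) ^ (n + n0) * 2 ^ (n + n0)" by (simp only: power_mult_distrib[symmetric]) simp
    also have "\<dots> \<le> (1/2) ^ n0 * 2 ^ (n + n0)" by (intro mult_right_mono power_decreasing) auto
    also have "\<dots> \<le> t * 2 ^ (n + n0)" using n0 by (intro mult_right_mono) auto
    finally show ?thesis by (simp only: one_le_floor)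
  qed
  have le: "s n \<le> t" for n
    using of_int_floor_le[of "t * 2 ^ (n + n0)"] by (simp add: s_def pos_divide_le_eq)
  have ge: "t - (1/2) ^ (n + n0) \<le> s n" for n
  proof -
    have "(t * 2 ^ (n + n0) - 1) / 2 ^ (n + n0) \<le> s n"
      unfolding s_def by (rule divide_right_mono) (linarith, simp)
    moreover have "(t * 2 ^ (n + n0) - 1) / 2 ^ (n + n0) = t - (1/2) ^ (n + n0)"
      by (simp only: diff_divide_distrib power_one_over) simp
    ultimately show ?thesis by simp
  qed
  have lim: "(\<lambda>n. t - (1/2) ^ (n + n0)) \<longlonglongrightarrow> t - 0"
    by (intro tendsto_diff tendsto_const LIMSEQ_ignore_initial_segment LIMSEQ_power_zero) simp
  have "s \<longlonglongrightarrow> t"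
    by (rule tendsto_sandwich[OF _ _ lim[unfolded diff_0_right] tendsto_const])
      (intro always_eventually allI ge le)+
  moreover have "0 < s n" for n using one[of n] by (simp add: s_def)
  moreover have "s n = real (nat \<lfloor>t * 2 ^ (n + n0)\<rfloor>) / 2 ^ (n + n0)" "0 < nat \<lfloor>t * 2 ^ (n + n0)\<rfloor>" for n
    using one[of n] by (simp_all add: s_def)
  ultimately show ?thesis using le by blast
qed

text \<open>The mean of the end values of \<open>x\<close> is uniformly close to \<open>x\<close> on
  a short cell, so the error per cell is o(step).\<close>

lemma trapezoid_integral_limit:
  fixes x y :: "real \<Rightarrow> real"
  assumes cx: "continuous_on {0..} x" and cy: "continuous_on {0..} y"
  shows "(\<lambda>n. \<Sum>k<a * 2 ^ n. (1/2) * (x (real k / 2 ^ (j + n)) + x (real (Suc k) / 2 ^ (j + n))) *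
      integral {real k / 2 ^ (j + n)..real (Suc k) / 2 ^ (j + n)} y)
    \<longlonglongrightarrow> integral {0..real a / 2 ^ j} (\<lambda>s. x s * y s)"
proof -
  define T where "T = real a / 2 ^ j"
  define D where "D n k = real k / 2 ^ (j + n)" for n k
  have D0: "0 \<le> D n k" for n k by (simp add: D_def)
  have step: "D n (Suc k) - D n k = 1 / 2 ^ (j + n)" for n k by (simp add: D_def diff_divide_distrib[symmetric])
  have mono: "D n k \<le> D n (Suc k)" for n k by (simp add: D_def divide_right_mono)
  have cont: "continuous_on {D n k..r} x" "continuous_on {D n k..r} y" for n k r
    using D0[of n k] by (auto intro: continuous_on_subset[OF cx] continuous_on_subset[OF cy])
  obtain G where G: "0 < G" "\<And>t. 0 \<le> t \<Longrightarrow> t \<le> T \<Longrightarrow> \<bar>y t\<bar> \<le> G"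
    using compact_imp_bounded[OF compact_continuous_image[OF _ compact_Icc, of 0 T y]] continuous_on_subset[OF cy, of "{0..T}"]
    unfolding bounded_pos by auto
  have split: "integral {0..D n N} (\<lambda>s. x s * y s) = (\<Sum>k<N. integral {D n k..D n (Suc k)} (\<lambda>s. x s * y s))" for n N
  proof (induction N)
    case (Suc N)
    have "(\<lambda>s. x s * y s) integrable_on {0..D n (Suc N)}"
      using cont[of n 0 "D n (Suc N)"] by (intro integrable_continuous_interval continuous_intros) (auto simp: D_def)
    then have "integral {0..D n N} (\<lambda>s. x s * y s) + integral {D n N..D n (Suc N)} (\<lambda>s. x s * y s) = integral {0..D n (Suc N)} (\<lambda>s. x s * y s)"
      by (intro Henstock_Kurzweil_Integration.integral_combine D0 mono)
    then show ?case using Suc by simp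
  qed (simp add: D_def)
  have DT: "D n (a * 2 ^ n) = T" for n by (simp add: D_def T_def power_add)
  define e where "e n k = (1/2) * (x (D n k) + x (D n (Suc k))) * integral {D n k..D n (Suc k)} y - integral {D n k..D n (Suc k)} (\<lambda>s. x s * y s)" for n k
  have "(\<lambda>n. \<Sum>k<a * 2 ^ n. e n k) \<longlonglongrightarrow> 0"
  proof (rule dyadic_sum_tendsto_0[where j = j])
    fix \<epsilon> :: real assume \<epsilon>: "\<epsilon> > 0"
    define \<eta> where "\<eta> = \<epsilon> / G"
    have \<eta>: "\<eta> > 0" using \<epsilon> G(1) by (simp add: \<eta>_def)
    have cxT: "continuous_on {0..T} x" by (rule continuous_on_subset[OF cx]) auto
    from uniformly_close_dyadic[OF cxT \<eta>, of j]
    show "\<forall>\<^sub>F n in sequentially. \<forall>k<a * 2 ^ n. \<bar>e n k\<bar> \<le> \<epsilon> / 2 ^ (j + n)"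
    proof eventually_elim
      case (elim n)
      show ?case
      proof (intro allI impI)
        fix k assume k: "k < a * 2 ^ n"
        have "D n (Suc k) \<le> D n (a * 2 ^ n)" using k unfolding D_def by (intro divide_right_mono of_nat_mono) auto
        then have kT: "D n (Suc k) \<le> T" by (simp add: DT)
        let ?c = "(1/2) * (x (D n k) + x (D n (Suc k)))"
        have osc: "\<bar>?c - x s\<bar> \<le> \<eta>" if s: "D n k \<le> s" "s \<le> D n (Suc k)" for s
        proof -
          have "\<bar>x s - x (D n k)\<bar> < \<eta>"
            using elim[rule_format, of "D n k" s] s kT D0[of n k] step[of n k] by (simp add: dist_real_def)
          moreover have "\<bar>x (D n (Suc k)) - x s\<bar> < \<eta>"
            using elim[rule_format, of s "D n (Suc k)"] s kT D0[of n k] step[of n k] by (simp add: dist_real_def)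
          ultimately have bound: "\<bar>(x (D n k) - x s) + (x (D n (Suc k)) - x s)\<bar> \<le> 2 * \<eta>" by linarith
          have eq: "?c - x s = ((x (D n k) - x s) + (x (D n (Suc k)) - x s)) / 2" by (simp add: field_simps)
          show ?thesis unfolding eq abs_divide using bound by simp
        qed
        have "e n k = integral {D n k..D n (Suc k)} (\<lambda>s. ?c * y s) - integral {D n k..D n (Suc k)} (\<lambda>s. x s * y s)"
          by (simp add: e_def)
        also have "\<dots> = integral {D n k..D n (Suc k)} (\<lambda>s. ?c * y s - x s * y s)"
          by (intro Henstock_Kurzweil_Integration.integral_diff[symmetric] integrable_continuous_interval continuous_intros cont)
        finally have "norm (e n k) = norm (integral {D n k..D n (Suc k)} (\<lambda>s. ?c * y s - x s * y s))" by simp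
        also have "\<dots> \<le> (\<eta> * G) * (D n (Suc k) - D n k)"
        proof (intro integral_bound mono continuous_intros cont ballI)
          fix s assume s: "s \<in> {D n k..D n (Suc k)}"
          have "\<bar>?c * y s - x s * y s\<bar> = \<bar>?c - x s\<bar> * \<bar>y s\<bar>" by (simp only: left_diff_distrib[symmetric] abs_mult)
          also have "\<dots> \<le> \<eta> * G"
            using osc[of s] G(2)[of s] s kT D0[of n k] \<eta> by (intro mult_mono) auto
          finally show "norm (?c * y s - x s * y s) \<le> \<eta> * G" by simp
        qed
        also have "\<dots> = \<epsilon> / 2 ^ (j + n)" unfolding step using G(1) by (simp add: \<eta>_def)
        finally show "\<bar>e n k\<bar> \<le> \<epsilon> / 2 ^ (j + n)" by simp
      qed
    qed
  qed
  then have "(\<lambda>n. (\<Sum>k<a * 2 ^ n. e n k) + integral {0..T} (\<lambda>s. x s * y s)) \<longlonglongrightarrow> 0 + integral {0..T} (\<lambda>s. x s * y s)"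
    by (intro tendsto_add tendsto_const)
  moreover have "(\<Sum>k<a * 2 ^ n. e n k) + integral {0..T} (\<lambda>s. x s * y s) =
      (\<Sum>k<a * 2 ^ n. (1/2) * (x (D n k) + x (D n (Suc k))) * integral {D n k..D n (Suc k)} y)" for n
    using split[of n "a * 2 ^ n"] unfolding DT e_def sum_subtractf by simp
  ultimately show ?thesis by (simp add: D_def T_def)
qed

section \<open>Eigencoordinates of the lift for a fixed outcome\<close>

locale stratonovich_path =
  fixes p \<sigma> :: real and \<Gamma> :: "real ^ 'd ^ 'd" and b x :: "real \<Rightarrow> real ^ 'd"
    and bb xx :: "real \<Rightarrow> real \<Rightarrow> real ^ 'd ^ 'd"
  assumes p: "0 < p" and can: "canonical_lift p b bb" and strat: "stratonovich_lift p \<Gamma> \<sigma> b bb x xx"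
    and cb: "continuous_on {0..} b" and cx: "continuous_on {0..} x" and x0: "x 0 = 0"
    and ode: "0 \<le> t \<Longrightarrow> x t - x 0 = - integral {0..t} (\<lambda>s. \<Gamma> *v x s) + \<sigma> *\<^sub>R (b t - b 0)"
    and sym: "transpose \<Gamma> = \<Gamma>"
begin

text \<open>The Stratonovich integral of \<open>u \<bullet> x\<close> against
  \<open>v \<bullet> x\<close> from 0 to a positive \<open>t\<close>, as \<open>x 0 = 0\<close>;
  both its symmetric and antisymmetric parts are meant.\<close>

definition area :: "real ^ 'd \<Rightarrow> real ^ 'd \<Rightarrow> real \<Rightarrow> real" where
  "area u v t = u \<bullet> (xx 0 t *v v)"

lemma cont_component: "continuous_on {0..} (\<lambda>t. u \<bullet> x t)" "continuous_on {0..} (\<lambda>t. u \<bullet> b t)"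
  by (intro continuous_intros cx cb)+

text \<open>By symmetry of \<Gamma> an eigenvector decouples the drift, and its coordinate solves a
  scalar equation.\<close>

lemma component_increment:
  assumes u: "\<Gamma> *v u = \<mu> *\<^sub>R u" and st: "0 \<le> s" "s \<le> t"
  shows "u \<bullet> x t - u \<bullet> x s = - \<mu> * integral {s..t} (\<lambda>r. u \<bullet> x r) + \<sigma> * (u \<bullet> b t - u \<bullet> b s)"
proof -
  have "continuous_on {s..t} x" by (rule continuous_on_subset[OF cx]) (use st in auto)
  then have int: "(\<lambda>r. \<Gamma> *v x r) integrable_on {s..t}"
    by (intro integrable_continuous_interval bounded_linear.continuous_on[OF matrix_vector_mul_bounded_linear])
  have ur: "u \<bullet> (\<Gamma> *v z) = \<mu> * (u \<bullet> z)" for z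
    using dot_lmul_matrix[of u \<Gamma> z] sym u by (simp add: transpose_matrix_vector[symmetric])
  have "u \<bullet> integral {s..t} (\<lambda>r. \<Gamma> *v x r) = integral {s..t} (\<lambda>r. u \<bullet> (\<Gamma> *v x r))"
    using integral_linear[OF int bounded_linear_inner_right[of u]] by (simp add: comp_def)
  also have "\<dots> = \<mu> * integral {s..t} (\<lambda>r. u \<bullet> x r)" by (simp add: ur)
  finally show ?thesis
    using arg_cong[OF ou_increment[OF cx ode st], of "\<lambda>z. u \<bullet> z"]
    by (simp add: inner_diff_right inner_add_right)
qed

lemma area_dyadic:
  assumes "0 < a"
  shows "(\<lambda>n. \<Sum>k<a * 2 ^ n. (1/2) * (u \<bullet> x (real k / 2 ^ (j + n)) + u \<bullet> x (real (Suc k) / 2 ^ (j + n))) *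
      (v \<bullet> x (real (Suc k) / 2 ^ (j + n)) - v \<bullet> x (real k / 2 ^ (j + n)))) \<longlonglongrightarrow> area u v (real a / 2 ^ j)"
proof -
  have bl: "bounded_linear (\<lambda>m :: real ^ 'd ^ 'd. u \<bullet> (m *v v))"
    by (intro linear_conv_bounded_linear[THEN iffD1] linearI)
      (simp_all add: matrix_vector_mult_add_rdistrib inner_add_right scaleR_matrix_vector_assoc[symmetric])
  have t: "u \<bullet> ((y \<otimes>\<^sub>t z) *v v) = (u \<bullet> y) * (v \<bullet> z)" for y z
    by (simp add: tensor_def matrix_vector_mult_def inner_vec_def sum_product sum_distrib_left mult_ac) (rule sum.swap)
  show ?thesis
    using bounded_linear.tendsto[OF bl stratonovich_lift_trapezoid_limit[OF strat can p cx x0 ode assms, of j]]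
    unfolding linear_sum[OF bounded_linear.linear[OF bl]] t area_def[symmetric]
    by (simp add: inner_add_right inner_diff_right del: of_nat_Suc)
qed

lemma area_left_limit:
  assumes "\<And>n. 0 < s n" "\<And>n. s n \<le> t" "s \<longlonglongrightarrow> t"
  shows "(\<lambda>n. area u v (s n)) \<longlonglongrightarrow> area u v t"
proof -
  have "0 < t" using assms(1,2) less_le_trans by blast
  then have "(\<lambda>n. xx 0 (s n)) \<longlonglongrightarrow> xx 0 t"
    by (intro rough_path_left_limit[OF stratonovich_lift_rough_path[OF strat] p order_refl] assms)
  moreover have bl: "bounded_linear (\<lambda>m :: real ^ 'd ^ 'd. u \<bullet> (m *v v))"
    by (intro linear_conv_bounded_linear[THEN iffD1] linearI)
      (simp_all add: matrix_vector_mult_add_rdistrib inner_add_right scaleR_matrix_vector_assoc[symmetric])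
  ultimately show ?thesis unfolding area_def by (intro bounded_linear.tendsto[OF bl])
qed

lemma component_left_limit:
  assumes "\<And>n. 0 < s n" "\<And>n. s n \<le> t" "s \<longlonglongrightarrow> t"
  shows "(\<lambda>n. u \<bullet> x (s n)) \<longlonglongrightarrow> u \<bullet> x t"
  by (rule continuous_on_tendsto_compose[OF cont_component(1) assms(3)])
    (use assms less_imp_le order_trans in \<open>auto intro!: always_eventually less_imp_le[OF less_le_trans[OF assms(1) assms(2)]]\<close>)

text \<open>The lift is geometric: symmetrised trapezoidal terms are exact increments of the product
  and telescope. Left limits extend this from dyadic times.\<close>

lemma area_symmetric_part:
  assumes t: "0 < t"
  shows "area u v t + area v u t = (u \<bullet> x t) * (v \<bullet> x t)"
proof -
  have dyadic: "area u v s + area v u s = (u \<bullet> x s) * (v \<bullet> x s)" if s: "0 < a" "s = real a / 2 ^ j" for a j s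
  proof -
    let ?X = "\<lambda>n k. u \<bullet> x (real k / 2 ^ (j + n))" and ?Y = "\<lambda>n k. v \<bullet> x (real k / 2 ^ (j + n))"
    have "(\<lambda>n. (\<Sum>k<a * 2 ^ n. (1/2) * (?X n k + ?X n (Suc k)) * (?Y n (Suc k) - ?Y n k))
        + (\<Sum>k<a * 2 ^ n. (1/2) * (?Y n k + ?Y n (Suc k)) * (?X n (Suc k) - ?X n k))) \<longlonglongrightarrow> area u v s + area v u s"
      unfolding s(2) by (intro tendsto_add area_dyadic s(1))
    moreover have "(\<Sum>k<a * 2 ^ n. (1/2) * (?X n k + ?X n (Suc k)) * (?Y n (Suc k) - ?Y n k))
        + (\<Sum>k<a * 2 ^ n. (1/2) * (?Y n k + ?Y n (Suc k)) * (?X n (Suc k) - ?X n k)) = (u \<bullet> x s) * (v \<bullet> x s)" for n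
    proof -
      have "(\<Sum>k<a * 2 ^ n. (1/2) * (?X n k + ?X n (Suc k)) * (?Y n (Suc k) - ?Y n k))
        + (\<Sum>k<a * 2 ^ n. (1/2) * (?Y n k + ?Y n (Suc k)) * (?X n (Suc k) - ?X n k)) =
        (\<Sum>k<a * 2 ^ n. ?X n (Suc k) * ?Y n (Suc k) - ?X n k * ?Y n k)"
        unfolding sum.distrib[symmetric] by (intro sum.cong refl) (simp add: field_simps)
      also have "\<dots> = (u \<bullet> x s) * (v \<bullet> x s)"
        using sum_lessThan_telescope[of "\<lambda>k. ?X n k * ?Y n k" "a * 2 ^ n"] x0 by (simp add: s(2) power_add)
      finally show ?thesis .
    qed
    ultimately have "(\<lambda>n::nat. (u \<bullet> x s) * (v \<bullet> x s)) \<longlonglongrightarrow> area u v s + area v u s" by (simp only:)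
    then show ?thesis by (simp only: LIMSEQ_const_iff)
  qed
  obtain s where s: "\<And>n. 0 < s n" "\<And>n. s n \<le> t" "s \<longlonglongrightarrow> t" and sd: "\<And>n. \<exists>a j. 0 < a \<and> s n = real a / 2 ^ j"
    using dyadic_left_approximation[OF t] by blast
  have "area u v (s n) + area v u (s n) = (u \<bullet> x (s n)) * (v \<bullet> x (s n))" for n
    using sd[of n] dyadic by blast
  moreover have "(\<lambda>n. area u v (s n) + area v u (s n)) \<longlonglongrightarrow> area u v t + area v u t"
    by (intro tendsto_add area_left_limit s)
  ultimately have "(\<lambda>n. (u \<bullet> x (s n)) * (v \<bullet> x (s n))) \<longlonglongrightarrow> area u v t + area v u t" by (simp only:)
  moreover have "(\<lambda>n. (u \<bullet> x (s n)) * (v \<bullet> x (s n))) \<longlonglongrightarrow> (u \<bullet> x t) * (v \<bullet> x t)"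
    by (intro tendsto_mult component_left_limit s)
  ultimately show ?thesis by (rule LIMSEQ_unique)
qed

text \<open>The Stratonovich integral of \<open>u \<bullet> X\<close> against \<open>\<sigma> (v \<bullet> B)\<close>.\<close>

definition noise_integral :: "real \<Rightarrow> real ^ 'd \<Rightarrow> real ^ 'd \<Rightarrow> real \<Rightarrow> real" where
  "noise_integral \<nu> u v t = (if t = 0 then 0 else area u v t + \<nu> * integral {0..t} (\<lambda>s. (u \<bullet> x s) * (v \<bullet> x s)))"

text \<open>Inserting the equation for \<open>v \<bullet> x\<close> into the trapezoidal sums leaves
  the noise increments; the drift is compensated by the time integral in
  \<open>noise_integral\<close>.\<close>

lemma good_path_noise_integral:
  assumes u: "\<Gamma> *v u = \<mu> *\<^sub>R u" "0 < \<mu>" and v: "\<Gamma> *v v = \<nu> *\<^sub>R v"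
  shows "good_path \<mu> \<sigma> (\<lambda>t. u \<bullet> b t) (\<lambda>t. v \<bullet> b t) (\<lambda>t. u \<bullet> x t) (noise_integral \<nu> u v)"
  unfolding good_path_def
proof (intro conjI allI impI)
  show "continuous_on {0..} (\<lambda>t. u \<bullet> b t)" "continuous_on {0..} (\<lambda>t. v \<bullet> b t)"
    by (rule cont_component(2))+
  show "ou_path \<mu> \<sigma> (\<lambda>t. u \<bullet> x t) (\<lambda>t. u \<bullet> b t)"
    by unfold_locales (use u(2) x0 cont_component component_increment[OF u(1)] in auto)
  \<comment> \<open>The value \<open>xx 0 0\<close> is arbitrary, which explains the separate value
    at time 0.\<close>
  show "noise_integral \<nu> u v 0 = 0" by (simp add: noise_integral_def)
next
  fix a j :: nat assume a: "0 < a"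
  define D where "D n k = real k / 2 ^ (j + n)" for n k
  let ?X = "\<lambda>n k. u \<bullet> x (D n k)" and ?Y = "\<lambda>n k. v \<bullet> x (D n k)"
  have "(\<lambda>n. (\<Sum>k<a * 2 ^ n. (1/2) * (?X n k + ?X n (Suc k)) * (?Y n (Suc k) - ?Y n k))
     + \<nu> * (\<Sum>k<a * 2 ^ n. (1/2) * (?X n k + ?X n (Suc k)) * integral {D n k..D n (Suc k)} (\<lambda>s. v \<bullet> x s)))
     \<longlonglongrightarrow> area u v (real a / 2 ^ j) + \<nu> * integral {0..real a / 2 ^ j} (\<lambda>s. (u \<bullet> x s) * (v \<bullet> x s))"
    unfolding D_def by (intro tendsto_add tendsto_mult tendsto_const area_dyadic a trapezoid_integral_limit cont_component)
  moreover have "(\<Sum>k<a * 2 ^ n. (1/2) * (?X n k + ?X n (Suc k)) * (?Y n (Suc k) - ?Y n k))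
     + \<nu> * (\<Sum>k<a * 2 ^ n. (1/2) * (?X n k + ?X n (Suc k)) * integral {D n k..D n (Suc k)} (\<lambda>s. v \<bullet> x s))
     = (\<Sum>k<a * 2 ^ n. \<sigma> * ((1/2) * (?X n k + ?X n (Suc k)) * (v \<bullet> b (D n (Suc k)) - v \<bullet> b (D n k))))" for n
    unfolding sum_distrib_left sum.distrib[symmetric]
  proof (rule sum.cong[OF refl])
    fix k
    have "?Y n (Suc k) - ?Y n k = - \<nu> * integral {D n k..D n (Suc k)} (\<lambda>s. v \<bullet> x s) + \<sigma> * (v \<bullet> b (D n (Suc k)) - v \<bullet> b (D n k))"
      by (rule component_increment[OF v]) (auto simp: D_def divide_right_mono)
    then show "(1/2) * (?X n k + ?X n (Suc k)) * (?Y n (Suc k) - ?Y n k)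
       + \<nu> * ((1/2) * (?X n k + ?X n (Suc k)) * integral {D n k..D n (Suc k)} (\<lambda>s. v \<bullet> x s))
       = \<sigma> * ((1/2) * (?X n k + ?X n (Suc k)) * (v \<bullet> b (D n (Suc k)) - v \<bullet> b (D n k)))"
      by (simp only:) (simp add: field_simps)
  qed
  ultimately show "(\<lambda>n. \<Sum>k<a * 2 ^ n. \<sigma> * ((1/2) * (u \<bullet> x (real k / 2 ^ (j + n)) + u \<bullet> x (real (Suc k) / 2 ^ (j + n))) *
        (v \<bullet> b (real (Suc k) / 2 ^ (j + n)) - v \<bullet> b (real k / 2 ^ (j + n))))) \<longlonglongrightarrow> noise_integral \<nu> u v (real a / 2 ^ j)"
    using a by (simp add: noise_integral_def D_def)
next
  fix t and s :: "nat \<Rightarrow> real" assume s: "\<forall>n. 0 < s n \<and> s n \<le> t" "s \<longlonglongrightarrow> t"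
  have t: "0 < t" using s(1) less_le_trans by blast
  have "continuous_on {0..t} (\<lambda>r. (u \<bullet> x r) * (v \<bullet> x r))"
    by (intro continuous_intros continuous_on_subset[OF cx]) auto
  then have "continuous_on {0..t} (\<lambda>r. integral {0..r} (\<lambda>s. (u \<bullet> x s) * (v \<bullet> x s)))"
    by (intro indefinite_integral_continuous_1 integrable_continuous_interval)
  then have "(\<lambda>n. integral {0..s n} (\<lambda>s. (u \<bullet> x s) * (v \<bullet> x s))) \<longlonglongrightarrow> integral {0..t} (\<lambda>s. (u \<bullet> x s) * (v \<bullet> x s))"
    by (rule continuous_on_tendsto_compose) (use s t in \<open>auto intro!: always_eventually less_imp_le\<close>)
  then have "(\<lambda>n. area u v (s n) + \<nu> * integral {0..s n} (\<lambda>s. (u \<bullet> x s) * (v \<bullet> x s))) \<longlonglongrightarrow>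
      area u v t + \<nu> * integral {0..t} (\<lambda>s. (u \<bullet> x s) * (v \<bullet> x s))"
    using s by (intro tendsto_add tendsto_mult tendsto_const area_left_limit) auto
  moreover have "s n \<noteq> 0" for n using s(1) by (metis less_irrefl)
  ultimately show "(\<lambda>n. noise_integral \<nu> u v (s n)) \<longlonglongrightarrow> noise_integral \<nu> u v t"
    using t by (simp add: noise_integral_def)
qed

text \<open>The two noise integrals contain the same time integral. Their sum minus the product of
  coordinates isolates it, divided by \<open>\<mu> + \<nu> > 0\<close>, and it is then removed from
  the first one.\<close>

lemma area_sublinear:
  assumes u: "0 < \<mu>" and v: "0 < \<nu>"
    and N: "((\<lambda>t. noise_integral \<nu> u v t / t) \<longlongrightarrow> 0) at_top" "((\<lambda>t. noise_integral \<mu> v u t / t) \<longlongrightarrow> 0) at_top"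
    and x: "((\<lambda>t. (u \<bullet> x t)\<^sup>2 / t) \<longlongrightarrow> 0) at_top" "((\<lambda>t. (v \<bullet> x t)\<^sup>2 / t) \<longlongrightarrow> 0) at_top"
  shows "((\<lambda>t. area u v t / t) \<longlongrightarrow> 0) at_top"
proof -
  have xy: "((\<lambda>t. (u \<bullet> x t) * (v \<bullet> x t) / t) \<longlongrightarrow> 0) at_top"
  proof (rule Lim_null_comparison)
    show "\<forall>\<^sub>F t in at_top. norm ((u \<bullet> x t) * (v \<bullet> x t) / t) \<le> (u \<bullet> x t)\<^sup>2 / t + (v \<bullet> x t)\<^sup>2 / t"
      using eventually_gt_at_top[of 0]
    proof eventually_elim
      case (elim t)
      have "2 * \<bar>(u \<bullet> x t) * (v \<bullet> x t)\<bar> \<le> (u \<bullet> x t)\<^sup>2 + (v \<bullet> x t)\<^sup>2"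
        using sum_squares_bound[of "\<bar>u \<bullet> x t\<bar>" "\<bar>v \<bullet> x t\<bar>"] by (simp add: abs_mult mult.assoc)
      then have "\<bar>(u \<bullet> x t) * (v \<bullet> x t)\<bar> \<le> (u \<bullet> x t)\<^sup>2 + (v \<bullet> x t)\<^sup>2" by linarith
      then have "\<bar>(u \<bullet> x t) * (v \<bullet> x t)\<bar> / t \<le> ((u \<bullet> x t)\<^sup>2 + (v \<bullet> x t)\<^sup>2) / t"
        using elim by (intro divide_right_mono) auto
      then show ?case using elim by (simp add: abs_divide add_divide_distrib)
    qed
    show "((\<lambda>t. (u \<bullet> x t)\<^sup>2 / t + (v \<bullet> x t)\<^sup>2 / t) \<longlongrightarrow> 0) at_top"
      using tendsto_add[OF x] by simp
  qed
  have lim: "((\<lambda>t. noise_integral \<nu> u v t / t - (\<nu> / (\<mu> + \<nu>)) * (noise_integral \<nu> u v t / t + noise_integral \<mu> v u t / t - (u \<bullet> x t) * (v \<bullet> x t) / t))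
      \<longlongrightarrow> 0 - (\<nu> / (\<mu> + \<nu>)) * (0 + 0 - 0)) at_top"
    by (intro tendsto_diff tendsto_mult tendsto_add tendsto_const N xy)
  have "\<forall>\<^sub>F t in at_top. noise_integral \<nu> u v t / t - (\<nu> / (\<mu> + \<nu>)) * (noise_integral \<nu> u v t / t + noise_integral \<mu> v u t / t - (u \<bullet> x t) * (v \<bullet> x t) / t)
      = area u v t / t"
    using eventually_gt_at_top[of 0]
  proof eventually_elim
    case (elim t)
    define I where "I = integral {0..t} (\<lambda>s. (u \<bullet> x s) * (v \<bullet> x s))"
    have n1: "noise_integral \<nu> u v t = area u v t + \<nu> * I" using elim by (simp add: noise_integral_def I_def)
    have n2: "noise_integral \<mu> v u t = area v u t + \<mu> * I" using elim by (simp add: noise_integral_def I_def mult.commute)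
    have "noise_integral \<nu> u v t / t + noise_integral \<mu> v u t / t - (u \<bullet> x t) * (v \<bullet> x t) / t = (\<mu> + \<nu>) * I / t"
      unfolding n1 n2 using area_symmetric_part[OF elim, of u v, symmetric]
      by (simp add: add_divide_distrib[symmetric] diff_divide_distrib[symmetric] algebra_simps)
    then show ?case unfolding n1 using u v by (simp add: add_divide_distrib)
  qed
  from Lim_transform_eventually[OF lim this] show ?thesis by simp
qed

end

section \<open>Projections of the driver and conclusion\<close>

lemma fractional_gaussian_space_fbm_span:
  fixes B :: "real \<Rightarrow> 'w \<Rightarrow> real ^ 'd"
  assumes "prob_space M" "1/3 < H" "H \<le> 1/2" "fractional_brownian_motion M H B"
  shows "fractional_gaussian_space M (fbm_span B) H"
  by (intro fractional_gaussian_space.intro fractional_gaussian_space_axioms.intro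
      gaussian_space_fbm_span[OF assms(1,4)] assms(2,3))

lemma fbm_pair_projections:
  fixes B :: "real \<Rightarrow> 'w \<Rightarrow> real ^ 'd"
  assumes M: "prob_space M" and H: "1/3 < H" "H \<le> 1/2" and B: "fractional_brownian_motion M H B"
    and uv: "norm u = 1" "norm v = 1" "u \<bullet> v = 0"
  shows "fbm_pair M (fbm_span B) H (\<lambda>t w. u \<bullet> B t w) (\<lambda>t w. v \<bullet> B t w)"
proof -
  have "u \<bullet> u = 1" "v \<bullet> v = 1" using uv by (simp_all add: norm_eq_1)
  then show ?thesis
    using uv(3) by (intro fbm_pair.intro fbm_pair_axioms.intro fractional_gaussian_space_fbm_span[OF M H B])
      (simp_all add: fbm_covariance[OF M B] fbm_span_inner)
qed

theorem theorem3p13: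
  fixes M :: "'w measure"
    and B X :: "real \<Rightarrow> 'w \<Rightarrow> real ^ 'd"
    and BB XX :: "'w \<Rightarrow> real \<Rightarrow> real \<Rightarrow> real ^ 'd ^ 'd"
    and \<Gamma> :: "real ^ 'd ^ 'd"
    and \<sigma> H p :: real
  assumes "prob_space M"
    and "1/3 < H" and "H \<le> 1/2"
    and "2 < p" and "p < 3" and "1/H < p"
    and "transpose \<Gamma> = \<Gamma>" and "\<forall>v. v \<noteq> 0 \<longrightarrow> 0 < v \<bullet> (\<Gamma> *v v)"
    and "fractional_brownian_motion M H B"
    and "fractional_ou M \<Gamma> \<sigma> B X"
    and "AE w in M. canonical_lift p (\<lambda>t. B t w) (BB w)"
    and "AE w in M. stratonovich_lift p \<Gamma> \<sigma> (\<lambda>t. B t w) (BB w) (\<lambda>t. X t w) (XX w)"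
  shows "AE w in M.
    ((\<lambda>t. (1/t) *\<^sub>R stratonovich_integral (\<lambda>t. X t w) (XX w) t) \<longlongrightarrow> 0) at_top"
proof -
  obtain E where E: "finite E" "span E = UNIV" "pairwise orthogonal E"
    "\<And>u. u \<in> E \<Longrightarrow> norm u = 1" "\<And>u. u \<in> E \<Longrightarrow> \<exists>c. \<Gamma> *v u = c *\<^sub>R u"
    using symmetric_matrix_eigenbasis[OF assms(7)] by blast
  \<comment> \<open>On a unit eigenvector the quadratic form is the eigenvalue, and definiteness
    makes it positive.\<close>
  define ev where "ev u = u \<bullet> (\<Gamma> *v u)" for u
  have ev: "\<Gamma> *v u = ev u *\<^sub>R u" "0 < ev u" if u: "u \<in> E" for u
  proof -
    obtain c where c: "\<Gamma> *v u = c *\<^sub>R u" using E(5)[OF u] by blast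
    have "u \<bullet> u = 1" using E(4)[OF u] by (simp add: norm_eq_1)
    with c show "\<Gamma> *v u = ev u *\<^sub>R u" by (simp add: ev_def)
    have "u \<noteq> 0" using E(4)[OF u] by auto
    then show "0 < ev u" using assms(8) by (simp add: ev_def)
  qed
  have fgs: "fractional_gaussian_space M (fbm_span B) H"
    by (rule fractional_gaussian_space_fbm_span[OF assms(1-3,9)])
  define Q where "Q u v w = (\<forall>x N. good_path (ev u) \<sigma> (\<lambda>t. u \<bullet> B t w) (\<lambda>t. v \<bullet> B t w) x N \<longrightarrow>
    ((\<lambda>t. N t / t) \<longlongrightarrow> 0) at_top)" for u v w
  have "AE w in M. Q u v w" if uv: "u \<in> E" "v \<in> E" "u \<noteq> v" for u v
  proof -
    have "u \<bullet> v = 0" using E(3) uv unfolding pairwise_def orthogonal_def by blast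
    then have "fbm_pair M (fbm_span B) H (\<lambda>t w. u \<bullet> B t w) (\<lambda>t w. v \<bullet> B t w)"
      using uv E(4) by (intro fbm_pair_projections[OF assms(1-3,9)]) auto
    from fbm_pair.good_path_sublinear[OF this ev(2)[OF uv(1)]]
    show ?thesis unfolding Q_def .
  qed
  then have "AE w in M. \<forall>u\<in>E. \<forall>v\<in>E. u \<noteq> v \<longrightarrow> Q u v w"
    using E(1) by (simp add: AE_finite_all)
  moreover have "AE w in M. \<forall>x. continuous_on {0..} (\<lambda>t. u \<bullet> B t w) \<and> ou_path (ev u) \<sigma> x (\<lambda>t. u \<bullet> B t w) \<longrightarrow>
      (\<exists>C\<ge>0. \<forall>t\<ge>0. \<bar>x t\<bar> \<le> C * (t + 1) powr (5/16))" if u: "u \<in> E" for u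
  proof (rule fractional_gaussian_space.ou_growth[OF fgs])
    have "u \<bullet> u = 1" using E(4)[OF u] by (simp add: norm_eq_1)
    then show "fractional_gaussian_space.fbm_coordinate M (fbm_span B) H (\<lambda>t w. u \<bullet> B t w)"
      unfolding fractional_gaussian_space.fbm_coordinate_def[OF fgs]
      by (simp add: fbm_span_inner fbm_covariance[OF assms(1,9)])
  qed
  then have "AE w in M. \<forall>u\<in>E. \<forall>x. continuous_on {0..} (\<lambda>t. u \<bullet> B t w) \<and> ou_path (ev u) \<sigma> x (\<lambda>t. u \<bullet> B t w) \<longrightarrow>
      (\<exists>C\<ge>0. \<forall>t\<ge>0. \<bar>x t\<bar> \<le> C * (t + 1) powr (5/16))"
    using E(1) by (simp add: AE_finite_all)
  moreover have "AE w in M. continuous_on {0..} (\<lambda>t. B t w)"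
    using assms(9) unfolding fractional_brownian_motion_def by blast
  moreover have "AE w in M. continuous_on {0..} (\<lambda>t. X t w) \<and> X 0 w = 0 \<and>
        (\<forall>t\<ge>0. X t w - X 0 w = - integral {0..t} (\<lambda>s. \<Gamma> *v X s w) + \<sigma> *\<^sub>R (B t w - B 0 w))"
    using assms(10) unfolding fractional_ou_def by blast
  moreover note assms(11,12)
  ultimately show ?thesis
  proof eventually_elim
    case (elim w)
    interpret stratonovich_path p \<sigma> \<Gamma> "\<lambda>t. B t w" "\<lambda>t. X t w" "BB w" "XX w"
      by unfold_locales (use elim assms(4,7) in auto)
    have ou: "ou_path (ev u) \<sigma> (\<lambda>t. u \<bullet> X t w) (\<lambda>t. u \<bullet> B t w)" if u: "u \<in> E" for u
      by unfold_locales (use ev[OF u] x0 cont_component component_increment[OF ev(1)[OF u]] in auto)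
    have sq: "((\<lambda>t. (u \<bullet> X t w)\<^sup>2 / t) \<longlongrightarrow> 0) at_top" if u: "u \<in> E" for u
    proof -
      obtain C where "0 \<le> C" "\<And>t. 0 \<le> t \<Longrightarrow> \<bar>u \<bullet> X t w\<bar> \<le> C * (t + 1) powr (5/16)"
        using elim(2)[THEN bspec, OF u, THEN spec, THEN mp, OF conjI[OF cont_component(2) ou[OF u]]] by blast
      then show ?thesis by (rule square_sublinear)
    qed
    have noise: "((\<lambda>t. noise_integral (ev v) u v t / t) \<longlongrightarrow> 0) at_top" if "u \<in> E" "v \<in> E" "u \<noteq> v" for u v
    proof -
      have "good_path (ev u) \<sigma> (\<lambda>t. u \<bullet> B t w) (\<lambda>t. v \<bullet> B t w) (\<lambda>t. u \<bullet> X t w) (noise_integral (ev v) u v)"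
        by (intro good_path_noise_integral ev that)
      moreover have "Q u v w" using elim(1) that by blast
      ultimately show ?thesis unfolding Q_def by blast
    qed
    have lim: "((\<lambda>t. u \<bullet> (((1/t) *\<^sub>R XX w 0 t) *v v)) \<longlongrightarrow> 0) at_top" if uv: "u \<in> E" "v \<in> E" for u v
    proof -
      have "((\<lambda>t. area u v t / t) \<longlongrightarrow> 0) at_top"
      proof (cases "u = v")
        case True
        have lim: "((\<lambda>t. (1/2) * ((u \<bullet> X t w)\<^sup>2 / t)) \<longlongrightarrow> (1/2) * 0) at_top"
          by (intro tendsto_mult tendsto_const sq uv)
        have "\<forall>\<^sub>F t in at_top. (1/2) * ((u \<bullet> X t w)\<^sup>2 / t) = area u v t / t"
          using eventually_gt_at_top[of 0]
        proof eventually_elim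
          case (elim t)
          have "area u v t = (u \<bullet> X t w)\<^sup>2 / 2"
            using area_symmetric_part[OF elim, of u u] True by (simp add: power2_eq_square)
          then show ?case by (simp only:)
        qed
        from Lim_transform_eventually[OF lim this] show ?thesis by simp
      next
        case False
        then show ?thesis
          using uv by (intro area_sublinear[of "ev u" "ev v"] noise sq ev) auto
      qed
      then show ?thesis
        by (simp add: area_def scaleR_matrix_vector_assoc[symmetric])
    qed
    have "((\<lambda>t. (1/t) *\<^sub>R XX w 0 t) \<longlongrightarrow> 0) at_top"
      by (rule tendsto_matrix_eigenbasis[OF E(1,2) lim])
    moreover have "\<forall>\<^sub>F t in at_top. (1/t) *\<^sub>R XX w 0 t = (1/t) *\<^sub>R stratonovich_integral (\<lambda>t. X t w) (XX w) t"
      using eventually_gt_at_top[of 0]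
    proof eventually_elim
      case (elim t)
      then show ?case
        using stratonovich_integral_eq[OF stratonovich_lift_rough_path[OF strat elim] elim order_refl] x0
        by (simp add: tensor_def vec_eq_iff)
    qed
    ultimately show ?case by (rule Lim_transform_eventually)
  qed
qed

end
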